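(* Let $X$ be a radiant toric variety. The nilpotency class of $U_{\max}$ equals $l+1$, where $l$ is the length of the longest path in $\Gamma(\mathfrak R^+)$.
   Context: $\mathbb K$ is an algebraically closed field of characteristic zero. $X$ is a complete toric variety of dimension $n$ with acting torus $T$; $N\cong\mathbb Z^n$ is the lattice of one-parameter subgroups of $T$, $M=\mathrm{Hom}(N,\mathbb Z)$, $\langle\cdot,\cdot\rangle$ is the pairing, $\Sigma$ is the fan of $X$, with rays having primitive generators $p_1,\dots,p_m$. $\mathrm{Aut}(X)$ is a linear algebraic group with maximal torus $T$. $X$ is radiant if a maximal unipotent subgroup of $\mathrm{Aut}(X)$ acts on $X$ with an open orbit; it is known that this holds iff $\Sigma$ is bilateral, i.e. up to renumbering $p_1,\dots,p_n$ is a basis of $N$ and $p_k=-\sum_{j=1}^n a_{kj}p_j$ with $a_{kj}\in\mathbb Z_{\ge0}$ for $n<k\le m$. Fix such a numbering; $q_1,\dots,q_n$ is the dual basis of $M$ and $C=\{1,\dots,n\}$. Demazure roots: $\mathfrak R_i=\{e\in M:\langle e,p_i\rangle=-1,\ \langle e,p_s\rangle\ge0\ \forall s\ne i\}$, $\mathfrak R=\bigsqcup_{i=1}^m\mathfrak R_i$; $\mathfrak S=\mathfrak R\cap(-\mathfrak R)$, $\mathfrak U=\mathfrak R\setminus\mathfrak S$. Root subgroups: the Cox ring of $X$ is $\mathbb K[x_1,\dots,x_m]$, graded by $\mathrm{Cl}(X)$ with $\deg x_l=[D_l]$, the class of the $T$-invariant prime divisor of the $l$-th ray. For $e\in\mathfrak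 R_i$ let $\partial_e=\big(\prod_{s\ne i}x_s^{\langle e,p_s\rangle}\big)\frac{\partial}{\partial x_i}$, a homogeneous locally nilpotent derivation; the graded automorphisms $\exp(\alpha\partial_e)$, $\alpha\in\mathbb K$, descend to a one-parameter unipotent subgroup $U_e\subseteq\mathrm{Aut}(X)$ through the Cox quotient construction of $X$. Preorder on $C$: $i\succeq j$ iff $a_{ki}\ge a_{kj}$ for all $n<k\le m$; $i\asymp j$ iff equality holds for all such $k$. The numbering is chosen so that the $\asymp$-classes $C_1,\dots,C_r$ satisfy: $C_l\succ C_s$ implies $l<s$, and $C_s=\{c_{s-1}+1,\dots,c_s\}$ for some $0=c_0<c_1<\dots<c_r=n$. Fix $v\in N$ with $\langle q_1,v\rangle<\dots<\langle q_n,v\rangle<0$; put $\mathfrak R^+=\{e\in\mathfrak S:\langle e,v\rangle>0\}\sqcup\mathfrak U$ and let $U_{\max}$ be the subgroup generated by all $U_e$, $e\in\mathfrak R^+$; it is a maximal unipotent subgroup of $\mathrm{Aut}(X)$, and $\mathfrak R^+$ is exactly the set of $e\in\mathfrak R$ with $U_e\subseteq U_{\max}$. $\Gamma(\mathfrak R^+)$ is the directed graph with vertex set $\mathfrak R^+$ and an arrow from $a$ to $b$ iff $b=a+e$ for some $e\in\mathfrak R^+$; it is acyclic. The length of a path is its number of arrows. *)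

theory Defs
  imports
    "HOL-Analysis.Analysis"
    "HOL-Algebra.Bij"
    "HOL-Algebra.Generated_Groups"
    "HOL-Library.Poly_Mapping"
    "HOL-Computational_Algebra.Polynomial"
    "Graph_Theory.Arc_Walk"
begin

section \<open>Lattices and fans\<close>

text \<open>
  Both lattices \<open>N\<close> and \<open>M = Hom(N, \<int>)\<close> are rendered as integer vectors of length
  \<open>n = CARD('n)\<close>; \<open>M\<close> acts on \<open>N\<close> through \<open>pairing\<close>, its argument from \<open>M\<close> coming first.
  Cones live in \<open>N \<otimes> \<real>\<close>, rendered as real vectors.
\<close>

definition pairing :: "int ^ 'n \<Rightarrow> int ^ 'n \<Rightarrow> int" where
  "pairing u w = (\<Sum>i\<in>UNIV. u $ i * w $ i)"

definition real_vec :: "int ^ 'n \<Rightarrow> real ^ 'n" where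
  "real_vec w = (\<chi> i. of_int (w $ i))"

definition rational_cone :: "(real ^ 'n) set \<Rightarrow> bool" where
  "rational_cone \<sigma> \<longleftrightarrow> (\<exists>S. finite S \<and> \<sigma> = convex_cone hull (real_vec ` S))"

definition strongly_convex :: "(real ^ 'n) set \<Rightarrow> bool" where
  "strongly_convex \<sigma> \<longleftrightarrow> \<sigma> \<inter> uminus ` \<sigma> = {0}"

text \<open>
  The library's \<open>face_of\<close> admits the empty face, which is not a cone and has to be excluded.
\<close>

definition fan :: "(real ^ 'n) set set \<Rightarrow> bool" where
  "fan \<Sigma> \<longleftrightarrow> finite \<Sigma> \<and> \<Sigma> \<noteq> {} \<and>
     (\<forall>\<sigma>\<in>\<Sigma>. rational_cone \<sigma> \<and> strongly_convex \<sigma>) \<and>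
     (\<forall>\<sigma>\<in>\<Sigma>. \<forall>\<tau>. \<tau> face_of \<sigma> \<and> \<tau> \<noteq> {} \<longrightarrow> \<tau> \<in> \<Sigma>) \<and>
     (\<forall>\<sigma>\<in>\<Sigma>. \<forall>\<tau>\<in>\<Sigma>. (\<sigma> \<inter> \<tau>) face_of \<sigma>)"

definition complete_fan :: "(real ^ 'n) set set \<Rightarrow> bool" where
  "complete_fan \<Sigma> \<longleftrightarrow> fan \<Sigma> \<and> \<Union>\<Sigma> = UNIV"

definition primitive :: "int ^ 'n \<Rightarrow> bool" where
  "primitive w \<longleftrightarrow> (\<forall>d w'. w = d *s w' \<longrightarrow> \<bar>d\<bar> = 1)"

definition ray_generators :: "(real ^ 'n) set set \<Rightarrow> nat \<Rightarrow> (nat \<Rightarrow> int ^ 'n) \<Rightarrow> bool" where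
  "ray_generators \<Sigma> m p \<longleftrightarrow>
     (\<forall>l\<in>{1..m}. primitive (p l)) \<and>
     bij_betw (\<lambda>l. convex_cone hull {real_vec (p l)}) {1..m} {\<rho>\<in>\<Sigma>. dim \<rho> = 1}"

definition lattice_basis :: "nat \<Rightarrow> (nat \<Rightarrow> int ^ 'n) \<Rightarrow> bool" where
  "lattice_basis n p \<longleftrightarrow>
     (\<forall>w. \<exists>!c. (\<forall>i. i \<notin> {1..n} \<longrightarrow> c i = 0) \<and> w = (\<Sum>i=1..n. c i *s p i))"

definition bilateral_numbering ::
    "nat \<Rightarrow> nat \<Rightarrow> (nat \<Rightarrow> int ^ 'n) \<Rightarrow> (nat \<Rightarrow> nat \<Rightarrow> nat) \<Rightarrow> bool" where
  "bilateral_numbering n m p a \<longleftrightarrow> n \<le> m \<and> lattice_basis n p \<and>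
     (\<forall>k\<in>{n<..m}. p k = - (\<Sum>j=1..n. int (a k j) *s p j))"

definition dual_basis :: "nat \<Rightarrow> (nat \<Rightarrow> int ^ 'n) \<Rightarrow> (nat \<Rightarrow> int ^ 'n) \<Rightarrow> bool" where
  "dual_basis n p q \<longleftrightarrow>
     (\<forall>i\<in>{1..n}. \<forall>j\<in>{1..n}. pairing (q i) (p j) = (if i = j then 1 else 0))"

section \<open>The toric variety of a fan\<close>

definition dual_monoid :: "(real ^ 'n) set \<Rightarrow> (int ^ 'n) set" where
  "dual_monoid \<sigma> = {u. \<forall>x\<in>\<sigma>. 0 \<le> real_vec u \<bullet> x}"

definition perp_lattice :: "(real ^ 'n) set \<Rightarrow> (int ^ 'n) set" where
  "perp_lattice \<sigma> = {u. \<forall>x\<in>\<sigma>. real_vec u \<bullet> x = 0}"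

text \<open>
  By the orbit-cone correspondence the set of closed points of \<open>X\<close> is the disjoint union over
  \<open>\<tau> \<in> \<Sigma>\<close> of the torus orbits \<open>O(\<tau>) = Hom(\<tau>\<^sup>\<bottom> \<inter> M, K\<^sup>*)\<close>.  A point of \<open>O(\<tau>)\<close> is encoded as
  \<open>(\<tau>, \<gamma>)\<close> with \<open>\<gamma>\<close> extended by \<open>0\<close> outside \<open>\<tau>\<^sup>\<bottom>\<close>.  The affine chart \<open>U\<^sub>\<sigma> = Spec K[\<sigma>\<^sup>\<or> \<inter> M]\<close> is
  the union of the \<open>O(\<tau>)\<close> with \<open>\<tau>\<close> a face of \<open>\<sigma>\<close> (equivalently, \<open>\<tau> \<in> \<Sigma>\<close> and \<open>\<tau> \<subseteq> \<sigma>\<close>), and for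
  \<open>u \<in> \<sigma>\<^sup>\<or> \<inter> M\<close> the value of the character \<open>\<chi>\<^sup>u\<close> at \<open>(\<tau>, \<gamma>) \<in> U\<^sub>\<sigma>\<close> is \<open>\<gamma> u\<close>: restricted to
  \<open>\<sigma>\<^sup>\<or> \<inter> M\<close>, \<open>\<gamma>\<close> is the monoid homomorphism to \<open>(K, \<cdot>)\<close> that corresponds to the point.
\<close>

type_synonym ('n, 'k) toric_point = "(real ^ 'n) set \<times> (int ^ 'n \<Rightarrow> 'k)"

definition toric_points :: "(real ^ 'n) set set \<Rightarrow> ('n, 'k::field) toric_point set" where
  "toric_points \<Sigma> = {(\<tau>, \<gamma>). \<tau> \<in> \<Sigma> \<and> \<gamma> 0 = 1 \<and>
     (\<forall>u\<in>perp_lattice \<tau>. \<forall>w\<in>perp_lattice \<tau>. \<gamma> (u + w) = \<gamma> u * \<gamma> w) \<and>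
     (\<forall>u. u \<notin> perp_lattice \<tau> \<longrightarrow> \<gamma> u = 0)}"

definition affine_chart ::
    "(real ^ 'n) set set \<Rightarrow> (real ^ 'n) set \<Rightarrow> ('n, 'k::field) toric_point set" where
  "affine_chart \<Sigma> \<sigma> = {x \<in> toric_points \<Sigma>. fst x \<subseteq> \<sigma>}"

text \<open>\<open>K[\<sigma>\<^sup>\<or> \<inter> M]\<close> as functions; only their values on \<open>affine_chart \<Sigma> \<sigma>\<close> are meaningful.\<close>

definition coordinate_ring ::
    "(real ^ 'n) set \<Rightarrow> (('n, 'k::field) toric_point \<Rightarrow> 'k) set" where
  "coordinate_ring \<sigma> =
     {f. \<exists>A c. finite A \<and> A \<subseteq> dual_monoid \<sigma> \<and> f = (\<lambda>x. \<Sum>u\<in>A. c u * snd x u)}"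

definition zariski_topology ::
    "(real ^ 'n) set set \<Rightarrow> ('n, 'k::field) toric_point topology" where
  "zariski_topology \<Sigma> = topology_generated_by
     {{x \<in> affine_chart \<Sigma> \<sigma>. f x \<noteq> 0} | \<sigma> f. \<sigma> \<in> \<Sigma> \<and> f \<in> coordinate_ring \<sigma>}"

definition regular_on ::
    "(real ^ 'n) set set \<Rightarrow> ('n, 'k::field) toric_point set \<Rightarrow>
     (('n, 'k) toric_point \<Rightarrow> 'k) \<Rightarrow> bool" where
  "regular_on \<Sigma> V h \<longleftrightarrow>
     (\<forall>y\<in>V. \<exists>\<sigma>\<in>\<Sigma>. \<exists>f\<in>coordinate_ring \<sigma>. \<exists>g\<in>coordinate_ring \<sigma>. \<exists>W.
        openin (zariski_topology \<Sigma>) W \<and> y \<in> W \<and> W \<subseteq> V \<inter> affine_chart \<Sigma> \<sigma> \<and>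
        (\<forall>z\<in>W. g z \<noteq> 0 \<and> h z = f z / g z))"

definition toric_morphism ::
    "(real ^ 'n) set set \<Rightarrow> (('n, 'k::field) toric_point \<Rightarrow> ('n, 'k) toric_point) \<Rightarrow> bool" where
  "toric_morphism \<Sigma> \<phi> \<longleftrightarrow>
     continuous_map (zariski_topology \<Sigma>) (zariski_topology \<Sigma>) \<phi> \<and>
     (\<forall>V h. openin (zariski_topology \<Sigma>) V \<and> regular_on \<Sigma> V h \<longrightarrow>
        regular_on \<Sigma> {x \<in> toric_points \<Sigma>. \<phi> x \<in> V} (h \<circ> \<phi>))"

text \<open>
  Here "toric" only refers to the variety: the morphisms and automorphisms need not respect
  the torus action.
\<close>

definition Aut_variety ::
    "(real ^ 'n) set set \<Rightarrow> (('n, 'k::field) toric_point \<Rightarrow> ('n, 'k) toric_point) monoid" where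
  "Aut_variety \<Sigma> = (BijGroup (toric_points \<Sigma>))
     \<lparr>carrier := {\<phi> \<in> Bij (toric_points \<Sigma>). toric_morphism \<Sigma> \<phi> \<and>
        toric_morphism \<Sigma> (restrict (inv_into (toric_points \<Sigma>) \<phi>) (toric_points \<Sigma>))}\<rparr>"

section \<open>Cox construction\<close>

text \<open>
  Points of \<open>K\<^sup>m\<close> are functions on \<open>nat\<close> of which only the values on \<open>{1..m}\<close> matter.
  \<open>cox_space\<close> is the complement of the zero locus of the irrelevant ideal.  On the chart of
  \<open>\<sigma>\<close> the quotient morphism \<open>cox_map\<close> is given by \<open>\<chi>\<^sup>u \<mapsto> \<Prod>\<^sub>l x\<^sub>l\<^bsup>\<langle>u, p\<^sub>l\<rangle>\<^esup>\<close> for \<open>u \<in> \<sigma>\<^sup>\<or> \<inter> M\<close>; hence \<open>x\<close>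
  lands in the orbit of the smallest cone \<open>\<tau>\<close> containing all \<open>p\<^sub>l\<close> with \<open>x\<^sub>l = 0\<close>.  For
  \<open>u \<in> \<tau>\<^sup>\<bottom>\<close> the exponent of each vanishing \<open>x\<^sub>l\<close> is \<open>0\<close>, so that factor is \<open>1\<close>.
\<close>

definition cox_space ::
    "(real ^ 'n) set set \<Rightarrow> nat \<Rightarrow> (nat \<Rightarrow> int ^ 'n) \<Rightarrow> (nat \<Rightarrow> 'k::field) set" where
  "cox_space \<Sigma> m p = {x. \<exists>\<sigma>\<in>\<Sigma>. \<forall>l\<in>{1..m}. x l = 0 \<longrightarrow> real_vec (p l) \<in> \<sigma>}"

definition cox_cone ::
    "(real ^ 'n) set set \<Rightarrow> nat \<Rightarrow> (nat \<Rightarrow> int ^ 'n) \<Rightarrow> (nat \<Rightarrow> 'k::field) \<Rightarrow> (real ^ 'n) set" where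
  "cox_cone \<Sigma> m p x = \<Inter>{\<sigma>\<in>\<Sigma>. \<forall>l\<in>{1..m}. x l = 0 \<longrightarrow> real_vec (p l) \<in> \<sigma>}"

definition cox_map ::
    "(real ^ 'n) set set \<Rightarrow> nat \<Rightarrow> (nat \<Rightarrow> int ^ 'n) \<Rightarrow> (nat \<Rightarrow> 'k::field) \<Rightarrow>
     ('n, 'k) toric_point" where
  "cox_map \<Sigma> m p x = (cox_cone \<Sigma> m p x,
     \<lambda>u. if u \<in> perp_lattice (cox_cone \<Sigma> m p x)
          then \<Prod>l=1..m. x l powi pairing u (p l) else 0)"

text \<open>
  Polynomials in variables indexed by \<open>nat\<close>: finitely supported maps from exponent vectors
  to coefficients.  The Cox ring is the subring of polynomials in the variables \<open>1, \<dots>, m\<close>.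
\<close>

type_synonym 'k mpoly = "(nat \<Rightarrow>\<^sub>0 nat) \<Rightarrow>\<^sub>0 'k"

definition mvar :: "nat \<Rightarrow> 'k::field mpoly" where
  "mvar l = Poly_Mapping.single (Poly_Mapping.single l 1) 1"

definition meval :: "(nat \<Rightarrow> 'k::field) \<Rightarrow> 'k mpoly \<Rightarrow> 'k" where
  "meval x f = (\<Sum>t\<in>Poly_Mapping.keys f. Poly_Mapping.lookup f t *
     (\<Prod>l\<in>Poly_Mapping.keys t. x l ^ Poly_Mapping.lookup t l))"

definition mpderiv :: "nat \<Rightarrow> 'k::field mpoly \<Rightarrow> 'k mpoly" where
  "mpderiv i f = (\<Sum>t\<in>Poly_Mapping.keys f.
     Poly_Mapping.single (t - Poly_Mapping.single i 1) (of_nat (Poly_Mapping.lookup t i) * Poly_Mapping.lookup f t))"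

text \<open>The index set of the sum is finite whenever \<open>D\<close> is linear and locally nilpotent.\<close>

definition exp_derivation ::
    "('k::field_char_0 mpoly \<Rightarrow> 'k mpoly) \<Rightarrow> 'k \<Rightarrow> 'k mpoly \<Rightarrow> 'k mpoly" where
  "exp_derivation D \<alpha> f =
     (\<Sum>j | (D ^^ j) f \<noteq> 0. Poly_Mapping.single 0 (\<alpha> ^ j / fact j) * (D ^^ j) f)"

text \<open>The map on points \<open>x \<mapsto> (F(x\<^sub>l)(x))\<^sub>l\<close> dual to an endomorphism \<open>F\<close> of the polynomial ring.\<close>

definition point_map :: "('k::field mpoly \<Rightarrow> 'k mpoly) \<Rightarrow> (nat \<Rightarrow> 'k) \<Rightarrow> nat \<Rightarrow> 'k" where
  "point_map F x = (\<lambda>l. meval x (F (mvar l)))"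

section \<open>Demazure roots and root subgroups\<close>

definition demazure_roots_at :: "nat \<Rightarrow> (nat \<Rightarrow> int ^ 'n) \<Rightarrow> nat \<Rightarrow> (int ^ 'n) set" where
  "demazure_roots_at m p i =
     {e. pairing e (p i) = -1 \<and> (\<forall>s\<in>{1..m} - {i}. 0 \<le> pairing e (p s))}"

definition demazure_roots :: "nat \<Rightarrow> (nat \<Rightarrow> int ^ 'n) \<Rightarrow> (int ^ 'n) set" where
  "demazure_roots m p = (\<Union>i\<in>{1..m}. demazure_roots_at m p i)"

definition semisimple_roots :: "nat \<Rightarrow> (nat \<Rightarrow> int ^ 'n) \<Rightarrow> (int ^ 'n) set" where
  "semisimple_roots m p = demazure_roots m p \<inter> uminus ` demazure_roots m p"

definition unipotent_roots :: "nat \<Rightarrow> (nat \<Rightarrow> int ^ 'n) \<Rightarrow> (int ^ 'n) set" where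
  "unipotent_roots m p = demazure_roots m p - semisimple_roots m p"

definition positive_roots :: "nat \<Rightarrow> (nat \<Rightarrow> int ^ 'n) \<Rightarrow> int ^ 'n \<Rightarrow> (int ^ 'n) set" where
  "positive_roots m p v = {e \<in> semisimple_roots m p. pairing e v > 0} \<union> unipotent_roots m p"

definition root_derivation ::
    "nat \<Rightarrow> (nat \<Rightarrow> int ^ 'n) \<Rightarrow> nat \<Rightarrow> int ^ 'n \<Rightarrow> 'k::field mpoly \<Rightarrow> 'k mpoly" where
  "root_derivation m p i e f =
     (\<Prod>s\<in>{1..m} - {i}. mvar s ^ nat (pairing e (p s))) * mpderiv i f"

text \<open>
  \<open>U\<^sub>e\<close> consists of the automorphisms of \<open>X\<close> induced through \<open>cox_map\<close> by the \<open>exp(\<alpha> \<partial>\<^sub>e)\<close>.  The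
  index \<open>i\<close> is determined by the root \<open>e\<close>.
\<close>

definition root_subgroup ::
    "(real ^ 'n) set set \<Rightarrow> nat \<Rightarrow> (nat \<Rightarrow> int ^ 'n) \<Rightarrow> int ^ 'n \<Rightarrow>
     (('n, 'k::field_char_0) toric_point \<Rightarrow> ('n, 'k) toric_point) set" where
  "root_subgroup \<Sigma> m p e = {\<phi> \<in> carrier (Aut_variety \<Sigma>).
     \<exists>i\<in>{1..m}. e \<in> demazure_roots_at m p i \<and>
       (\<exists>\<alpha>. \<forall>x\<in>cox_space \<Sigma> m p.
          let y = point_map (exp_derivation (root_derivation m p i e) \<alpha>) x
          in y \<in> cox_space \<Sigma> m p \<and> \<phi> (cox_map \<Sigma> m p x) = cox_map \<Sigma> m p y)}"

definition U_max ::
    "(real ^ 'n) set set \<Rightarrow> nat \<Rightarrow> (nat \<Rightarrow> int ^ 'n) \<Rightarrow> int ^ 'n \<Rightarrow>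
     (('n, 'k::field_char_0) toric_point \<Rightarrow> ('n, 'k) toric_point) monoid" where
  "U_max \<Sigma> m p v = (Aut_variety \<Sigma>)
     \<lparr>carrier := generate (Aut_variety \<Sigma>)
        (\<Union>e\<in>positive_roots m p v. root_subgroup \<Sigma> m p e)\<rparr>"

section \<open>Numbering of the basis\<close>

definition dominates :: "nat \<Rightarrow> nat \<Rightarrow> (nat \<Rightarrow> nat \<Rightarrow> nat) \<Rightarrow> nat \<Rightarrow> nat \<Rightarrow> bool" where
  "dominates n m a i j \<longleftrightarrow> (\<forall>k\<in>{n<..m}. a k i \<ge> a k j)"

definition class_numbering ::
    "nat \<Rightarrow> nat \<Rightarrow> (nat \<Rightarrow> nat \<Rightarrow> nat) \<Rightarrow> nat \<Rightarrow> (nat \<Rightarrow> nat) \<Rightarrow> bool" where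
  "class_numbering n m a r c \<longleftrightarrow>
     c 0 = 0 \<and> c r = n \<and> strict_mono_on {0..r} c \<and>
     {1..n} // {(i, j). i \<in> {1..n} \<and> j \<in> {1..n} \<and> dominates n m a i j \<and> dominates n m a j i}
       = (\<lambda>s. {c (s - 1) + 1..c s}) ` {1..r} \<and>
     (\<forall>l\<in>{1..r}. \<forall>s\<in>{1..r}.
        (\<forall>i\<in>{c (l - 1) + 1..c l}. \<forall>j\<in>{c (s - 1) + 1..c s}.
           dominates n m a i j \<and> \<not> dominates n m a j i) \<longrightarrow> l < s)"

section \<open>The root graph\<close>

definition root_graph :: "(int ^ 'n) set \<Rightarrow> (int ^ 'n, (int ^ 'n) \<times> (int ^ 'n)) pre_digraph" where
  "root_graph R = \<lparr>verts = R,
     arcs = {(a, b). a \<in> R \<and> b \<in> R \<and> (\<exists>e\<in>R. b = a + e)}, tail = fst, head = snd\<rparr>"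

definition longest_path_length :: "('a, 'b) pre_digraph \<Rightarrow> nat \<Rightarrow> bool" where
  "longest_path_length G l \<longleftrightarrow>
     (\<exists>u P w. pre_digraph.apath G u P w \<and> length P = l) \<and>
     (\<forall>u P w. pre_digraph.apath G u P w \<longrightarrow> length P \<le> l)"

section \<open>Nilpotency class\<close>

text \<open>The indexing of the lower central series starts with \<open>lower_central G 0 = G\<close>.\<close>

primrec lower_central :: "('a, 'b) monoid_scheme \<Rightarrow> nat \<Rightarrow> 'a set" where
  "lower_central G 0 = carrier G"
| "lower_central G (Suc c) = generate G
     {x \<otimes>\<^bsub>G\<^esub> y \<otimes>\<^bsub>G\<^esub> inv\<^bsub>G\<^esub> x \<otimes>\<^bsub>G\<^esub> inv\<^bsub>G\<^esub> y | x y. x \<in> lower_central G c \<and> y \<in> carrier G}"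

definition has_nilpotency_class :: "('a, 'b) monoid_scheme \<Rightarrow> nat \<Rightarrow> bool" where
  "has_nilpotency_class G c \<longleftrightarrow> group G \<and>
     lower_central G c = {\<one>\<^bsub>G\<^esub>} \<and> (\<forall>d<c. lower_central G d \<noteq> {\<one>\<^bsub>G\<^esub>})"

end

theory Submission
  imports Defs
begin

text \<open>
  The proof replaces \<open>U_max\<close> by a group of polynomial substitutions of the Cox space and computes
  there.

  For a root \<open>e\<close> at the ray \<open>i\<close>, the root subgroup consists of the substitutions
  \<open>x\<^sub>i \<mapsto> x\<^sub>i + \<alpha> x\<^sup>e\<close> with \<open>x\<^sup>e = \<Prod>\<^sub>s x\<^sub>s\<^bsup>\<langle>e, p\<^sub>s\<rangle>\<^esup>\<close> taken over \<open>s \<noteq> i\<close>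
  (\<open>exp_root_derivation\<close>).  With the given numbering of the basis, a root is positive iff \<open>i \<le> n\<close> and
  \<open>x\<^sup>e\<close> only involves variables \<open>x\<^sub>s\<close> with \<open>s > i\<close> (\<open>positive_roots_eq\<close>).  Hence products of root
  elements are triangular substitutions \<open>x\<^sub>t \<mapsto> x\<^sub>t + \<Sum>\<^sub>e \<gamma>\<^sub>e x\<^sup>e\<close>, the sum being over the positive
  roots at \<open>t\<close>.

  Let the height of a root be one plus the length of a longest path of the root graph that ends
  in it.  Performing a substitution in the monomial of a root \<open>a\<close> produces monomials of roots
  \<open>a + b\<^sub>1 + b\<^sub>2 + \<dots>\<close>, each reached from \<open>a\<close> along a path, so heights grow
  (\<open>substitute_monomial\<close>).  The substitutions whose coefficients vanish below height \<open>k\<close> therefore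
  form groups \<open>F\<^sub>k\<close> with \<open>[F\<^sub>k, F\<^sub>1] \<subseteq> F\<^sub>k\<^sub>+\<^sub>1\<close>, and \<open>F\<^sub>k\<close> is trivial above the maximal height \<open>l + 1\<close>.
  This bounds the class from above.  For the lower bound, the coefficients of a commutator in the
  lowest height are given by an antisymmetrised pre-Lie product (\<open>commutator_expansion\<close>).  If one of
  the factors is an elementary substitution of a root \<open>e\<close> and \<open>a + e\<close> is a root, exactly one of
  the two opposite terms contributes to the coefficient at \<open>a + e\<close>, with a positive integer factor;
  in characteristic zero it does not vanish (\<open>bracket_coefficient\<close>).  Following a longest path
  yields an element of the last but one term of the lower central series whose coefficient at the
  end of the path is nonzero, and by independence of monomials this element is not the identity.

  It remains to pass between substitutions and automorphisms of the variety.  Every point of the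
  variety has a preimage under the Cox quotient map, because characters of a subgroup of \<open>M\<close> extend
  to \<open>M\<close> over an algebraically closed field (\<open>cox_map_surj\<close>).  A root substitution descends to an
  automorphism: on the chart of a cone that contains \<open>p\<^sub>i\<close> it is polynomial, and on the part
  \<open>1 + \<alpha> \<chi>\<^sup>e \<noteq> 0\<close> of any other chart it multiplies \<open>\<chi>\<^sup>u\<close> by \<open>(1 + \<alpha> \<chi>\<^sup>e)\<^bsup>\<langle>u, p\<^sub>i\<rangle>\<^esup>\<close>; completeness of the fan
  ensures that these open sets cover the variety (\<open>adjacent_cone\<close>, \<open>good_chart_exists\<close>).  Conversely a
  substitution other than the identity moves a point of the open torus orbit (\<open>nontrivial_lift\<close>).
\<close>

section \<open>Rational polyhedral cones\<close>

lemma pairing_add_left: "pairing (u + w) z = pairing u z + pairing w z"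
  by (simp add: pairing_def distrib_right sum.distrib)

lemma pairing_add_right: "pairing z (u + w) = pairing z u + pairing z w"
  by (simp add: pairing_def distrib_left sum.distrib)

lemma pairing_uminus_left: "pairing (- u) z = - pairing u z"
  by (simp add: pairing_def sum_negf)

lemma pairing_diff_left: "pairing (u - w) z = pairing u z - pairing w z"
  by (simp add: pairing_def left_diff_distrib sum_subtractf)

lemma pairing_uminus_right: "pairing z (- u) = - pairing z u"
  by (simp add: pairing_def sum_negf)

lemma pairing_zero_left [simp]: "pairing 0 z = 0"
  by (simp add: pairing_def)

lemma pairing_zero_right [simp]: "pairing z 0 = 0"
  by (simp add: pairing_def)

lemma pairing_scale_left: "pairing (d *s u) z = d * pairing u z"
  by (simp add: pairing_def sum_distrib_left mult.assoc)

lemma pairing_scale_right: "pairing z (d *s u) = d * pairing z u"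
  by (simp add: pairing_def sum_distrib_left mult_ac)

lemma pairing_sum_right: "pairing z (\<Sum>i\<in>I. f i) = (\<Sum>i\<in>I. pairing z (f i))"
  by (induction I rule: infinite_finite_induct) (auto simp: pairing_add_right)

lemma pairing_sum_left: "pairing (\<Sum>i\<in>I. f i) z = (\<Sum>i\<in>I. pairing (f i) z)"
  by (induction I rule: infinite_finite_induct) (auto simp: pairing_add_left)

lemma inner_real_vec: "real_vec u \<bullet> real_vec w = of_int (pairing u w)"
  by (simp add: real_vec_def pairing_def inner_vec_def)

lemma real_vec_add: "real_vec (u + w) = real_vec u + real_vec w"
  by (simp add: real_vec_def vec_eq_iff)

lemma real_vec_uminus: "real_vec (- u) = - real_vec u"
  by (simp add: real_vec_def vec_eq_iff)

lemma real_vec_zero [simp]: "real_vec 0 = 0"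
  by (simp add: real_vec_def vec_eq_iff)

lemma real_vec_scale: "real_vec (d *s u) = of_int d *\<^sub>R real_vec u"
  by (simp add: real_vec_def vec_eq_iff)

lemma real_vec_eq_iff [simp]: "real_vec u = real_vec w \<longleftrightarrow> u = w"
  by (simp add: real_vec_def vec_eq_iff)

lemma convex_cone_sum:
  assumes "convex_cone C" "\<And>i. i \<in> I \<Longrightarrow> f i \<in> C"
  shows "(\<Sum>i\<in>I. f i) \<in> C"
  using assms(2)
  by (induction I rule: infinite_finite_induct)
     (auto intro: convex_cone_add[OF assms(1)] convex_cone_contains_0[OF assms(1)])

lemma convex_cone_hull_finite:
  assumes "finite S"
  shows "convex_cone hull S = {\<Sum>s\<in>S. c s *\<^sub>R s | c. \<forall>s\<in>S. 0 \<le> c s}" (is "_ = ?H")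
proof (rule hull_unique)
  show "S \<subseteq> ?H"
  proof
    fix s assume "s \<in> S"
    then have "s = (\<Sum>t\<in>S. (if t = s then 1 else 0) *\<^sub>R t)"
      using assms by (simp add: if_distrib[of "\<lambda>c. c *\<^sub>R _"] cong: if_cong)
    then show "s \<in> ?H" by (auto intro!: exI[of _ "\<lambda>t. if t = s then 1 else 0"])
  qed
  show "convex_cone ?H"
    unfolding convex_cone_iff
  proof (intro conjI ballI allI impI)
    show "0 \<in> ?H" by (auto intro!: exI[of _ "\<lambda>_. 0"])
    fix x assume "x \<in> ?H"
    then obtain c where c: "\<forall>s\<in>S. 0 \<le> c s" "x = (\<Sum>s\<in>S. c s *\<^sub>R s)" by blast
    show "a *\<^sub>R x \<in> ?H" if "0 \<le> a" for a
      using c that by (auto simp: scaleR_sum_right intro!: exI[of _ "\<lambda>s. a * c s"])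
    fix y assume "y \<in> ?H"
    then obtain d where d: "\<forall>s\<in>S. 0 \<le> d s" "y = (\<Sum>s\<in>S. d s *\<^sub>R s)" by blast
    show "x + y \<in> ?H"
      using c d by (auto simp: scaleR_left_distrib sum.distrib intro!: exI[of _ "\<lambda>s. c s + d s"])
  qed
  fix C assume C: "S \<subseteq> C" "convex_cone C"
  show "?H \<subseteq> C"
    using C by (auto intro!: convex_cone_sum convex_cone_scaleR)
qed

lemma convex_cone_hull_real_vec:
  assumes "finite S" "x \<in> convex_cone hull (real_vec ` S)"
  shows "\<exists>c. (\<forall>s\<in>S. 0 \<le> c s) \<and> x = (\<Sum>s\<in>S. c s *\<^sub>R real_vec s)"
proof -
  have "inj_on real_vec S" by (auto simp: inj_on_def)
  moreover obtain c where "\<forall>y\<in>real_vec ` S. 0 \<le> c y" "x = (\<Sum>y\<in>real_vec ` S. c y *\<^sub>R y)"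
    using assms(2) unfolding convex_cone_hull_finite[OF finite_imageI[OF assms(1)]] by blast
  ultimately show ?thesis
    by (intro exI[of _ "c \<circ> real_vec"]) (auto simp: sum.reindex)
qed

lemma face_of_cone_add:
  assumes "convex_cone C" "F face_of C" "x \<in> C" "y \<in> C" "x + y \<in> F"
  shows "x \<in> F"
proof -
  have "conic F" using assms(1) by (intro face_of_conic[OF _ assms(2)]) (simp add: convex_cone_def)
  have "2 *\<^sub>R x \<in> F"
  proof (cases "x = y")
    case True
    then show ?thesis using assms(5) by (simp add: scaleR_2)
  next
    case False
    then have "midpoint (2 *\<^sub>R x) (2 *\<^sub>R y) \<in> open_segment (2 *\<^sub>R x) (2 *\<^sub>R y)" by simp
    moreover have "midpoint (2 *\<^sub>R x) (2 *\<^sub>R y) = x + y"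
      by (simp add: midpoint_def algebra_simps)
    ultimately have "x + y \<in> open_segment (2 *\<^sub>R x) (2 *\<^sub>R y)" by simp
    then show ?thesis
      using face_ofD[OF assms(2) _ _ _ assms(5)] convex_cone_scaleR[OF assms(1), of 2] assms(3,4) by simp
  qed
  from conic_mul[OF \<open>conic F\<close> this, of "1/2"] show ?thesis by simp
qed

lemma face_of_cone_sum:
  assumes "convex_cone C" "F face_of C" "finite I" "\<And>i. i \<in> I \<Longrightarrow> f i \<in> C"
    and "(\<Sum>i\<in>I. f i) \<in> F" "j \<in> I"
  shows "f j \<in> F"
proof (rule face_of_cone_add[OF assms(1,2)])
  show "f j + (\<Sum>i\<in>I - {j}. f i) \<in> F" using assms by (simp add: sum.remove)
qed (use assms in \<open>auto intro!: convex_cone_sum\<close>)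

text \<open>
  Strong convexity makes every member of a minimal generating set span a face: if \<open>a\<close>, \<open>b\<close> in the
  cone sum to a multiple of the generator \<open>s\<close>, then either \<open>s\<close> is a combination of the other
  generators, against minimality, or the other generators cancel, against strong convexity.
\<close>

lemma rational_cone_generators_on_rays:
  fixes \<sigma> :: "(real ^ 'n) set"
  assumes "rational_cone \<sigma>" "strongly_convex \<sigma>"
  shows "\<exists>S. finite S \<and> \<sigma> = convex_cone hull (real_vec ` S) \<and>
           (\<forall>s\<in>S. s \<noteq> 0 \<and> (convex_cone hull {real_vec s}) face_of \<sigma>)"
proof -
  obtain S where S: "finite S" "\<sigma> = convex_cone hull (real_vec ` S)"
    and minimal: "\<And>S'. finite S' \<Longrightarrow> \<sigma> = convex_cone hull (real_vec ` S') \<Longrightarrow> card S \<le> card S'"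
  proof -
    have "\<exists>S. finite S \<and> \<sigma> = convex_cone hull (real_vec ` S)"
      using assms(1) unfolding rational_cone_def by blast
    then obtain S0 where "finite S0 \<and> \<sigma> = convex_cone hull (real_vec ` S0)" ..
    from ex_has_least_nat[of "\<lambda>S. finite S \<and> \<sigma> = convex_cone hull (real_vec ` S)", OF this, of card]
    obtain S where "finite S" "\<sigma> = convex_cone hull (real_vec ` S)"
      "\<forall>S'. finite S' \<and> \<sigma> = convex_cone hull (real_vec ` S') \<longrightarrow> card S \<le> card S'" by iprover
    then show ?thesis by (intro that[of S]) iprover+
  qed
  have cone: "convex_cone \<sigma>" using S convex_cone_convex_cone_hull by blast
  have indep: "real_vec s \<notin> convex_cone hull (real_vec ` (S - {s}))" if s: "s \<in> S" for s
  proof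
    assume "real_vec s \<in> convex_cone hull (real_vec ` (S - {s}))"
    then have "real_vec ` S \<subseteq> convex_cone hull (real_vec ` (S - {s}))"
      by (auto intro: hull_inc)
    then have "\<sigma> = convex_cone hull (real_vec ` (S - {s}))"
      unfolding S(2) by (intro subset_antisym hull_minimal hull_mono) (auto intro: convex_cone_convex_cone_hull)
    then have "card S \<le> card (S - {s})" using S(1) by (intro minimal) auto
    then show False using s S(1) card_Diff1_less[of S s] by linarith
  qed
  have nonzero: "s \<noteq> 0" if "s \<in> S" for s
    using indep[OF that] by (auto simp: convex_cone_hull_contains_0)
  have mem: "real_vec s \<in> \<sigma>" if "s \<in> S" for s
    using S that by (auto intro: hull_inc)
  have fin: "finite (real_vec ` (S - {s}))" for s using S by auto
  have repr: "\<exists>c. (\<forall>s\<in>S. 0 \<le> c s) \<and> x = (\<Sum>s\<in>S. c s *\<^sub>R real_vec s)" if "x \<in> \<sigma>"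
    for x
    using that unfolding S(2) by (rule convex_cone_hull_real_vec[OF S(1)])
  have "(convex_cone hull {real_vec s}) face_of \<sigma>" if s: "s \<in> S" for s
    unfolding face_of_def
  proof (intro conjI ballI impI)
    let ?r = "real_vec s"
    have ray: "convex_cone hull {?r} = {c *\<^sub>R ?r | c. 0 \<le> c}"
      by (subst convex_cone_hull_finite) auto
    show "convex_cone hull {?r} \<subseteq> \<sigma>"
      using cone mem s by (intro hull_minimal) auto
    show "convex (convex_cone hull {?r})" by (rule convex_convex_cone_hull)
    have *: "a \<in> convex_cone hull {?r}"
      if ab: "a \<in> \<sigma>" "b \<in> \<sigma>" and u: "0 < u" "u < 1"
        and x: "(1 - u) *\<^sub>R a + u *\<^sub>R b = d *\<^sub>R ?r" for a b u d
    proof -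
      obtain \<alpha> where \<alpha>: "\<forall>t\<in>S. 0 \<le> \<alpha> t" "a = (\<Sum>t\<in>S. \<alpha> t *\<^sub>R real_vec t)" using repr[OF ab(1)] by blast
      obtain \<beta> where \<beta>: "\<forall>t\<in>S. 0 \<le> \<beta> t" "b = (\<Sum>t\<in>S. \<beta> t *\<^sub>R real_vec t)" using repr[OF ab(2)] by blast
      define \<gamma> where "\<gamma> t = (1 - u) * \<alpha> t + u * \<beta> t" for t
      have \<gamma>: "0 \<le> \<gamma> t" if "t \<in> S" for t
        using u \<alpha> \<beta> that by (simp add: \<gamma>_def)
      have "d *\<^sub>R ?r = (\<Sum>t\<in>S. \<gamma> t *\<^sub>R real_vec t)"
        unfolding x[symmetric] \<alpha>(2) \<beta>(2) \<gamma>_def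
        by (simp add: scaleR_sum_right scaleR_left_distrib sum.distrib)
      also have "\<dots> = \<gamma> s *\<^sub>R ?r + (\<Sum>t\<in>S - {s}. \<gamma> t *\<^sub>R real_vec t)"
        using S s by (simp add: sum.remove)
      finally have eq: "(\<Sum>t\<in>S - {s}. \<gamma> t *\<^sub>R real_vec t) = (d - \<gamma> s) *\<^sub>R ?r"
        by (simp add: algebra_simps)
      have "d - \<gamma> s \<le> 0"
      proof (rule ccontr)
        assume "\<not> ?thesis"
        then have pos: "0 < d - \<gamma> s" by simp
        have "(\<Sum>t\<in>S - {s}. \<gamma> t *\<^sub>R real_vec t) \<in> convex_cone hull (real_vec ` (S - {s}))"
          using \<gamma> by (intro convex_cone_sum convex_cone_convex_cone_hull convex_cone_hull_mul hull_inc) auto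
        from convex_cone_hull_mul[OF this[unfolded eq], of "1 / (d - \<gamma> s)"]
        have "?r \<in> convex_cone hull (real_vec ` (S - {s}))" using pos by simp
        then show False using indep[OF s] pos by simp
      qed
      have zero: "\<gamma> t = 0" if t: "t \<in> S - {s}" for t
      proof -
        have "\<gamma> t *\<^sub>R real_vec t + ((\<Sum>t\<in>S - {s} - {t}. \<gamma> t *\<^sub>R real_vec t) + (\<gamma> s - d) *\<^sub>R ?r) = 0"
          using eq t S by (simp add: sum.remove[of "S - {s}" t] algebra_simps)
        moreover have "(\<Sum>t\<in>S - {s} - {t}. \<gamma> t *\<^sub>R real_vec t) + (\<gamma> s - d) *\<^sub>R ?r \<in> \<sigma>"
          using cone \<gamma> mem s \<open>d - \<gamma> s \<le> 0\<close>
          by (intro convex_cone_add convex_cone_sum convex_cone_scaleR) auto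
        ultimately have "\<gamma> t *\<^sub>R real_vec t \<in> uminus ` \<sigma>"
          unfolding eq_neg_iff_add_eq_0[symmetric] by (rule image_eqI)
        moreover have "\<gamma> t *\<^sub>R real_vec t \<in> \<sigma>"
          using cone \<gamma> mem t by (intro convex_cone_scaleR) auto
        ultimately have "\<gamma> t *\<^sub>R real_vec t = 0" using assms(2) unfolding strongly_convex_def by blast
        then show ?thesis using nonzero t by (metis DiffD1 real_vec_eq_iff real_vec_zero scaleR_eq_0_iff)
      qed
      have "\<alpha> t = 0" if t: "t \<in> S - {s}" for t
      proof -
        have "0 \<le> (1 - u) * \<alpha> t" "0 \<le> u * \<beta> t" using u \<alpha> \<beta> t by auto
        then have "(1 - u) * \<alpha> t = 0" using zero[OF t] unfolding \<gamma>_def by linarith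
        then show ?thesis using u by simp
      qed
      then have "a = \<alpha> s *\<^sub>R ?r" unfolding \<alpha>(2) using S s by (simp add: sum.remove)
      then show ?thesis unfolding ray using \<alpha> s by blast
    qed
    fix a b x assume ab: "a \<in> \<sigma>" "b \<in> \<sigma>" and x: "x \<in> convex_cone hull {?r}" "x \<in> open_segment a b"
    then obtain u where u: "0 < u" "u < 1" "x = (1 - u) *\<^sub>R a + u *\<^sub>R b" by (auto simp: in_segment)
    obtain d where d: "x = d *\<^sub>R ?r" using x ray by auto
    show "a \<in> convex_cone hull {?r}" using *[OF ab u(1,2), of d] unfolding u(3)[symmetric] d[symmetric] by simp
    have "(1 - (1 - u)) *\<^sub>R b + (1 - u) *\<^sub>R a = d *\<^sub>R ?r"
      unfolding d[symmetric] u(3) by (simp add: add.commute)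
    then show "b \<in> convex_cone hull {?r}" using *[OF ab(2,1), of "1 - u" d] u by simp
  qed
  then show ?thesis using S nonzero by blast
qed

lemma common_denominator:
  fixes f :: "'i \<Rightarrow> rat"
  assumes "finite I"
  shows "\<exists>d>0. \<forall>i\<in>I. \<exists>z. of_int d * f i = of_int z"
  using assms
proof (induction I rule: finite_induct)
  case empty
  then show ?case by (intro exI[of _ 1]) auto
next
  case (insert i I)
  then obtain d where d: "d > 0" "\<And>i. i \<in> I \<Longrightarrow> \<exists>z. of_int d * f i = of_int z" by auto
  obtain a b where ab: "quotient_of (f i) = (a, b)" by fastforce
  then have b: "b > 0" "f i = of_int a / of_int b" by (rule quotient_of_denom_pos, rule quotient_of_div)
  have "\<exists>z. of_int (b * d) * f j = of_int z" if "j \<in> insert i I" for j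
  proof (cases "j = i")
    case True
    have "of_int (b * d) * f i = of_int (d * a)" using b by simp
    then show ?thesis unfolding True ..
  next
    case False
    then have "j \<in> I" using that by simp
    from d(2)[OF this] obtain z where "of_int d * f j = of_int z" ..
    then have "of_int (b * d) * f j = of_int (b * z)" by (simp add: mult.assoc)
    then show ?thesis ..
  qed
  then show ?case using b d by (intro exI[of _ "b * d"]) auto
qed

text \<open>
  A real solution of integral linear equations and strict inequalities can be made integral.  Write
  the coordinates of \<open>y\<close> in a basis of their \<open>\<rat>\<close>-span.  The equations have rational coefficients, so
  they hold for each basis element separately and survive when the basis elements are replaced by
  rational approximations; the inequalities survive by continuity.
\<close>

lemma integral_functional:
  fixes y :: "real ^ 'n" and S T :: "(int ^ 'n) set"
  assumes "finite S"
    and T: "\<And>t. t \<in> T \<Longrightarrow> y \<bullet> real_vec t = 0" and S: "\<And>s. s \<in> S \<Longrightarrow> 0 < y \<bullet> real_vec s"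
  shows "\<exists>u. (\<forall>t\<in>T. pairing u t = 0) \<and> (\<forall>s\<in>S. 0 < pairing u s)"
proof -
  \<comment> \<open>The reals as a rational vector space.\<close>
  interpret Q: vector_space "\<lambda>(r::rat) (x::real). of_rat r * x"
    by unfold_locales (auto simp: algebra_simps of_rat_add of_rat_mult)
  obtain B where B: "B \<subseteq> range (($) y)" "\<not> Q.dependent B" "range (($) y) \<subseteq> Q.span B"
    using Q.maximal_independent_subset by blast
  have finB: "finite B" using B(1) by (rule finite_subset) simp
  have "\<exists>r. y $ i = (\<Sum>b\<in>B. of_rat (r b) * b)" for i
    using B(3) Q.span_finite[OF finB] by (auto simp: image_iff)
  then obtain r where r: "\<And>i. y $ i = (\<Sum>b\<in>B. of_rat (r i b) * b)" by metis
  \<comment> \<open>The value of \<open>y\<close> at \<open>s\<close> has the rational coordinates \<open>\<rho> s b\<close>.\<close>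
  define \<rho> where "\<rho> s b = (\<Sum>i\<in>UNIV. r i b * of_int (s $ i))" for s b
  have inner: "y \<bullet> real_vec s = (\<Sum>b\<in>B. of_rat (\<rho> s b) * b)" for s
  proof -
    have "y \<bullet> real_vec s = (\<Sum>i\<in>UNIV. \<Sum>b\<in>B. of_rat (r i b * of_int (s $ i)) * b)"
      by (simp add: inner_vec_def real_vec_def r sum_distrib_left sum_distrib_right of_rat_mult mult_ac)
    also have "\<dots> = (\<Sum>b\<in>B. \<Sum>i\<in>UNIV. of_rat (r i b * of_int (s $ i)) * b)" by (rule sum.swap)
    finally show ?thesis by (simp add: \<rho>_def of_rat_sum sum_distrib_right)
  qed
  have \<rho>T: "\<rho> t b = 0" if "t \<in> T" "b \<in> B" for t b
    using inner[of t] T[OF that(1)] B(2) Q.dependent_finite[OF finB] that(2) by auto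
  have "\<forall>k b. \<exists>q. of_rat q < b + 1 / real (Suc k) \<and> b < of_rat q"
    using of_rat_dense[of b "b + 1 / real (Suc k)" for b k] by auto
  from choice[OF allI[OF choice[OF spec[OF this]]]]
  obtain q where "\<forall>k b. of_rat (q k b) < b + 1 / real (Suc k) \<and> b < of_rat (q k b)" ..
  then have q: "\<And>k b. of_rat (q k b) < b + 1 / real (Suc k)" "\<And>k b. b < of_rat (q k b)" by auto
  have lim: "(\<lambda>k. of_rat (q k b)) \<longlonglongrightarrow> b" for b
  proof (rule tendsto_sandwich[of "\<lambda>_. b" _ _ "\<lambda>k. b + 1 / real (Suc k)"])
    show "(\<lambda>k. b + 1 / real (Suc k)) \<longlonglongrightarrow> b"
      using tendsto_add[OF tendsto_const LIMSEQ_inverse_real_of_nat, of b] by (simp add: inverse_eq_divide)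
    show "(\<lambda>k. b) \<longlonglongrightarrow> b" by simp
    show "\<forall>\<^sub>F k in sequentially. b \<le> of_rat (q k b)"
      by (intro always_eventually allI less_imp_le q)
    show "\<forall>\<^sub>F k in sequentially. of_rat (q k b) \<le> b + 1 / real (Suc k)"
      by (intro always_eventually allI less_imp_le q)
  qed
  have "\<forall>\<^sub>F k in sequentially. \<forall>s\<in>S. 0 < (\<Sum>b\<in>B. of_rat (\<rho> s b) * (of_rat (q k b) :: real))"
  proof (rule eventually_ball_finite[OF assms(1)], intro ballI)
    fix s assume "s \<in> S"
    have "(\<lambda>k. \<Sum>b\<in>B. of_rat (\<rho> s b) * (of_rat (q k b) :: real)) \<longlonglongrightarrow> (\<Sum>b\<in>B. of_rat (\<rho> s b) * b)"
      by (intro tendsto_intros lim)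
    then show "\<forall>\<^sub>F k in sequentially. 0 < (\<Sum>b\<in>B. of_rat (\<rho> s b) * (of_rat (q k b) :: real))"
      using S[OF \<open>s \<in> S\<close>] inner by (intro order_tendstoD(1)) auto
  qed
  then obtain k where k: "\<And>s. s \<in> S \<Longrightarrow> 0 < (\<Sum>b\<in>B. of_rat (\<rho> s b) * (of_rat (q k b) :: real))"
    using eventually_happens'[OF sequentially_bot] by blast
  define v where "v i = (\<Sum>b\<in>B. r i b * q k b)" for i
  obtain d where d: "d > 0" "\<forall>i. \<exists>z. of_int d * v i = of_int z"
    using common_denominator[of UNIV v] by auto
  then obtain z where z: "\<And>i. of_int d * v i = of_int (z i)" by metis
  define u where "u = (\<chi> i. z i)"
  have val: "of_int (pairing u s) = of_int d * (\<Sum>b\<in>B. \<rho> s b * q k b)" for s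
  proof -
    have "of_int (pairing u s) = (\<Sum>i\<in>UNIV. of_int d * v i * of_int (s $ i))"
      by (simp add: pairing_def u_def z)
    also have "\<dots> = of_int d * (\<Sum>i\<in>UNIV. \<Sum>b\<in>B. r i b * of_int (s $ i) * q k b)"
      by (simp add: v_def sum_distrib_left sum_distrib_right mult_ac)
    also have "(\<Sum>i\<in>UNIV. \<Sum>b\<in>B. r i b * of_int (s $ i) * q k b) = (\<Sum>b\<in>B. \<Sum>i\<in>UNIV. r i b * of_int (s $ i) * q k b)"
      by (rule sum.swap)
    finally show ?thesis by (simp add: \<rho>_def sum_distrib_right)
  qed
  have "pairing u t = 0" if "t \<in> T" for t
    using val[of t] \<rho>T[OF that] by simp
  moreover have "0 < pairing u s" if "s \<in> S" for s
  proof -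
    have "of_rat (\<Sum>b\<in>B. \<rho> s b * q k b) = (\<Sum>b\<in>B. of_rat (\<rho> s b) * (of_rat (q k b) :: real))"
      by (simp add: of_rat_sum of_rat_mult)
    then have "(0::rat) < (\<Sum>b\<in>B. \<rho> s b * q k b)" using k[OF that] by (metis zero_less_of_rat_iff)
    then have "(0::rat) < of_int (pairing u s)" unfolding val using d(1) by simp
    then show ?thesis by simp
  qed
  ultimately show ?thesis by blast
qed

text \<open>
  Faces of polyhedra are exposed by real functionals; on a rational cone the functional is
  determined by signs on finitely many lattice vectors and can be taken integral.
\<close>

lemma face_exposed_by_character:
  fixes \<sigma> :: "(real ^ 'n) set"
  assumes "rational_cone \<sigma>" "\<nu> face_of \<sigma>" "\<nu> \<noteq> {}"
  shows "\<exists>u\<in>dual_monoid \<sigma>. \<nu> = {x \<in> \<sigma>. real_vec u \<bullet> x = 0}"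
proof -
  obtain S where S: "finite S" "\<sigma> = convex_cone hull (real_vec ` S)"
    using assms(1) unfolding rational_cone_def by blast
  have cone: "convex_cone \<sigma>" using S convex_cone_convex_cone_hull by blast
  have "polyhedron \<sigma>" unfolding S(2) by (intro polyhedron_convex_cone_hull finite_imageI S(1))
  then have "\<nu> exposed_face_of \<sigma>" using exposed_face_of_polyhedron assms(2) by metis
  then obtain a b where ab: "\<sigma> \<subseteq> {x. a \<bullet> x \<le> b}" "\<nu> = \<sigma> \<inter> {x. a \<bullet> x = b}"
    unfolding exposed_face_of_def by metis
  have "conic \<nu>" using cone by (intro face_of_conic[OF _ assms(2)]) (simp add: convex_cone_def)
  then have "0 \<in> \<nu>" using assms(3) by (simp add: conic_contains_0)
  then have "b = 0" using ab by auto
  let ?T = "{s \<in> S. real_vec s \<in> \<nu>}"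
  have mem: "real_vec s \<in> \<sigma>" if "s \<in> S" for s using S that by (auto intro: hull_inc)
  have "\<exists>u. (\<forall>t\<in>?T. pairing u t = 0) \<and> (\<forall>s\<in>S - ?T. 0 < pairing u s)"
  proof (rule integral_functional[of _ _ "- a"])
    fix s assume s: "s \<in> S - ?T"
    then have "a \<bullet> real_vec s \<le> 0" "a \<bullet> real_vec s \<noteq> 0"
      using ab mem[of s] \<open>b = 0\<close> by auto
    then show "0 < - a \<bullet> real_vec s" by simp
  qed (use S ab \<open>b = 0\<close> in auto)
  then obtain u where u: "\<And>t. t \<in> ?T \<Longrightarrow> pairing u t = 0" "\<And>s. s \<in> S - ?T \<Longrightarrow> 0 < pairing u s" by blast
  have nonneg: "0 \<le> pairing u s" if "s \<in> S" for s using u[of s] that by fastforce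
  have repr: "\<exists>c. (\<forall>s\<in>S. 0 \<le> c s) \<and> x = (\<Sum>s\<in>S. c s *\<^sub>R real_vec s)" if "x \<in> \<sigma>"
    for x
    using that unfolding S(2) by (rule convex_cone_hull_real_vec[OF S(1)])
  have val: "w \<bullet> (\<Sum>s\<in>S. c s *\<^sub>R real_vec s) = (\<Sum>s\<in>S. c s * (w \<bullet> real_vec s))"
    for c w
    by (simp add: inner_sum_right)
  have "u \<in> dual_monoid \<sigma>"
    unfolding dual_monoid_def using repr nonneg
    by (force simp: val inner_real_vec intro!: sum_nonneg)
  moreover have "real_vec u \<bullet> x = 0 \<longleftrightarrow> x \<in> \<nu>" if x: "x \<in> \<sigma>" for x
  proof -
    obtain c where c: "\<And>s. s \<in> S \<Longrightarrow> 0 \<le> c s" "x = (\<Sum>s\<in>S. c s *\<^sub>R real_vec s)" using repr[OF x] by blast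
    have "real_vec u \<bullet> x = 0 \<longleftrightarrow> (\<forall>s\<in>S. c s * of_int (pairing u s) = 0)"
      unfolding c(2) val inner_real_vec using c nonneg S by (subst sum_nonneg_eq_0_iff) auto
    also have "\<dots> \<longleftrightarrow> (\<forall>s\<in>S. c s * (a \<bullet> real_vec s) = 0)"
    proof (intro ball_cong refl)
      fix s assume s: "s \<in> S"
      have "pairing u s = 0 \<longleftrightarrow> real_vec s \<in> \<nu>" using u[of s] s by fastforce
      also have "\<dots> \<longleftrightarrow> a \<bullet> real_vec s = 0"
        using ab mem[OF s] \<open>b = 0\<close> by auto
      finally show "c s * of_int (pairing u s) = 0 \<longleftrightarrow> c s * (a \<bullet> real_vec s) = 0" by simp
    qed
    also have "\<dots> \<longleftrightarrow> (\<forall>s\<in>S. c s * (- a \<bullet> real_vec s) = 0)" by simp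
    also have "\<dots> \<longleftrightarrow> - a \<bullet> x = 0"
    proof -
      have "0 \<le> c s * (- a \<bullet> real_vec s)" if "s \<in> S" for s
        using ab(1) mem[OF that] c(1)[OF that] \<open>b = 0\<close> by (intro mult_nonneg_nonneg) auto
      then show ?thesis unfolding c(2) val using S by (subst sum_nonneg_eq_0_iff) auto
    qed
    also have "\<dots> \<longleftrightarrow> x \<in> \<nu>" using ab x \<open>b = 0\<close> by auto
    finally show ?thesis .
  qed
  ultimately show ?thesis using face_of_imp_subset[OF assms(2)] by blast
qed

section \<open>Complete fans\<close>

locale toric_fan =
  fixes \<Sigma> :: "(real ^ 'n) set set" and m :: nat and p :: "nat \<Rightarrow> int ^ 'n"
  assumes complete: "complete_fan \<Sigma>" and rays: "ray_generators \<Sigma> m p"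
begin

lemma fan: "fan \<Sigma>"
  using complete by (simp add: complete_fan_def)

lemma finite_fan: "finite \<Sigma>"
  using fan by (simp add: fan_def)

lemma rational: "\<sigma> \<in> \<Sigma> \<Longrightarrow> rational_cone \<sigma>"
  using fan by (simp add: fan_def)

lemma pointed: "\<sigma> \<in> \<Sigma> \<Longrightarrow> strongly_convex \<sigma>"
  using fan by (simp add: fan_def)

lemma face_in_fan: "\<sigma> \<in> \<Sigma> \<Longrightarrow> \<tau> face_of \<sigma> \<Longrightarrow> \<tau> \<noteq> {} \<Longrightarrow> \<tau> \<in> \<Sigma>"
  using fan by (auto simp: fan_def)

lemma Int_face: "\<sigma> \<in> \<Sigma> \<Longrightarrow> \<tau> \<in> \<Sigma> \<Longrightarrow> (\<sigma> \<inter> \<tau>) face_of \<sigma>"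
  using fan by (simp add: fan_def)

lemma cone: "\<sigma> \<in> \<Sigma> \<Longrightarrow> convex_cone \<sigma>"
  using rational unfolding rational_cone_def by (metis convex_cone_convex_cone_hull)

lemma cone_closed: "\<sigma> \<in> \<Sigma> \<Longrightarrow> closed \<sigma>"
  using rational unfolding rational_cone_def by (metis closed_convex_cone_hull finite_imageI)

lemma zero_in_cone: "\<sigma> \<in> \<Sigma> \<Longrightarrow> 0 \<in> \<sigma>"
  using cone convex_cone_contains_0 by metis

lemma Int_in_fan:
  assumes "\<sigma> \<in> \<Sigma>" "\<tau> \<in> \<Sigma>"
  shows "\<sigma> \<inter> \<tau> \<in> \<Sigma>"
  using zero_in_cone[OF assms(1)] zero_in_cone[OF assms(2)]
  by (intro face_in_fan[OF assms(1) Int_face[OF assms]]) auto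

lemma Inter_in_fan:
  assumes "S \<subseteq> \<Sigma>" "S \<noteq> {}"
  shows "\<Inter>S \<in> \<Sigma>"
proof -
  have "finite S" using assms(1) finite_fan finite_subset by auto
  then show ?thesis using assms(2,1)
    by (induction S rule: finite_ne_induct) (auto intro: Int_in_fan)
qed

text \<open>
  A generator that spans a face spans a ray of the fan, and is therefore a nonnegative multiple of some
  \<open>p\<^sub>l\<close>.
\<close>

lemma cone_generated_by_rays:
  assumes "\<sigma> \<in> \<Sigma>" "x \<in> \<sigma>"
  shows "\<exists>c. (\<forall>l. 0 \<le> c l) \<and> x = (\<Sum>l | l \<in> {1..m} \<and> real_vec (p l) \<in> \<sigma>. c l *\<^sub>R real_vec (p l))"
proof -
  let ?L = "{l. l \<in> {1..m} \<and> real_vec (p l) \<in> \<sigma>}"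
  let ?C = "{\<Sum>l\<in>?L. c l *\<^sub>R real_vec (p l) | c. \<forall>l. 0 \<le> c l}"
  obtain S where S: "finite S" "\<sigma> = convex_cone hull (real_vec ` S)"
    "\<And>s. s \<in> S \<Longrightarrow> s \<noteq> 0 \<and> (convex_cone hull {real_vec s}) face_of \<sigma>"
    using rational_cone_generators_on_rays[OF rational[OF assms(1)] pointed[OF assms(1)]] by metis
  have C: "convex_cone ?C"
    unfolding convex_cone_iff
  proof (intro conjI ballI allI impI)
    show "0 \<in> ?C" by (auto intro!: exI[of _ "\<lambda>_. 0"])
    fix x assume "x \<in> ?C"
    then obtain c where c: "\<forall>l. 0 \<le> c l" "x = (\<Sum>l\<in>?L. c l *\<^sub>R real_vec (p l))" by blast
    show "a *\<^sub>R x \<in> ?C" if "0 \<le> a" for a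
    proof -
      have "\<forall>l. 0 \<le> a * c l" "a *\<^sub>R x = (\<Sum>l\<in>?L. (a * c l) *\<^sub>R real_vec (p l))"
        using c that by (auto simp: scaleR_sum_right)
      then show ?thesis unfolding mem_Collect_eq by (intro exI[of _ "\<lambda>l. a * c l"]) simp
    qed
    fix y assume "y \<in> ?C"
    then obtain d where d: "\<forall>l. 0 \<le> d l" "y = (\<Sum>l\<in>?L. d l *\<^sub>R real_vec (p l))" by blast
    have "\<forall>l. 0 \<le> c l + d l" "x + y = (\<Sum>l\<in>?L. (c l + d l) *\<^sub>R real_vec (p l))"
      using c d by (auto simp: scaleR_left_distrib sum.distrib)
    then show "x + y \<in> ?C" unfolding mem_Collect_eq by (intro exI[of _ "\<lambda>l. c l + d l"]) simp
  qed
  have "real_vec s \<in> ?C" if s: "s \<in> S" for s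
  proof -
    let ?r = "convex_cone hull {real_vec s}"
    have "?r \<in> \<Sigma>" using S(3)[OF s] convex_cone_hull_nonempty by (intro face_in_fan[OF assms(1)]) auto
    moreover have "dim ?r = 1"
    proof -
      have "span ?r = span {real_vec s}"
        by (intro subset_antisym span_mono span_minimal hull_minimal subspace_span)
           (auto simp: convex_cone_span span_base hull_inc)
      then have "dim ?r = dim {real_vec s}" by (metis dim_span)
      then show ?thesis using S(3)[OF s] by (metis dim_singleton real_vec_eq_iff real_vec_zero)
    qed
    moreover have bij: "bij_betw (\<lambda>l. convex_cone hull {real_vec (p l)}) {1..m} {\<rho>\<in>\<Sigma>. dim \<rho> = 1}"
      using rays by (simp add: ray_generators_def)
    ultimately obtain l where l: "l \<in> {1..m}" "?r = convex_cone hull {real_vec (p l)}"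
      unfolding bij_betw_def by blast
    have "real_vec (p l) \<in> ?r" unfolding l(2) by (simp add: hull_inc)
    then have "real_vec (p l) \<in> \<sigma>" using S(3)[OF s] face_of_imp_subset by blast
    have "real_vec s \<in> convex_cone hull {real_vec (p l)}" unfolding l(2)[symmetric] by (simp add: hull_inc)
    then obtain c where c: "0 \<le> c" "real_vec s = c *\<^sub>R real_vec (p l)"
      by (subst (asm) convex_cone_hull_finite) auto
    have "real_vec s = (\<Sum>k\<in>?L. (if k = l then c else 0) *\<^sub>R real_vec (p k))"
      using l \<open>real_vec (p l) \<in> \<sigma>\<close> by (simp add: c(2) if_distrib[of "\<lambda>c. c *\<^sub>R _"] cong: if_cong)
    then show ?thesis using c(1) unfolding mem_Collect_eq
      by (intro exI[of _ "\<lambda>k. if k = l then c else 0"]) simp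
  qed
  then have "convex_cone hull (real_vec ` S) \<subseteq> ?C" using C by (intro hull_minimal) auto
  moreover have "x \<in> convex_cone hull (real_vec ` S)" using assms(2) S(2) by simp
  ultimately have "x \<in> ?C" by blast
  then show ?thesis by blast
qed

lemma p_nonzero:
  assumes "l \<in> {1..m}"
  shows "p l \<noteq> 0"
proof
  assume "p l = 0"
  then have "p l = 0 *s p l" by simp
  moreover have "primitive (p l)" using rays assms by (simp add: ray_generators_def)
  ultimately show False unfolding primitive_def by (metis abs_0 zero_neq_one)
qed

lemma functional_nonneg_iff:
  assumes "\<sigma> \<in> \<Sigma>"
  shows "(\<forall>x\<in>\<sigma>. 0 \<le> y \<bullet> x) \<longleftrightarrow> (\<forall>l\<in>{1..m}. real_vec (p l) \<in> \<sigma> \<longrightarrow> 0 \<le> y \<bullet> real_vec (p l))"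
proof (intro iffI ballI)
  fix x assume *: "\<forall>l\<in>{1..m}. real_vec (p l) \<in> \<sigma> \<longrightarrow> 0 \<le> y \<bullet> real_vec (p l)" and x: "x \<in> \<sigma>"
  from cone_generated_by_rays[OF assms x] obtain c where
    "\<forall>l. 0 \<le> c l" "x = (\<Sum>l | l \<in> {1..m} \<and> real_vec (p l) \<in> \<sigma>. c l *\<^sub>R real_vec (p l))" by blast
  then show "0 \<le> y \<bullet> x" using * by (auto simp: inner_sum_right intro!: sum_nonneg)
qed auto

lemma dual_monoid_iff:
  assumes "\<sigma> \<in> \<Sigma>"
  shows "u \<in> dual_monoid \<sigma> \<longleftrightarrow> (\<forall>l\<in>{1..m}. real_vec (p l) \<in> \<sigma> \<longrightarrow> 0 \<le> pairing u (p l))"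
  using functional_nonneg_iff[OF assms, of "real_vec u"] by (simp add: dual_monoid_def inner_real_vec)

lemma perp_lattice_iff:
  assumes "\<sigma> \<in> \<Sigma>"
  shows "u \<in> perp_lattice \<sigma> \<longleftrightarrow> (\<forall>l\<in>{1..m}. real_vec (p l) \<in> \<sigma> \<longrightarrow> pairing u (p l) = 0)"
proof -
  have "u \<in> perp_lattice \<sigma> \<longleftrightarrow> u \<in> dual_monoid \<sigma> \<and> - u \<in> dual_monoid \<sigma>"
    unfolding perp_lattice_def dual_monoid_def by (auto simp: real_vec_uminus intro: antisym)
  then show ?thesis unfolding dual_monoid_iff[OF assms] pairing_uminus_left by force
qed

lemma subset_face:
  assumes "\<sigma> \<in> \<Sigma>" "\<tau> \<in> \<Sigma>" "\<tau> \<subseteq> \<sigma>"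
  shows "\<tau> face_of \<sigma>"
  using Int_face[OF assms(1,2)] assms(3) by (simp add: Int_absorb1)

lemma subset_iff_rays:
  assumes "\<sigma> \<in> \<Sigma>" "\<tau> \<in> \<Sigma>"
  shows "\<tau> \<subseteq> \<sigma> \<longleftrightarrow> (\<forall>l\<in>{1..m}. real_vec (p l) \<in> \<tau> \<longrightarrow> real_vec (p l) \<in> \<sigma>)"
proof (intro iffI subsetI)
  fix x assume *: "\<forall>l\<in>{1..m}. real_vec (p l) \<in> \<tau> \<longrightarrow> real_vec (p l) \<in> \<sigma>" and "x \<in> \<tau>"
  then obtain c where
    "\<forall>l. 0 \<le> c l" "x = (\<Sum>l | l \<in> {1..m} \<and> real_vec (p l) \<in> \<tau>. c l *\<^sub>R real_vec (p l))"
    using cone_generated_by_rays[OF assms(2)] by blast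
  then show "x \<in> \<sigma>" using * cone[OF assms(1)] by (auto intro!: convex_cone_sum convex_cone_scaleR)
qed auto

lemma zero_cone: "{0} \<in> \<Sigma>"
proof -
  obtain \<sigma> where \<sigma>: "\<sigma> \<in> \<Sigma>" using fan by (auto simp: fan_def)
  have "{0} face_of \<sigma>"
    unfolding face_of_def
  proof (intro conjI ballI impI)
    fix a b x assume ab: "a \<in> \<sigma>" "b \<in> \<sigma>" and x: "x \<in> {0}" "x \<in> open_segment a b"
    then obtain u where u: "0 < u" "u < 1" "(1 - u) *\<^sub>R a + u *\<^sub>R b = 0" by (auto simp: in_segment)
    have 1: "(1 - u) *\<^sub>R a \<in> \<sigma>" "u *\<^sub>R b \<in> \<sigma>"
      using ab u cone[OF \<sigma>] by (auto intro: convex_cone_scaleR)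
    have "(1 - u) *\<^sub>R a = - (u *\<^sub>R b)" using u(3) by (simp add: eq_neg_iff_add_eq_0)
    then have "(1 - u) *\<^sub>R a \<in> uminus ` \<sigma>" using 1 by auto
    then have "(1 - u) *\<^sub>R a = 0" using 1 pointed[OF \<sigma>] unfolding strongly_convex_def by blast
    then show "a \<in> {0}" "b \<in> {0}" using u by auto
  qed (use zero_in_cone[OF \<sigma>] in auto)
  then show ?thesis by (intro face_in_fan[OF \<sigma>]) auto
qed

section \<open>The Cox quotient map\<close>

abbreviation total_space :: "(nat \<Rightarrow> 'k::field) set" where "total_space \<equiv> cox_space \<Sigma> m p"
abbreviation quot :: "(nat \<Rightarrow> 'k::field) \<Rightarrow> ('n, 'k) toric_point" where "quot \<equiv> cox_map \<Sigma> m p"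

definition zeros :: "(nat \<Rightarrow> 'k::field) \<Rightarrow> nat set" where
  "zeros x = {l\<in>{1..m}. x l = 0}"

lemma cox_space_iff: "x \<in> total_space \<longleftrightarrow> (\<exists>\<sigma>\<in>\<Sigma>. \<forall>l\<in>zeros x. real_vec (p l) \<in> \<sigma>)"
  unfolding cox_space_def zeros_def mem_Collect_eq by (intro bex_cong refl) auto

lemma fst_quot: "fst (quot x) = \<Inter>{\<sigma>\<in>\<Sigma>. \<forall>l\<in>zeros x. real_vec (p l) \<in> \<sigma>}"
  by (auto simp: cox_map_def cox_cone_def zeros_def)

lemma fst_quot_in_fan: "x \<in> total_space \<Longrightarrow> fst (quot x) \<in> \<Sigma>"
  unfolding fst_quot by (rule Inter_in_fan) (auto simp: cox_space_iff)

lemma zeros_in_fst_quot: "l \<in> zeros x \<Longrightarrow> real_vec (p l) \<in> fst (quot x)"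
  unfolding fst_quot by auto

lemma fst_quot_subset_iff: "\<sigma> \<in> \<Sigma> \<Longrightarrow> fst (quot x) \<subseteq> \<sigma> \<longleftrightarrow> (\<forall>l\<in>zeros x. real_vec (p l) \<in> \<sigma>)"
  using zeros_in_fst_quot unfolding fst_quot by blast

text \<open>
  The vanishing locus of \<open>u\<close> in the smallest cone containing the \<open>p\<^sub>l\<close> with \<open>x\<^sub>l = 0\<close> is a face, so it
  is the whole cone as soon as it contains these \<open>p\<^sub>l\<close>.
\<close>

lemma perp_fst_quot:
  assumes "x \<in> total_space" "u \<in> dual_monoid (fst (quot x))"
  shows "u \<in> perp_lattice (fst (quot x)) \<longleftrightarrow> (\<forall>l\<in>zeros x. pairing u (p l) = 0)"
proof
  assume u: "u \<in> perp_lattice (fst (quot x))"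
  show "\<forall>l\<in>zeros x. pairing u (p l) = 0"
  proof
    fix l assume l: "l \<in> zeros x"
    then show "pairing u (p l) = 0"
      using zeros_in_fst_quot[OF l] u unfolding perp_lattice_iff[OF fst_quot_in_fan[OF assms(1)]]
      by (auto simp: zeros_def)
  qed
next
  assume *: "\<forall>l\<in>zeros x. pairing u (p l) = 0"
  let ?\<tau> = "fst (quot x)" let ?F = "?\<tau> \<inter> {z. real_vec u \<bullet> z = 0}"
  have \<tau>: "?\<tau> \<in> \<Sigma>" using fst_quot_in_fan assms by blast
  have "?F face_of ?\<tau>"
    using assms(2) cone[OF \<tau>]
    by (intro face_of_Int_supporting_hyperplane_ge) (auto simp: dual_monoid_def convex_cone_def)
  then have "?F \<in> \<Sigma>" using zero_in_cone[OF \<tau>] by (intro face_in_fan[OF \<tau>]) auto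
  then have "?\<tau> \<subseteq> ?F"
    using * zeros_in_fst_quot by (subst fst_quot_subset_iff) (auto simp: inner_real_vec)
  then show "u \<in> perp_lattice ?\<tau>" by (auto simp: perp_lattice_def)
qed

text \<open>
  On \<open>l\<close> with \<open>x\<^sub>l = 0\<close> the convention \<open>0\<^sup>0 = 1\<close> applies, and \<open>0\<close> raised to a negative power is \<open>0\<close>.  The
  latter value never matters below: exponents of vanishing variables are nonnegative on the chart
  under consideration.
\<close>

definition chi :: "int ^ 'n \<Rightarrow> (nat \<Rightarrow> 'k::field) \<Rightarrow> 'k" where
  "chi u x = (\<Prod>l=1..m. x l powi pairing u (p l))"

text \<open>
  If \<open>u\<close> is not orthogonal to the cone of the point, some vanishing variable has a positive exponent,
  so the product is \<open>0\<close>, as is the coordinate of the point.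
\<close>

lemma snd_quot_chart:
  assumes "x \<in> total_space" "\<sigma> \<in> \<Sigma>" "fst (quot x) \<subseteq> \<sigma>" "u \<in> dual_monoid \<sigma>"
  shows "snd (quot x) u = chi u x"
proof -
  have snd: "snd (quot x) u = (if u \<in> perp_lattice (fst (quot x)) then chi u x else 0)"
    by (simp add: cox_map_def chi_def)
  have "chi u x = 0" if nperp: "u \<notin> perp_lattice (fst (quot x))"
  proof -
    have "u \<in> dual_monoid (fst (quot x))" using assms(3,4) by (auto simp: dual_monoid_def)
    then obtain l where l: "l \<in> zeros x" "pairing u (p l) \<noteq> 0" using nperp perp_fst_quot[OF assms(1)] by blast
    then have "x l powi pairing u (p l) = 0" by (simp add: zeros_def)
    then show ?thesis unfolding chi_def using l by (intro prod_zero) (auto simp: zeros_def)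
  qed
  then show ?thesis using snd by simp
qed

lemma chi_add:
  assumes "\<And>l. l \<in> {1..m} \<Longrightarrow> x l \<noteq> 0 \<or> pairing u (p l) = 0 \<and> pairing w (p l) = 0"
  shows "chi (u + w) x = chi u x * chi w x"
  unfolding chi_def prod.distrib[symmetric] pairing_add_left
proof (rule prod.cong)
  fix l assume "l \<in> {1..m}"
  from assms[OF this] show "x l powi (pairing u (p l) + pairing w (p l))
      = x l powi pairing u (p l) * x l powi pairing w (p l)"
    by (cases "x l = 0") (auto simp: power_int_add)
qed simp

lemma quot_in_toric_points:
  assumes "x \<in> total_space"
  shows "quot x \<in> toric_points \<Sigma>"
proof -
  let ?\<tau> = "fst (quot x)"
  have snd: "snd (quot x) u = (if u \<in> perp_lattice ?\<tau> then chi u x else 0)" for u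
    by (simp add: cox_map_def chi_def)
  have "snd (quot x) 0 = 1" by (simp add: snd chi_def perp_lattice_def)
  moreover have "snd (quot x) (u + w) = snd (quot x) u * snd (quot x) w"
    if "u \<in> perp_lattice ?\<tau>" "w \<in> perp_lattice ?\<tau>" for u w
  proof -
    have sum: "u + w \<in> perp_lattice ?\<tau>"
      using that by (simp add: perp_lattice_def real_vec_add inner_add_left)
    have "x l \<noteq> 0 \<or> pairing u (p l) = 0 \<and> pairing w (p l) = 0" if "l \<in> {1..m}" for l
      using zeros_in_fst_quot[of l x] that \<open>u \<in> perp_lattice ?\<tau>\<close> \<open>w \<in> perp_lattice ?\<tau>\<close>
      unfolding perp_lattice_iff[OF fst_quot_in_fan[OF assms]] by (auto simp: zeros_def)
    from chi_add[OF this] show ?thesis using that sum by (simp add: snd)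
  qed
  ultimately show ?thesis
    using fst_quot_in_fan[OF assms] unfolding toric_points_def
    by (auto simp: snd split_beta)
qed

section \<open>Points of charts\<close>

lemma point_props:
  assumes "P \<in> toric_points \<Sigma>"
  shows "fst P \<in> \<Sigma>" "snd P 0 = 1"
    "\<And>u w. u \<in> perp_lattice (fst P) \<Longrightarrow> w \<in> perp_lattice (fst P) \<Longrightarrow> snd P (u + w) = snd P u * snd P w"
    "\<And>u. u \<notin> perp_lattice (fst P) \<Longrightarrow> snd P u = 0"
  using assms by (auto simp: toric_points_def split_beta)

lemma snd_nonzero_iff:
  assumes "P \<in> toric_points \<Sigma>"
  shows "snd P u \<noteq> 0 \<longleftrightarrow> u \<in> perp_lattice (fst P)"
proof
  assume u: "u \<in> perp_lattice (fst P)"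
  then have "- u \<in> perp_lattice (fst P)" by (simp add: perp_lattice_def real_vec_uminus)
  then have "snd P (u + - u) = snd P u * snd P (- u)" using point_props[OF assms] u by blast
  then show "snd P u \<noteq> 0" using point_props(2)[OF assms] by auto
qed (use point_props(4)[OF assms] in blast)

lemma snd_add_chart:
  assumes "\<sigma> \<in> \<Sigma>" "P \<in> affine_chart \<Sigma> \<sigma>" "u \<in> dual_monoid \<sigma>" "w \<in> dual_monoid \<sigma>"
  shows "snd P (u + w) = snd P u * snd P w"
proof (cases "u \<in> perp_lattice (fst P) \<and> w \<in> perp_lattice (fst P)")
  case True
  then show ?thesis using point_props(3)[of P u w] assms(2) by (auto simp: affine_chart_def)
next
  case False
  have P: "P \<in> toric_points \<Sigma>" "fst P \<subseteq> \<sigma>" using assms(2) by (auto simp: affine_chart_def)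
  have "u + w \<notin> perp_lattice (fst P)"
  proof
    assume *: "u + w \<in> perp_lattice (fst P)"
    have "real_vec u \<bullet> x = 0 \<and> real_vec w \<bullet> x = 0" if "x \<in> fst P" for x
    proof -
      have "0 \<le> real_vec u \<bullet> x" "0 \<le> real_vec w \<bullet> x"
        using that P assms(3,4) by (auto simp: dual_monoid_def)
      moreover have "real_vec u \<bullet> x + real_vec w \<bullet> x = 0"
        using * that by (simp add: perp_lattice_def real_vec_add inner_add_left)
      ultimately show ?thesis by linarith
    qed
    then show False using False by (auto simp: perp_lattice_def)
  qed
  then show ?thesis using False point_props(4)[OF P(1)] by auto
qed

lemma dual_monoid_add: "u \<in> dual_monoid \<sigma> \<Longrightarrow> w \<in> dual_monoid \<sigma> \<Longrightarrow> u + w \<in> dual_monoid \<sigma>"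
  by (simp add: dual_monoid_def real_vec_add inner_add_left)

lemma dual_monoid_scale: "u \<in> dual_monoid \<sigma> \<Longrightarrow> of_nat k *s u \<in> dual_monoid \<sigma>"
  by (simp add: dual_monoid_def real_vec_scale)

lemma snd_scale_chart:
  assumes "\<sigma> \<in> \<Sigma>" "P \<in> affine_chart \<Sigma> \<sigma>" "u \<in> dual_monoid \<sigma>"
  shows "snd P (of_nat k *s u) = snd P u ^ k"
proof (induction k)
  case 0
  then show ?case using point_props(2)[of P] assms by (simp add: affine_chart_def)
next
  case (Suc k)
  have "of_nat (Suc k) *s u = u + of_nat k *s u" by (simp add: vec_eq_iff algebra_simps)
  then show ?case using Suc snd_add_chart[OF assms(1,2,3) dual_monoid_scale[OF assms(3)]] by simp
qed

text \<open>
  The integral form of exposedness, expressed through the rays and the cones of the fan.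
\<close>

lemma exposing_character:
  assumes "\<sigma> \<in> \<Sigma>" "\<nu> \<in> \<Sigma>" "\<nu> \<subseteq> \<sigma>"
  obtains u where "u \<in> dual_monoid \<sigma>" "\<And>l. l \<in> {1..m} \<Longrightarrow> real_vec (p l) \<in> \<sigma> \<Longrightarrow>
      pairing u (p l) = 0 \<longleftrightarrow> real_vec (p l) \<in> \<nu>"
    "\<And>\<tau>. \<tau> \<in> \<Sigma> \<Longrightarrow> \<tau> \<subseteq> \<sigma> \<Longrightarrow> u \<in> perp_lattice \<tau> \<longleftrightarrow> \<tau> \<subseteq> \<nu>"
proof -
  have "\<nu> \<noteq> {}" using zero_in_cone[OF assms(2)] by auto
  from face_exposed_by_character[OF rational[OF assms(1)] subset_face[OF assms] this]
  obtain u where u: "u \<in> dual_monoid \<sigma>" "\<nu> = {x \<in> \<sigma>. real_vec u \<bullet> x = 0}" by blast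
  show ?thesis
  proof
    show "pairing u (p l) = 0 \<longleftrightarrow> real_vec (p l) \<in> \<nu>" if "real_vec (p l) \<in> \<sigma>"
      for l
      using u(2) that by (auto simp: inner_real_vec)
    show "u \<in> perp_lattice \<tau> \<longleftrightarrow> \<tau> \<subseteq> \<nu>" if "\<tau> \<subseteq> \<sigma>"
      for \<tau>
      unfolding u(2) perp_lattice_def using that by auto
  qed (rule u(1))
qed

text \<open>
  This is \<open>K[\<nu>\<^sup>\<or> \<inter> M] = K[\<sigma>\<^sup>\<or> \<inter> M][1/\<chi>\<^sup>u]\<close> for the face \<open>\<nu>\<close> of \<open>\<sigma>\<close> cut out by \<open>u\<close>: on rays outside
  \<open>\<nu>\<close> the functional \<open>u\<close> is at least \<open>1\<close> and compensates any negative value of \<open>w\<close>.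
\<close>

lemma localize_character:
  assumes "\<sigma> \<in> \<Sigma>" "u \<in> dual_monoid \<sigma>"
    and u: "\<And>l. l \<in> {1..m} \<Longrightarrow> real_vec (p l) \<in> \<sigma> \<Longrightarrow> pairing u (p l) = 0 \<longleftrightarrow> real_vec (p l) \<in> \<nu>"
    and "\<nu> \<in> \<Sigma>" "w \<in> dual_monoid \<nu>"
  shows "\<exists>N. \<forall>k\<ge>N. w + of_nat k *s u \<in> dual_monoid \<sigma>"
proof -
  define N where "N = (\<Sum>l=1..m. nat (- pairing w (p l)))"
  have "w + of_nat k *s u \<in> dual_monoid \<sigma>" if "N \<le> k" for k
    unfolding dual_monoid_iff[OF assms(1)]
  proof (intro ballI impI)
    fix l assume l: "l \<in> {1..m}" "real_vec (p l) \<in> \<sigma>"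
    have "0 \<le> pairing u (p l)" using assms(2) l unfolding dual_monoid_iff[OF assms(1)] by blast
    have "nat (- pairing w (p l)) \<le> N" unfolding N_def using l by (intro member_le_sum) auto
    have "0 \<le> pairing w (p l) + int k * pairing u (p l)"
    proof (cases "real_vec (p l) \<in> \<nu>")
      case True
      then show ?thesis using assms(5) u[OF l] l unfolding dual_monoid_iff[OF assms(4)] by auto
    next
      case False
      then have "1 \<le> pairing u (p l)" using u[OF l] \<open>0 \<le> pairing u (p l)\<close> by linarith
      then have "int k * 1 \<le> int k * pairing u (p l)" by (intro mult_left_mono) auto
      then show ?thesis using \<open>nat (- pairing w (p l)) \<le> N\<close> that by linarith
    qed
    then show "0 \<le> pairing (w + of_nat k *s u) (p l)" by (simp add: pairing_add_left pairing_scale_left)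
  qed
  then show ?thesis by blast
qed

text \<open>
  A point of an affine chart is determined by its coordinates.  The character exposing the orbit
  cone recovers the cone, since it is nonzero exactly on the orbits of its faces; its multiples move
  every character of the orbit into \<open>\<sigma>\<^sup>\<or>\<close>.
\<close>

lemma chart_point_eqI:
  assumes "\<sigma> \<in> \<Sigma>" "P \<in> affine_chart \<Sigma> \<sigma>" "Q \<in> affine_chart \<Sigma> \<sigma>"
    and eq: "\<And>u. u \<in> dual_monoid \<sigma> \<Longrightarrow> snd P u = snd Q u"
  shows "P = Q"
proof -
  have P: "P \<in> toric_points \<Sigma>" "fst P \<subseteq> \<sigma>" "fst P \<in> \<Sigma>"
    and Q: "Q \<in> toric_points \<Sigma>" "fst Q \<subseteq> \<sigma>" "fst Q \<in> \<Sigma>"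
    using assms(2,3) point_props(1)[of P] point_props(1)[of Q] by (auto simp: affine_chart_def)
  have sub: "fst Q \<subseteq> fst P" if P: "P \<in> toric_points \<Sigma>" "fst P \<subseteq> \<sigma>" "fst P \<in> \<Sigma>"
    and Q: "Q \<in> toric_points \<Sigma>" "fst Q \<subseteq> \<sigma>" "fst Q \<in> \<Sigma>"
    and eq: "\<And>u. u \<in> dual_monoid \<sigma> \<Longrightarrow> snd P u = snd Q u" for P Q :: "('n, 'a) toric_point"
  proof -
    obtain u where u: "u \<in> dual_monoid \<sigma>"
      "\<And>\<tau>. \<tau> \<in> \<Sigma> \<Longrightarrow> \<tau> \<subseteq> \<sigma> \<Longrightarrow> u \<in> perp_lattice \<tau> \<longleftrightarrow> \<tau> \<subseteq> fst P"
      using exposing_character[OF assms(1) P(3,2)] by metis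
    then have "u \<in> perp_lattice (fst P)" using P by auto
    then have "u \<in> perp_lattice (fst Q)" using eq[OF u(1)] snd_nonzero_iff P(1) Q(1) by metis
    then show ?thesis using u(2) Q by blast
  qed
  have fst: "fst P = fst Q" using sub[OF P Q eq] sub[OF Q P eq[symmetric]] by auto
  obtain u where u: "u \<in> dual_monoid \<sigma>" "\<And>l. l \<in> {1..m} \<Longrightarrow> real_vec (p l) \<in> \<sigma> \<Longrightarrow>
      pairing u (p l) = 0 \<longleftrightarrow> real_vec (p l) \<in> fst P"
    "\<And>\<tau>. \<tau> \<in> \<Sigma> \<Longrightarrow> \<tau> \<subseteq> \<sigma> \<Longrightarrow> u \<in> perp_lattice \<tau> \<longleftrightarrow> \<tau> \<subseteq> fst P"
    using exposing_character[OF assms(1) P(3,2)] by metis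
  have uP: "u \<in> perp_lattice (fst P)" using u(3) P by auto
  have "snd P w = snd Q w" for w
  proof (cases "w \<in> perp_lattice (fst P)")
    case False
    then show ?thesis using point_props(4) P(1) Q(1) fst by metis
  next
    case True
    then have "w \<in> dual_monoid (fst P)" by (simp add: perp_lattice_def dual_monoid_def)
    from localize_character[OF assms(1) u(1,2) P(3) this]
    obtain k where k: "w + of_nat k *s u \<in> dual_monoid \<sigma>" by blast
    have ku: "of_nat k *s u \<in> perp_lattice (fst P)" using uP by (simp add: perp_lattice_def real_vec_scale)
    have "snd P w * snd P (of_nat k *s u) = snd Q w * snd Q (of_nat k *s u)"
      using eq[OF k] point_props(3)[OF P(1) True ku] point_props(3)[OF Q(1) True[unfolded fst] ku[unfolded fst]] by simp
    moreover have "snd P (of_nat k *s u) = snd Q (of_nat k *s u)" using u(1) by (intro eq dual_monoid_scale)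
    moreover have "snd P (of_nat k *s u) \<noteq> 0" using ku snd_nonzero_iff P(1) by blast
    ultimately show ?thesis by simp
  qed
  then show ?thesis using fst by (simp add: prod_eq_iff fun_eq_iff)
qed

end

section \<open>Regular functions on charts\<close>

context toric_fan
begin

abbreviation chart :: "(real ^ 'n) set \<Rightarrow> ('n, 'k::field) toric_point set" where
  "chart \<equiv> affine_chart \<Sigma>"

text \<open>
  Coordinate rings only matter up to their values on the chart, and only there are they closed under
  products.
\<close>

definition regular_fun :: "(real ^ 'n) set \<Rightarrow> (('n, 'k::field) toric_point \<Rightarrow> 'k) \<Rightarrow> bool" where
  "regular_fun \<sigma> f \<longleftrightarrow> (\<exists>g\<in>coordinate_ring \<sigma>. \<forall>P\<in>chart \<sigma>. f P = g P)"

lemma regular_fun_cong: "regular_fun \<sigma> f \<Longrightarrow> (\<And>P. P \<in> chart \<sigma> \<Longrightarrow> g P = f P) \<Longrightarrow> regular_fun \<sigma> g"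
  by (auto simp: regular_fun_def)

lemma regular_fun_char:
  assumes "u \<in> dual_monoid \<sigma>"
  shows "regular_fun \<sigma> (\<lambda>P. snd P u)"
  unfolding regular_fun_def coordinate_ring_def
  using assms by (intro bexI[of _ "\<lambda>P. snd P u"]) (auto intro!: exI[of _ "{u}"] exI[of _ "\<lambda>_. 1"])

lemma regular_fun_zero: "regular_fun \<sigma> (\<lambda>P. 0)"
  unfolding regular_fun_def coordinate_ring_def
  by (intro bexI[of _ "\<lambda>P. 0"]) (auto intro!: exI[of _ "{}"])

lemma regular_fun_obtain:
  assumes "regular_fun \<sigma> f"
  obtains A c where "finite A" "A \<subseteq> dual_monoid \<sigma>" "\<And>P. P \<in> chart \<sigma> \<Longrightarrow> f P = (\<Sum>u\<in>A. c u * snd P u)"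
  using assms unfolding regular_fun_def coordinate_ring_def by auto

lemma regular_funI:
  assumes "finite A" "A \<subseteq> dual_monoid \<sigma>" "\<And>P. P \<in> chart \<sigma> \<Longrightarrow> f P = (\<Sum>u\<in>A. c u * snd P u)"
  shows "regular_fun \<sigma> f"
  unfolding regular_fun_def
proof (intro bexI ballI)
  show "(\<lambda>P. \<Sum>u\<in>A. c u * snd P u) \<in> coordinate_ring \<sigma>"
    unfolding coordinate_ring_def mem_Collect_eq
    using assms by (intro exI[of _ A] exI[of _ c]) simp
qed (rule assms(3))

lemma regular_fun_add:
  assumes "regular_fun \<sigma> f" "regular_fun \<sigma> g"
  shows "regular_fun \<sigma> (\<lambda>P. f P + g P)"
proof -
  obtain A c where A: "finite A" "A \<subseteq> dual_monoid \<sigma>" "\<And>P. P \<in> chart \<sigma> \<Longrightarrow> f P = (\<Sum>u\<in>A. c u * snd P u)"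
    using regular_fun_obtain[OF assms(1)] by blast
  obtain B d where B: "finite B" "B \<subseteq> dual_monoid \<sigma>" "\<And>P. P \<in> chart \<sigma> \<Longrightarrow> g P = (\<Sum>u\<in>B. d u * snd P u)"
    using regular_fun_obtain[OF assms(2)] by blast
  let ?e = "\<lambda>u. (if u \<in> A then c u else 0) + (if u \<in> B then d u else 0)"
  have "(\<Sum>u\<in>A \<union> B. ?e u * z u) = (\<Sum>u\<in>A. c u * z u) + (\<Sum>u\<in>B. d u * z u)" for z
  proof -
    have "(\<Sum>u\<in>A. c u * z u) = (\<Sum>u\<in>A \<union> B. (if u \<in> A then c u else 0) * z u)"
      using A B by (intro sum.mono_neutral_cong_left) auto
    moreover have "(\<Sum>u\<in>B. d u * z u) = (\<Sum>u\<in>A \<union> B. (if u \<in> B then d u else 0) * z u)"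
      using A B by (intro sum.mono_neutral_cong_left) auto
    ultimately show ?thesis by (simp add: sum.distrib[symmetric] distrib_right)
  qed
  then show ?thesis
    using A B by (intro regular_funI[of "A \<union> B" _ _ ?e]) auto
qed

lemma regular_fun_scale:
  assumes "regular_fun \<sigma> f"
  shows "regular_fun \<sigma> (\<lambda>P. t * f P)"
proof -
  obtain A c where A: "finite A" "A \<subseteq> dual_monoid \<sigma>" "\<And>P. P \<in> chart \<sigma> \<Longrightarrow> f P = (\<Sum>u\<in>A. c u * snd P u)"
    using regular_fun_obtain[OF assms] by blast
  show ?thesis
    using A by (intro regular_funI[of A _ _ "\<lambda>u. t * c u"]) (auto simp: sum_distrib_left mult.assoc)
qed

lemma regular_fun_sum: "(\<And>i. i \<in> I \<Longrightarrow> regular_fun \<sigma> (f i)) \<Longrightarrow> regular_fun \<sigma> (\<lambda>P. \<Sum>i\<in>I. f i P)"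
  by (induction I rule: infinite_finite_induct) (auto intro: regular_fun_zero regular_fun_add)

lemma regular_fun_mult:
  fixes f g :: "('n, 'k::field) toric_point \<Rightarrow> 'k"
  assumes "\<sigma> \<in> \<Sigma>" "regular_fun \<sigma> f" "regular_fun \<sigma> g"
  shows "regular_fun \<sigma> (\<lambda>P. f P * g P)"
proof -
  obtain A c where A: "finite A" "A \<subseteq> dual_monoid \<sigma>" "\<And>P. P \<in> chart \<sigma> \<Longrightarrow> f P = (\<Sum>u\<in>A. c u * snd P u)"
    using regular_fun_obtain[OF assms(2)] by blast
  obtain B d where B: "finite B" "B \<subseteq> dual_monoid \<sigma>" "\<And>P. P \<in> chart \<sigma> \<Longrightarrow> g P = (\<Sum>u\<in>B. d u * snd P u)"
    using regular_fun_obtain[OF assms(3)] by blast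
  have "regular_fun \<sigma> (\<lambda>P. \<Sum>u\<in>A. \<Sum>w\<in>B. (c u * d w) * snd P (u + w))"
    using A B by (intro regular_fun_sum regular_fun_scale regular_fun_char dual_monoid_add) auto
  then show ?thesis
  proof (rule regular_fun_cong)
    fix P :: "('n, 'k) toric_point" assume P: "P \<in> chart \<sigma>"
    have "f P * g P = (\<Sum>u\<in>A. \<Sum>w\<in>B. (c u * d w) * (snd P u * snd P w))"
      unfolding A(3)[OF P] B(3)[OF P] sum_product by (simp add: mult_ac)
    also have "\<dots> = (\<Sum>u\<in>A. \<Sum>w\<in>B. (c u * d w) * snd P (u + w))"
    proof (intro sum.cong refl)
      fix u w assume "u \<in> A" "w \<in> B"
      then have "snd P (u + w) = snd P u * snd P w"
        using A(2) B(2) by (intro snd_add_chart[OF assms(1) P]) auto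
      then show "c u * d w * (snd P u * snd P w) = c u * d w * snd P (u + w)" by simp
    qed
    finally show "f P * g P = (\<Sum>u\<in>A. \<Sum>w\<in>B. (c u * d w) * snd P (u + w))" .
  qed
qed

lemma zero_in_dual_monoid: "0 \<in> dual_monoid \<sigma>"
  by (simp add: dual_monoid_def)

lemma regular_fun_const: "regular_fun \<sigma> (\<lambda>P. t)"
proof (rule regular_fun_cong)
  show "regular_fun \<sigma> (\<lambda>P. t * snd P 0)"
    by (intro regular_fun_scale regular_fun_char zero_in_dual_monoid)
  show "t = t * snd P 0" if "P \<in> chart \<sigma>" for P
    using point_props(2)[of P] that by (simp add: affine_chart_def)
qed

lemma regular_fun_power:
  assumes "\<sigma> \<in> \<Sigma>" "regular_fun \<sigma> f"
  shows "regular_fun \<sigma> (\<lambda>P. f P ^ k)"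
  by (induction k) (auto intro: regular_fun_const regular_fun_mult[OF assms(1)] assms(2))

section \<open>Zariski topology\<close>

abbreviation zariski :: "('n, 'k::field) toric_point topology" where
  "zariski \<equiv> zariski_topology \<Sigma>"

lemma openin_basic:
  assumes "\<sigma> \<in> \<Sigma>" "regular_fun \<sigma> f"
  shows "openin zariski {P \<in> chart \<sigma>. f P \<noteq> 0}"
proof -
  obtain g where g: "g \<in> coordinate_ring \<sigma>" "\<forall>P\<in>chart \<sigma>. f P = g P" using assms(2) by (auto simp: regular_fun_def)
  then have "{P \<in> chart \<sigma>. f P \<noteq> 0} = {P \<in> chart \<sigma>. g P \<noteq> 0}" by auto
  moreover have "openin zariski {P \<in> chart \<sigma>. g P \<noteq> 0}"
    unfolding zariski_topology_def using assms(1) g(1) by (intro topology_generated_by_Basis) blast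
  ultimately show ?thesis by simp
qed

lemma openin_chart: "\<sigma> \<in> \<Sigma> \<Longrightarrow> openin zariski (chart \<sigma>)"
  using openin_basic[OF _ regular_fun_const, of \<sigma> 1] by simp

lemma topspace_zariski: "topspace zariski = (toric_points \<Sigma> :: ('n, 'k::field) toric_point set)"
proof
  show "topspace zariski \<subseteq> (toric_points \<Sigma> :: ('n, 'k) toric_point set)"
    unfolding zariski_topology_def by (auto simp: affine_chart_def)
  show "(toric_points \<Sigma> :: ('n, 'k) toric_point set) \<subseteq> topspace zariski"
  proof
    fix P :: "('n, 'k) toric_point" assume P: "P \<in> toric_points \<Sigma>"
    then have "P \<in> chart (fst P)" by (simp add: affine_chart_def)
    then show "P \<in> topspace zariski" using openin_chart[OF point_props(1)[OF P]] openin_subset by blast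
  qed
qed

text \<open>
  The overlap of two charts is a principal open subset of either one, and functions that are regular
  on the other chart acquire a power of the defining character as denominator.
\<close>

lemma chart_overlap:
  assumes "\<sigma> \<in> \<Sigma>" "\<sigma>' \<in> \<Sigma>"
  obtains u where "u \<in> dual_monoid \<sigma>"
    "\<And>P :: ('n, 'k::field) toric_point. P \<in> chart \<sigma> \<Longrightarrow> snd P u \<noteq> 0 \<longleftrightarrow> P \<in> chart \<sigma>'"
    "\<And>f :: ('n, 'k) toric_point \<Rightarrow> 'k. regular_fun \<sigma>' f \<Longrightarrow>
       \<exists>N. \<forall>k\<ge>N. \<exists>g. regular_fun \<sigma> g \<and> (\<forall>P\<in>chart \<sigma> \<inter> chart \<sigma>'. f P * snd P u ^ k = g P)"
proof -
  let ?\<nu> = "\<sigma> \<inter> \<sigma>'"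
  have \<nu>: "?\<nu> \<in> \<Sigma>" using Int_in_fan assms by blast
  obtain u where u: "u \<in> dual_monoid \<sigma>" "\<And>l. l \<in> {1..m} \<Longrightarrow> real_vec (p l) \<in> \<sigma> \<Longrightarrow>
      pairing u (p l) = 0 \<longleftrightarrow> real_vec (p l) \<in> ?\<nu>"
    "\<And>\<tau>. \<tau> \<in> \<Sigma> \<Longrightarrow> \<tau> \<subseteq> \<sigma> \<Longrightarrow> u \<in> perp_lattice \<tau> \<longleftrightarrow> \<tau> \<subseteq> ?\<nu>"
    using exposing_character[OF assms(1) \<nu>] by auto
  have sub: "dual_monoid \<sigma> \<subseteq> dual_monoid ?\<nu>" "dual_monoid \<sigma>' \<subseteq> dual_monoid ?\<nu>"
    by (auto simp: dual_monoid_def)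
  show ?thesis
  proof
    fix P :: "('n, 'k) toric_point" assume P: "P \<in> chart \<sigma>"
    then have P': "P \<in> toric_points \<Sigma>" "fst P \<subseteq> \<sigma>" by (auto simp: affine_chart_def)
    show "snd P u \<noteq> 0 \<longleftrightarrow> P \<in> chart \<sigma>'"
      unfolding snd_nonzero_iff[OF P'(1)] u(3)[OF point_props(1)[OF P'(1)] P'(2)]
      using P' by (auto simp: affine_chart_def)
  next
    fix f :: "('n, 'k) toric_point \<Rightarrow> 'k" assume "regular_fun \<sigma>' f"
    then obtain A c where A: "finite A" "A \<subseteq> dual_monoid \<sigma>'"
      "\<And>P. P \<in> chart \<sigma>' \<Longrightarrow> f P = (\<Sum>u\<in>A. c u * snd P u)"
      using regular_fun_obtain by blast
    have "\<exists>N. \<forall>k\<ge>N. w + of_nat k *s u \<in> dual_monoid \<sigma>" if "w \<in> A" for w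
      using A(2) sub that by (intro localize_character[OF assms(1) u(1,2) \<nu>]) auto
    then obtain N where N: "\<And>w k. w \<in> A \<Longrightarrow> N w \<le> k \<Longrightarrow> w + of_nat k *s u \<in> dual_monoid \<sigma>" by metis
    have "\<exists>g. regular_fun \<sigma> g \<and> (\<forall>P\<in>chart \<sigma> \<inter> chart \<sigma>'. f P * snd P u ^ k = g P)"
      if k: "(\<Sum>w\<in>A. N w) \<le> k" for k
    proof (intro exI conjI ballI)
      have k': "w + of_nat k *s u \<in> dual_monoid \<sigma>" if "w \<in> A" for w
        using member_le_sum[OF that, of N] A(1) k that by (intro N) auto
      show "regular_fun \<sigma> (\<lambda>P. \<Sum>w\<in>A. c w * snd P (w + of_nat k *s u))"
        using k' by (intro regular_fun_sum regular_fun_scale regular_fun_char)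
      fix P :: "('n, 'k) toric_point" assume P: "P \<in> chart \<sigma> \<inter> chart \<sigma>'"
      then have P\<nu>: "P \<in> chart ?\<nu>" by (auto simp: affine_chart_def)
      have "snd P w * snd P u ^ k = snd P (w + of_nat k *s u)" if "w \<in> A" for w
      proof -
        have uw: "u \<in> dual_monoid ?\<nu>" "w \<in> dual_monoid ?\<nu>" using that A(2) sub u(1) by auto
        show ?thesis
          unfolding snd_add_chart[OF \<nu> P\<nu> uw(2) dual_monoid_scale[OF uw(1)]] snd_scale_chart[OF \<nu> P\<nu> uw(1)]
          by simp
      qed
      then show "f P * snd P u ^ k = (\<Sum>w\<in>A. c w * snd P (w + of_nat k *s u))"
        using A(3) P by (simp add: sum_distrib_right mult.assoc)
    qed
    then show "\<exists>N. \<forall>k\<ge>N. \<exists>g. regular_fun \<sigma> g \<and> (\<forall>P\<in>chart \<sigma> \<inter> chart \<sigma>'. f P * snd P u ^ k = g P)"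
      by blast
  qed (rule u(1))
qed

text \<open>
  A checkable criterion for morphisms: around each point there is a principal open subset of a chart
  that is mapped into the same chart, with coordinates pulled back to regular functions divided by
  powers of the equation \<open>\<delta>\<close>.
\<close>

definition locally_rational :: "(('n, 'k::field) toric_point \<Rightarrow> ('n, 'k) toric_point) \<Rightarrow> bool" where
  "locally_rational \<phi> \<longleftrightarrow> (\<forall>P\<in>toric_points \<Sigma>. \<exists>\<sigma>\<in>\<Sigma>. \<exists>\<delta>. regular_fun \<sigma> \<delta> \<and> P \<in> chart \<sigma> \<and> \<delta> P \<noteq> 0 \<and>
     (\<forall>Q\<in>chart \<sigma>. \<delta> Q \<noteq> 0 \<longrightarrow> \<phi> Q \<in> chart \<sigma>) \<and>
     (\<forall>u\<in>dual_monoid \<sigma>. \<exists>k F. regular_fun \<sigma> F \<and> (\<forall>Q\<in>chart \<sigma>. \<delta> Q \<noteq> 0 \<longrightarrow> snd (\<phi> Q) u * \<delta> Q ^ k = F Q)))"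

text \<open>
  All large exponents work, which allows a common denominator for several functions.
\<close>

lemma pullback_regular_fun:
  assumes \<sigma>: "\<sigma> \<in> \<Sigma>" and \<delta>: "regular_fun \<sigma> \<delta>" and maps: "\<And>Q. Q \<in> chart \<sigma> \<Longrightarrow> \<delta> Q \<noteq> 0 \<Longrightarrow> \<phi> Q \<in> chart \<sigma>"
    and char: "\<And>u. u \<in> dual_monoid \<sigma> \<Longrightarrow>
      \<exists>k F. regular_fun \<sigma> F \<and> (\<forall>Q\<in>chart \<sigma>. \<delta> Q \<noteq> 0 \<longrightarrow> snd (\<phi> Q) u * \<delta> Q ^ k = F Q)"
    and f: "regular_fun \<sigma> f"
  shows "\<exists>K. \<forall>k\<ge>K. \<exists>F. regular_fun \<sigma> F \<and> (\<forall>Q\<in>chart \<sigma>. \<delta> Q \<noteq> 0 \<longrightarrow> f (\<phi> Q) * \<delta> Q ^ k = F Q)"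
proof -
  obtain A c where A: "finite A" "A \<subseteq> dual_monoid \<sigma>" "\<And>P. P \<in> chart \<sigma> \<Longrightarrow> f P = (\<Sum>u\<in>A. c u * snd P u)"
    using regular_fun_obtain[OF f] by blast
  have "\<forall>u. \<exists>k F. u \<in> A \<longrightarrow> regular_fun \<sigma> F \<and> (\<forall>Q\<in>chart \<sigma>. \<delta> Q \<noteq> 0 \<longrightarrow> snd (\<phi> Q) u * \<delta> Q ^ k = F Q)"
    using char A(2) by blast
  then obtain k F where kF: "\<And>u. u \<in> A \<Longrightarrow> regular_fun \<sigma> (F u)"
    "\<And>u Q. u \<in> A \<Longrightarrow> Q \<in> chart \<sigma> \<Longrightarrow> \<delta> Q \<noteq> 0 \<Longrightarrow> snd (\<phi> Q) u * \<delta> Q ^ k u = F u Q"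
    by metis
  show ?thesis
  proof (intro exI allI impI conjI ballI)
    fix j assume j: "(\<Sum>u\<in>A. k u) \<le> j"
    show "regular_fun \<sigma> (\<lambda>Q. \<Sum>u\<in>A. c u * (F u Q * \<delta> Q ^ (j - k u)))"
      by (intro regular_fun_sum regular_fun_scale regular_fun_mult[OF \<sigma>] regular_fun_power[OF \<sigma>] kF \<delta>)
    fix Q assume Q: "Q \<in> chart \<sigma>" "\<delta> Q \<noteq> 0"
    have "snd (\<phi> Q) u * \<delta> Q ^ j = F u Q * \<delta> Q ^ (j - k u)" if u: "u \<in> A" for u
    proof -
      have "k u \<le> j" using member_le_sum[OF u, of k] A(1) j by auto
      then have "\<delta> Q ^ j = \<delta> Q ^ k u * \<delta> Q ^ (j - k u)" by (simp add: power_add[symmetric])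
      then show ?thesis using kF(2)[OF u Q] by (simp add: mult.assoc[symmetric])
    qed
    then show "f (\<phi> Q) * \<delta> Q ^ j = (\<Sum>u\<in>A. c u * (F u Q * \<delta> Q ^ (j - k u)))"
      using A(3)[OF maps[OF Q]] by (simp add: sum_distrib_right mult.assoc)
  qed
qed

lemma locally_rational_maps: "locally_rational \<phi> \<Longrightarrow> P \<in> toric_points \<Sigma> \<Longrightarrow> \<phi> P \<in> toric_points \<Sigma>"
  unfolding locally_rational_def affine_chart_def by blast

text \<open>
  It suffices to see that the preimage of a basic open set of another chart is open.  On the overlap
  with the given chart its equation becomes regular after multiplication with a power of \<open>\<chi>\<^sup>u\<close>, and
  nonvanishing of \<open>\<chi>\<^sup>u\<close> describes the overlap.
\<close>

lemma locally_rational_continuous: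
  assumes "locally_rational (\<phi> :: ('n, 'k::field) toric_point \<Rightarrow> ('n, 'k) toric_point)"
  shows "continuous_map zariski zariski \<phi>"
proof -
  let ?S = "{{x \<in> chart \<sigma>. f x \<noteq> 0} | \<sigma> f. \<sigma> \<in> \<Sigma> \<and> f \<in> coordinate_ring \<sigma>} :: ('n, 'k) toric_point set set"
  have "openin zariski (\<phi> -` U \<inter> topspace zariski)" if U: "U \<in> ?S" for U
  proof (subst openin_subopen, intro ballI)
    fix P assume P: "P \<in> \<phi> -` U \<inter> topspace zariski"
    obtain \<sigma>' f where f: "\<sigma>' \<in> \<Sigma>" "f \<in> coordinate_ring \<sigma>'" "U = {x \<in> chart \<sigma>'. f x \<noteq> 0}" using U by blast
    have "P \<in> toric_points \<Sigma>" using P by (simp add: topspace_zariski)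
    then obtain \<sigma> \<delta> where \<sigma>: "\<sigma> \<in> \<Sigma>" "regular_fun \<sigma> \<delta>" "P \<in> chart \<sigma>" "\<delta> P \<noteq> 0"
      and maps: "\<And>Q. Q \<in> chart \<sigma> \<Longrightarrow> \<delta> Q \<noteq> 0 \<Longrightarrow> \<phi> Q \<in> chart \<sigma>"
      and char: "\<And>u. u \<in> dual_monoid \<sigma> \<Longrightarrow>
        \<exists>k F. regular_fun \<sigma> F \<and> (\<forall>Q\<in>chart \<sigma>. \<delta> Q \<noteq> 0 \<longrightarrow> snd (\<phi> Q) u * \<delta> Q ^ k = F Q)"
      using assms unfolding locally_rational_def by metis
    have "regular_fun \<sigma>' f" using f by (auto simp: regular_fun_def)
    obtain u where u: "u \<in> dual_monoid \<sigma>"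
      "\<And>P :: ('n, 'k) toric_point. P \<in> chart \<sigma> \<Longrightarrow> snd P u \<noteq> 0 \<longleftrightarrow> P \<in> chart \<sigma>'"
      "\<And>f :: ('n, 'k) toric_point \<Rightarrow> 'k. regular_fun \<sigma>' f \<Longrightarrow>
         \<exists>N. \<forall>k\<ge>N. \<exists>g. regular_fun \<sigma> g \<and> (\<forall>P\<in>chart \<sigma> \<inter> chart \<sigma>'. f P * snd P u ^ k = g P)"
      using chart_overlap[OF \<sigma>(1) f(1)] by metis
    obtain N g where g: "regular_fun \<sigma> g" "\<And>P. P \<in> chart \<sigma> \<Longrightarrow> P \<in> chart \<sigma>' \<Longrightarrow> f P * snd P u ^ N = g P"
      using u(3)[OF \<open>regular_fun \<sigma>' f\<close>] by blast
    obtain k G where G: "regular_fun \<sigma> G" "\<And>Q. Q \<in> chart \<sigma> \<Longrightarrow> \<delta> Q \<noteq> 0 \<Longrightarrow> g (\<phi> Q) * \<delta> Q ^ k = G Q"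
      using pullback_regular_fun[OF \<sigma>(1,2) maps char g(1)] by blast
    obtain j H where H: "regular_fun \<sigma> H" "\<And>Q. Q \<in> chart \<sigma> \<Longrightarrow> \<delta> Q \<noteq> 0 \<Longrightarrow> snd (\<phi> Q) u * \<delta> Q ^ j = H Q"
      using pullback_regular_fun[OF \<sigma>(1,2) maps char regular_fun_char[OF u(1)]] by blast
    let ?T = "{Q \<in> chart \<sigma>. \<delta> Q * (G Q * H Q) \<noteq> 0}"
    have "openin zariski ?T"
      by (intro openin_basic regular_fun_mult[OF \<sigma>(1)] \<sigma> G H)
    moreover have *: "\<phi> Q \<in> U \<longleftrightarrow> G Q * H Q \<noteq> 0" if Q: "Q \<in> chart \<sigma>" "\<delta> Q \<noteq> 0"
      for Q
    proof -
      have "H Q \<noteq> 0 \<longleftrightarrow> \<phi> Q \<in> chart \<sigma>'"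
        using u(2)[OF maps[OF Q]] H(2)[OF Q, symmetric] Q(2) by auto
      moreover have "G Q \<noteq> 0 \<longleftrightarrow> f (\<phi> Q) \<noteq> 0" if "\<phi> Q \<in> chart \<sigma>'"
        using g(2)[OF maps[OF Q] that] u(2)[OF maps[OF Q]] that G(2)[OF Q, symmetric] Q(2) by auto
      ultimately show ?thesis unfolding f(3) by auto
    qed
    moreover have "?T \<subseteq> \<phi> -` U \<inter> topspace zariski"
      using * by (auto simp: topspace_zariski affine_chart_def)
    moreover have "P \<in> ?T" using * P \<sigma> by auto
    ultimately show "\<exists>T. openin zariski T \<and> P \<in> T \<and> T \<subseteq> \<phi> -` U \<inter> topspace zariski" by blast
  qed
  moreover have "\<phi> ` topspace zariski \<subseteq> \<Union>?S"
  proof -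
    have "\<Union>?S = topspace zariski" unfolding zariski_topology_def topology_generated_by_topspace ..
    then show ?thesis using locally_rational_maps[OF assms] topspace_zariski by auto
  qed
  ultimately show ?thesis
    unfolding zariski_topology_def by (intro continuous_on_generated_topo) auto
qed

text \<open>
  Numerator and denominator of a local fraction are multiplied by the same powers of \<open>\<chi>\<^sup>u\<close> and of \<open>\<delta>\<close>,
  so that both become regular on the source chart.
\<close>

lemma locally_rational_regular:
  assumes lr: "locally_rational (\<phi> :: ('n, 'k::field) toric_point \<Rightarrow> ('n, 'k) toric_point)"
    and V: "openin zariski V" "regular_on \<Sigma> V h"
  shows "regular_on \<Sigma> {x \<in> toric_points \<Sigma>. \<phi> x \<in> V} (h \<circ> \<phi>)"
  unfolding regular_on_def
proof
  fix P assume "P \<in> {x \<in> toric_points \<Sigma>. \<phi> x \<in> V}"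
  then have P: "P \<in> toric_points \<Sigma>" "\<phi> P \<in> V" by auto
  from V(2) P(2) obtain \<sigma>' f g W where W: "\<sigma>' \<in> \<Sigma>" "f \<in> coordinate_ring \<sigma>'" "g \<in> coordinate_ring \<sigma>'"
    "openin zariski W" "\<phi> P \<in> W" "W \<subseteq> V \<inter> chart \<sigma>'" "\<And>z. z \<in> W \<Longrightarrow> g z \<noteq> 0 \<and> h z = f z / g z"
    unfolding regular_on_def by metis
  obtain \<sigma> \<delta> where \<sigma>: "\<sigma> \<in> \<Sigma>" "regular_fun \<sigma> \<delta>" "P \<in> chart \<sigma>" "\<delta> P \<noteq> 0"
    and maps: "\<And>Q. Q \<in> chart \<sigma> \<Longrightarrow> \<delta> Q \<noteq> 0 \<Longrightarrow> \<phi> Q \<in> chart \<sigma>"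
    and char: "\<And>u. u \<in> dual_monoid \<sigma> \<Longrightarrow>
      \<exists>k F. regular_fun \<sigma> F \<and> (\<forall>Q\<in>chart \<sigma>. \<delta> Q \<noteq> 0 \<longrightarrow> snd (\<phi> Q) u * \<delta> Q ^ k = F Q)"
    using lr P(1) unfolding locally_rational_def by metis
  obtain u where u: "u \<in> dual_monoid \<sigma>"
    "\<And>P :: ('n, 'k) toric_point. P \<in> chart \<sigma> \<Longrightarrow> snd P u \<noteq> 0 \<longleftrightarrow> P \<in> chart \<sigma>'"
    "\<And>f :: ('n, 'k) toric_point \<Rightarrow> 'k. regular_fun \<sigma>' f \<Longrightarrow>
       \<exists>N. \<forall>k\<ge>N. \<exists>g. regular_fun \<sigma> g \<and> (\<forall>P\<in>chart \<sigma> \<inter> chart \<sigma>'. f P * snd P u ^ k = g P)"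
    using chart_overlap[OF \<sigma>(1) W(1)] by metis
  have "regular_fun \<sigma>' f" "regular_fun \<sigma>' g" using W by (auto simp: regular_fun_def)
  note fg = this
  obtain N1 where N1: "\<forall>k\<ge>N1. \<exists>f'. regular_fun \<sigma> f' \<and> (\<forall>P\<in>chart \<sigma> \<inter> chart \<sigma>'. f P * snd P u ^ k = f' P)"
    using u(3)[OF fg(1)] ..
  obtain N2 where N2: "\<forall>k\<ge>N2. \<exists>g'. regular_fun \<sigma> g' \<and> (\<forall>P\<in>chart \<sigma> \<inter> chart \<sigma>'. g P * snd P u ^ k = g' P)"
    using u(3)[OF fg(2)] ..
  let ?N = "max N1 N2"
  obtain f' where f': "regular_fun \<sigma> f'" "\<And>P. P \<in> chart \<sigma> \<Longrightarrow> P \<in> chart \<sigma>' \<Longrightarrow> f P * snd P u ^ ?N = f' P"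
    using N1[rule_format, of ?N] by auto
  obtain g' where g': "regular_fun \<sigma> g'" "\<And>P. P \<in> chart \<sigma> \<Longrightarrow> P \<in> chart \<sigma>' \<Longrightarrow> g P * snd P u ^ ?N = g' P"
    using N2[rule_format, of ?N] by auto
  obtain K1 where K1: "\<forall>k\<ge>K1. \<exists>F. regular_fun \<sigma> F \<and> (\<forall>Q\<in>chart \<sigma>. \<delta> Q \<noteq> 0 \<longrightarrow> f' (\<phi> Q) * \<delta> Q ^ k = F Q)"
    using pullback_regular_fun[OF \<sigma>(1,2) maps char f'(1)] ..
  obtain K2 where K2: "\<forall>k\<ge>K2. \<exists>F. regular_fun \<sigma> F \<and> (\<forall>Q\<in>chart \<sigma>. \<delta> Q \<noteq> 0 \<longrightarrow> g' (\<phi> Q) * \<delta> Q ^ k = F Q)"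
    using pullback_regular_fun[OF \<sigma>(1,2) maps char g'(1)] ..
  let ?K = "max K1 K2"
  obtain F where F: "regular_fun \<sigma> F" "\<And>Q. Q \<in> chart \<sigma> \<Longrightarrow> \<delta> Q \<noteq> 0 \<Longrightarrow> f' (\<phi> Q) * \<delta> Q ^ ?K = F Q"
    using K1[rule_format, of ?K] by auto
  obtain G where G: "regular_fun \<sigma> G" "\<And>Q. Q \<in> chart \<sigma> \<Longrightarrow> \<delta> Q \<noteq> 0 \<Longrightarrow> g' (\<phi> Q) * \<delta> Q ^ ?K = G Q"
    using K2[rule_format, of ?K] by auto
  obtain F0 G0 where F0: "F0 \<in> coordinate_ring \<sigma>" "\<forall>P\<in>chart \<sigma>. F P = F0 P"
    and G0: "G0 \<in> coordinate_ring \<sigma>" "\<forall>P\<in>chart \<sigma>. G P = G0 P"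
    using F(1) G(1) unfolding regular_fun_def by metis
  let ?W = "{Q \<in> chart \<sigma>. \<delta> Q \<noteq> 0} \<inter> {Q \<in> topspace zariski. \<phi> Q \<in> W}"
  have "openin zariski ?W"
    by (intro openin_Int openin_basic \<sigma> openin_continuous_map_preimage[OF locally_rational_continuous[OF lr] W(4)])
  moreover have "P \<in> ?W" using P \<sigma> W by (simp add: topspace_zariski)
  moreover have "?W \<subseteq> {x \<in> toric_points \<Sigma>. \<phi> x \<in> V} \<inter> chart \<sigma>"
    using W(6) by (auto simp: topspace_zariski)
  moreover have "G0 Q \<noteq> 0 \<and> (h \<circ> \<phi>) Q = F0 Q / G0 Q" if Q: "Q \<in> ?W" for Q
  proof -
    have Q1: "Q \<in> chart \<sigma>" "\<delta> Q \<noteq> 0" "\<phi> Q \<in> W" using Q by auto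
    have 1: "\<phi> Q \<in> chart \<sigma>" "\<phi> Q \<in> chart \<sigma>'" using maps Q1 W(6) by auto
    have 2: "snd (\<phi> Q) u ^ ?N * \<delta> Q ^ ?K \<noteq> 0" using u(2)[OF 1(1)] 1 Q1 by simp
    have "F0 Q = f (\<phi> Q) * (snd (\<phi> Q) u ^ ?N * \<delta> Q ^ ?K)"
      using F0 F(2)[OF Q1(1,2)] f'(2)[OF 1] Q1(1) by (simp add: mult.assoc[symmetric])
    moreover have "G0 Q = g (\<phi> Q) * (snd (\<phi> Q) u ^ ?N * \<delta> Q ^ ?K)"
      using G0 G(2)[OF Q1(1,2)] g'(2)[OF 1] Q1(1) by (simp add: mult.assoc[symmetric])
    ultimately show ?thesis using 2 W(7)[OF Q1(3)] by simp
  qed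
  ultimately show "\<exists>\<sigma>\<in>\<Sigma>. \<exists>f\<in>coordinate_ring \<sigma>. \<exists>g\<in>coordinate_ring \<sigma>. \<exists>W. openin zariski W \<and> P \<in> W \<and>
      W \<subseteq> {x \<in> toric_points \<Sigma>. \<phi> x \<in> V} \<inter> chart \<sigma> \<and> (\<forall>z\<in>W. g z \<noteq> 0 \<and> (h \<circ> \<phi>) z = f z / g z)"
    using \<sigma>(1) F0(1) G0(1) by blast
qed

lemma locally_rational_morphism: "locally_rational \<phi> \<Longrightarrow> toric_morphism \<Sigma> \<phi>"
  unfolding toric_morphism_def using locally_rational_continuous locally_rational_regular by blast

section \<open>The automorphism group\<close>

lemma regular_on_cong:
  assumes "regular_on \<Sigma> V h" "\<And>x. x \<in> V \<Longrightarrow> h x = h' x"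
  shows "regular_on \<Sigma> V h'"
  unfolding regular_on_def
proof
  fix y assume "y \<in> V"
  with assms(1) obtain \<sigma> f g W where "\<sigma>\<in>\<Sigma>" "f\<in>coordinate_ring \<sigma>" "g\<in>coordinate_ring \<sigma>"
      "openin zariski W" "y \<in> W" "W \<subseteq> V \<inter> chart \<sigma>" "\<forall>z\<in>W. g z \<noteq> 0 \<and> h z = f z / g z"
    unfolding regular_on_def by metis
  moreover from this have "\<forall>z\<in>W. g z \<noteq> 0 \<and> h' z = f z / g z" using assms(2) by (metis Int_iff subsetD)
  ultimately show "\<exists>\<sigma>\<in>\<Sigma>. \<exists>f\<in>coordinate_ring \<sigma>. \<exists>g\<in>coordinate_ring \<sigma>. \<exists>W. openin zariski W \<and> y \<in> W \<and>
      W \<subseteq> V \<inter> chart \<sigma> \<and> (\<forall>z\<in>W. g z \<noteq> 0 \<and> h' z = f z / g z)"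
    by blast
qed

lemma toric_morphism_cong:
  fixes \<phi> \<psi> :: "('n, 'k::field) toric_point \<Rightarrow> ('n, 'k) toric_point"
  assumes "toric_morphism \<Sigma> \<phi>" "\<And>x. x \<in> toric_points \<Sigma> \<Longrightarrow> \<psi> x = \<phi> x"
  shows "toric_morphism \<Sigma> \<psi>"
  unfolding toric_morphism_def
proof (intro conjI allI impI)
  have "continuous_map zariski zariski \<phi>" using assms(1) by (simp add: toric_morphism_def)
  then show "continuous_map zariski zariski \<psi>"
    by (rule continuous_map_eq) (simp add: topspace_zariski assms(2))
  fix V and h :: "('n, 'k) toric_point \<Rightarrow> 'k" assume *: "openin zariski V \<and> regular_on \<Sigma> V h"
  have "{x \<in> toric_points \<Sigma>. \<psi> x \<in> V} = {x \<in> toric_points \<Sigma>. \<phi> x \<in> V}"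
    using assms(2) by auto
  moreover have "regular_on \<Sigma> {x \<in> toric_points \<Sigma>. \<phi> x \<in> V} (h \<circ> \<phi>)"
    using assms(1) * unfolding toric_morphism_def by blast
  ultimately show "regular_on \<Sigma> {x \<in> toric_points \<Sigma>. \<psi> x \<in> V} (h \<circ> \<psi>)"
    using assms(2) by (auto elim: regular_on_cong)
qed

lemma toric_morphism_comp:
  fixes \<phi> \<psi> :: "('n, 'k::field) toric_point \<Rightarrow> ('n, 'k) toric_point"
  assumes "toric_morphism \<Sigma> \<phi>" "toric_morphism \<Sigma> \<psi>"
  shows "toric_morphism \<Sigma> (\<psi> \<circ> \<phi>)"
  unfolding toric_morphism_def
proof (intro conjI allI impI)
  have cont: "continuous_map zariski zariski \<phi>" "continuous_map zariski zariski \<psi>"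
    using assms by (auto simp: toric_morphism_def)
  then show "continuous_map zariski zariski (\<psi> \<circ> \<phi>)" by (rule continuous_map_compose)
  fix V and h :: "('n, 'k) toric_point \<Rightarrow> 'k" assume *: "openin zariski V \<and> regular_on \<Sigma> V h"
  let ?V = "{x \<in> toric_points \<Sigma>. \<psi> x \<in> V}"
  have "regular_on \<Sigma> ?V (h \<circ> \<psi>)" using assms(2) * by (simp add: toric_morphism_def)
  moreover have "openin zariski ?V"
    using openin_continuous_map_preimage[OF cont(2), of V] * by (simp add: topspace_zariski)
  ultimately have "regular_on \<Sigma> {x \<in> toric_points \<Sigma>. \<phi> x \<in> ?V} ((h \<circ> \<psi>) \<circ> \<phi>)"
    using assms(1) unfolding toric_morphism_def by blast
  moreover have "{x \<in> toric_points \<Sigma>. \<phi> x \<in> ?V} = {x \<in> toric_points \<Sigma>. (\<psi> \<circ> \<phi>) x \<in> V}"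
    using continuous_map_image_subset_topspace[OF cont(1)] by (auto simp: topspace_zariski)
  ultimately show "regular_on \<Sigma> {x \<in> toric_points \<Sigma>. (\<psi> \<circ> \<phi>) x \<in> V} (h \<circ> (\<psi> \<circ> \<phi>))"
    by (simp add: o_assoc)
qed

lemma toric_morphism_id: "toric_morphism \<Sigma> (\<lambda>x. x)"
proof -
  have "openin zariski V \<Longrightarrow> {x \<in> toric_points \<Sigma>. x \<in> V} = V"
    for V :: "('n, 'a) toric_point set"
    using openin_subset[of zariski V] by (auto simp: topspace_zariski)
  then show ?thesis unfolding toric_morphism_def by (auto simp: o_def)
qed

lemma Aut_carrier_iff:
  "\<phi> \<in> carrier (Aut_variety \<Sigma>) \<longleftrightarrow> \<phi> \<in> Bij (toric_points \<Sigma>) \<and> toric_morphism \<Sigma> \<phi> \<and>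
     toric_morphism \<Sigma> (restrict (inv_into (toric_points \<Sigma>) \<phi>) (toric_points \<Sigma>))"
  by (simp add: Aut_variety_def)

lemma Aut_subgroup: "subgroup (carrier (Aut_variety \<Sigma>)) (BijGroup (toric_points \<Sigma> :: ('n, 'k::field) toric_point set))"
proof -
  let ?X = "toric_points \<Sigma> :: ('n, 'k) toric_point set"
  let ?B = "BijGroup ?X"
  let ?A = "carrier (Aut_variety \<Sigma>) :: (('n, 'k) toric_point \<Rightarrow> ('n, 'k) toric_point) set"
  interpret B: group ?B by (rule group_BijGroup)
  have inv: "inv\<^bsub>?B\<^esub> \<phi> = restrict (inv_into ?X \<phi>) ?X" if "\<phi> \<in> Bij ?X" for \<phi>
    using that by (rule inv_BijGroup)
  have carrier: "carrier ?B = Bij ?X" by (simp add: BijGroup_def)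
  have mult: "\<phi> \<otimes>\<^bsub>?B\<^esub> \<psi> = compose ?X \<phi> \<psi>" if "\<phi> \<in> Bij ?X" "\<psi> \<in> Bij ?X"
    for \<phi> \<psi>
    using that by (simp add: BijGroup_def)
  have A: "\<phi> \<in> ?A \<longleftrightarrow> \<phi> \<in> carrier ?B \<and> toric_morphism \<Sigma> \<phi> \<and> toric_morphism \<Sigma> (inv\<^bsub>?B\<^esub> \<phi>)"
    for \<phi>
    unfolding Aut_carrier_iff carrier using inv by metis
  have comp: "toric_morphism \<Sigma> (\<phi> \<otimes>\<^bsub>?B\<^esub> \<psi>)"
    if "toric_morphism \<Sigma> \<phi>" "toric_morphism \<Sigma> \<psi>" "\<phi> \<in> carrier ?B" "\<psi> \<in> carrier ?B" for \<phi> \<psi>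
  proof (rule toric_morphism_cong)
    show "toric_morphism \<Sigma> (\<phi> \<circ> \<psi>)" using that by (intro toric_morphism_comp)
    fix P :: "('n, 'k) toric_point" assume "P \<in> ?X"
    then show "(\<phi> \<otimes>\<^bsub>?B\<^esub> \<psi>) P = (\<phi> \<circ> \<psi>) P"
      using that(3,4) unfolding carrier by (simp add: mult compose_def)
  qed
  show ?thesis
  proof (rule B.subgroupI)
    show "?A \<subseteq> carrier ?B" using A by blast
    have "toric_morphism \<Sigma> (\<one>\<^bsub>?B\<^esub>)"
      by (rule toric_morphism_cong[OF toric_morphism_id]) (simp add: BijGroup_def)
    then have "\<one>\<^bsub>?B\<^esub> \<in> ?A" unfolding A by simp
    then show "?A \<noteq> {}" by blast
    show "inv\<^bsub>?B\<^esub> \<phi> \<in> ?A" if "\<phi> \<in> ?A" for \<phi> using that unfolding A by simp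
    show "\<phi> \<otimes>\<^bsub>?B\<^esub> \<psi> \<in> ?A" if "\<phi> \<in> ?A" "\<psi> \<in> ?A" for \<phi> \<psi>
      using that unfolding A by (auto simp: comp B.inv_mult_group)
  qed
qed

lemma group_Aut: "group (Aut_variety \<Sigma> :: (('n, 'k::field) toric_point \<Rightarrow> ('n, 'k) toric_point) monoid)"
proof -
  have "Aut_variety \<Sigma> = (BijGroup (toric_points \<Sigma>))\<lparr>carrier := carrier (Aut_variety \<Sigma>)\<rparr>"
    by (simp add: Aut_variety_def)
  then show ?thesis using subgroup.subgroup_is_group[OF Aut_subgroup group_BijGroup] by metis
qed

lemma Aut_mult:
  assumes "\<phi> \<in> carrier (Aut_variety \<Sigma>)" "\<psi> \<in> carrier (Aut_variety \<Sigma>)" "P \<in> toric_points \<Sigma>"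
  shows "(\<phi> \<otimes>\<^bsub>Aut_variety \<Sigma>\<^esub> \<psi>) P = \<phi> (\<psi> P)"
  using assms by (simp add: Aut_variety_def BijGroup_def compose_def)

lemma Aut_one: "\<one>\<^bsub>Aut_variety \<Sigma>\<^esub> = (\<lambda>P\<in>toric_points \<Sigma>. P)"
  by (simp add: Aut_variety_def BijGroup_def)

lemma Aut_eqI:
  assumes "\<phi> \<in> carrier (Aut_variety \<Sigma>)" "\<psi> \<in> carrier (Aut_variety \<Sigma>)"
    "\<And>P. P \<in> toric_points \<Sigma> \<Longrightarrow> \<phi> P = \<psi> P"
  shows "\<phi> = \<psi>"
  using assms by (auto simp: Aut_carrier_iff Bij_def intro: extensionalityI)

lemma Aut_inv:
  assumes "\<phi> \<in> carrier (Aut_variety \<Sigma>)" "P \<in> toric_points \<Sigma>"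
  shows "(inv\<^bsub>Aut_variety \<Sigma>\<^esub> \<phi>) (\<phi> P) = P"
proof -
  interpret A: group "Aut_variety \<Sigma>" by (rule group_Aut)
  have "(inv\<^bsub>Aut_variety \<Sigma>\<^esub> \<phi> \<otimes>\<^bsub>Aut_variety \<Sigma>\<^esub> \<phi>) P = (inv\<^bsub>Aut_variety \<Sigma>\<^esub> \<phi>) (\<phi> P)"
    using assms by (intro Aut_mult) auto
  then show ?thesis using assms by (simp add: Aut_one)
qed

lemma Aut_I:
  assumes lr: "locally_rational \<phi>" "locally_rational \<psi>"
    and inv: "\<And>P. P \<in> toric_points \<Sigma> \<Longrightarrow> \<psi> (\<phi> P) = P" "\<And>P. P \<in> toric_points \<Sigma> \<Longrightarrow> \<phi> (\<psi> P) = P"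
  shows "restrict \<phi> (toric_points \<Sigma>) \<in> carrier (Aut_variety \<Sigma>)"
proof -
  let ?X = "toric_points \<Sigma>" let ?f = "restrict \<phi> ?X"
  have bij: "bij_betw ?f ?X ?X"
    using inv locally_rational_maps[OF lr(1)] locally_rational_maps[OF lr(2)]
    by (intro bij_betw_byWitness[of _ \<psi>]) auto
  then have "?f \<in> Bij ?X" by (simp add: Bij_def)
  moreover have "toric_morphism \<Sigma> ?f"
    by (rule toric_morphism_cong[OF locally_rational_morphism[OF lr(1)]]) simp
  moreover have "inv_into ?X ?f P = \<psi> P" if "P \<in> ?X" for P
    using inv(2)[OF that] locally_rational_maps[OF lr(2) that] bij
    by (intro inv_into_f_eq) (auto simp: bij_betw_def)
  then have "toric_morphism \<Sigma> (restrict (inv_into ?X ?f) ?X)"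
    by (intro toric_morphism_cong[OF locally_rational_morphism[OF lr(2)]]) simp
  ultimately show ?thesis unfolding Aut_carrier_iff by blast
qed

end

section \<open>Extension of characters\<close>

definition partial_character :: "(int ^ 'n) set \<Rightarrow> (int ^ 'n \<Rightarrow> 'k::field) \<Rightarrow> bool" where
  "partial_character H \<gamma> \<longleftrightarrow> 0 \<in> H \<and> (\<forall>u\<in>H. \<forall>w\<in>H. u - w \<in> H) \<and> \<gamma> 0 = 1 \<and>
     (\<forall>u\<in>H. \<forall>w\<in>H. \<gamma> (u + w) = \<gamma> u * \<gamma> w)"

lemma partial_characterD:
  assumes "partial_character H \<gamma>"
  shows "0 \<in> H" "\<gamma> 0 = 1" "\<And>u w. u \<in> H \<Longrightarrow> w \<in> H \<Longrightarrow> u - w \<in> H"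
    "\<And>u. u \<in> H \<Longrightarrow> - u \<in> H" "\<And>u w. u \<in> H \<Longrightarrow> w \<in> H \<Longrightarrow> u + w \<in> H"
    "\<And>u w. u \<in> H \<Longrightarrow> w \<in> H \<Longrightarrow> \<gamma> (u + w) = \<gamma> u * \<gamma> w"
    "\<And>u. u \<in> H \<Longrightarrow> \<gamma> u \<noteq> 0" "\<And>u. u \<in> H \<Longrightarrow> \<gamma> (- u) = inverse (\<gamma> u)"
proof -
  show 0: "0 \<in> H" "\<gamma> 0 = 1" and diff: "\<And>u w. u \<in> H \<Longrightarrow> w \<in> H \<Longrightarrow> u - w \<in> H"
    and mult: "\<And>u w. u \<in> H \<Longrightarrow> w \<in> H \<Longrightarrow> \<gamma> (u + w) = \<gamma> u * \<gamma> w"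
    using assms by (auto simp: partial_character_def)
  show neg: "\<And>u. u \<in> H \<Longrightarrow> - u \<in> H" using diff[OF 0(1)] by simp
  show "\<And>u w. u \<in> H \<Longrightarrow> w \<in> H \<Longrightarrow> u + w \<in> H" using diff[OF _ neg] by simp
  have inv: "\<gamma> u * \<gamma> (- u) = 1" if "u \<in> H" for u using mult[OF that neg[OF that]] 0 by simp
  show "\<And>u. u \<in> H \<Longrightarrow> \<gamma> u \<noteq> 0" using inv by force
  show "\<And>u. u \<in> H \<Longrightarrow> \<gamma> (- u) = inverse (\<gamma> u)"
    using inv by (metis inverse_unique)
qed

lemma partial_character_scale:
  assumes "partial_character H \<gamma>" "z \<in> H"
  shows "k *s z \<in> H \<and> \<gamma> (k *s z) = \<gamma> z powi k"
proof -
  note pc = partial_characterD[OF assms(1)]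
  have nat: "int j *s z \<in> H \<and> \<gamma> (int j *s z) = \<gamma> z ^ j" for j
  proof (induction j)
    case 0
    then show ?case using pc by simp
  next
    case (Suc j)
    have "int (Suc j) *s z = z + int j *s z" by (simp add: vec_eq_iff algebra_simps)
    then show ?case using Suc pc(5)[OF assms(2)] pc(6)[OF assms(2)] by simp
  qed
  show ?thesis
  proof (cases "0 \<le> k")
    case True
    then show ?thesis using nat[of "nat k"] by (simp add: power_int_def)
  next
    case False
    have "k *s z = - (int (nat (- k)) *s z)" using False by (simp add: vec_eq_iff)
    then show ?thesis using nat[of "nat (- k)"] pc(4) pc(8) False
      by (simp add: power_int_def power_inverse)
  qed
qed

text \<open>
  If no positive multiple of \<open>w\<close> lies in \<open>H\<close> the value is free; otherwise take a root of the prescribed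
  value at the smallest positive multiple, of which every multiple of \<open>w\<close> in \<open>H\<close> is a multiple.
\<close>

lemma partial_character_root:
  fixes \<gamma> :: "int ^ 'n \<Rightarrow> 'k::alg_closed_field"
  assumes "partial_character H \<gamma>"
  shows "\<exists>c. c \<noteq> 0 \<and> (\<forall>k. k *s w \<in> H \<longrightarrow> \<gamma> (k *s w) = c powi k)"
proof (cases "\<exists>d>0. int d *s w \<in> H")
  case False
  have "k = 0" if "k *s w \<in> H" for k
  proof (rule ccontr)
    assume "k \<noteq> 0"
    have "\<bar>k\<bar> *s w = k *s w \<or> \<bar>k\<bar> *s w = - (k *s w)" by (auto simp: abs_if vec_eq_iff)
    then have "\<bar>k\<bar> *s w \<in> H" using that partial_characterD(4)[OF assms] by auto
    then have "int (nat \<bar>k\<bar>) *s w \<in> H" by simp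
    moreover have "0 < nat \<bar>k\<bar>" using \<open>k \<noteq> 0\<close> by simp
    ultimately show False using False by blast
  qed
  then show ?thesis using partial_characterD(2)[OF assms] by (intro exI[of _ 1]) fastforce
next
  case True
  define d where "d = (LEAST d. d > 0 \<and> int d *s w \<in> H)"
  have d: "d > 0" "int d *s w \<in> H" using LeastI_ex[OF True] unfolding d_def by auto
  have least: "d \<le> j" if "j > 0" "int j *s w \<in> H" for j
    unfolding d_def using that by (intro Least_le) simp
  obtain c where c: "c ^ d = \<gamma> (int d *s w)" using nth_root_exists[OF d(1)] by blast
  have "c \<noteq> 0" using c partial_characterD(7)[OF assms d(2)] d(1) by (auto simp: power_0_left)
  moreover have "\<gamma> (k *s w) = c powi k" if k: "k *s w \<in> H" for k
  proof -
    define r where "r = k mod int d"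
    have r: "0 \<le> r" "r < int d" using d(1) by (auto simp: r_def)
    have "r *s w = k *s w - (k div int d) *s (int d *s w)"
      by (simp add: r_def vec_eq_iff minus_div_mult_eq_mod[symmetric] algebra_simps)
    then have "r *s w \<in> H"
      using partial_characterD(3)[OF assms k] partial_character_scale[OF assms d(2)] by metis
    then have "r = 0" using least[of "nat r"] r by (cases "r = 0") auto
    then have "k = int d * (k div int d)" unfolding r_def by (metis mult_div_mod_eq add.right_neutral)
    then have "k *s w = (k div int d) *s (int d *s w)" by (simp add: vec_eq_iff) (metis mult.assoc mult.commute)
    then have "\<gamma> (k *s w) = \<gamma> (int d *s w) powi (k div int d)"
      using partial_character_scale[OF assms d(2)] by metis
    also have "\<dots> = c powi (int d * (k div int d))" unfolding c[symmetric] by (simp add: power_int_mult)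
    finally show ?thesis using \<open>k = int d * (k div int d)\<close> by simp
  qed
  ultimately show ?thesis by blast
qed

text \<open>
  Divisibility of the multiplicative group of an algebraically closed field enters through the
  choice of \<open>c\<close>.
\<close>

lemma extend_character_one:
  fixes \<gamma> :: "int ^ 'n \<Rightarrow> 'k::alg_closed_field"
  assumes "partial_character H \<gamma>"
  shows "\<exists>H' \<gamma>'. partial_character H' \<gamma>' \<and> H \<subseteq> H' \<and> w \<in> H' \<and> (\<forall>u\<in>H. \<gamma>' u = \<gamma> u)"
proof -
  note pc = partial_characterD[OF assms]
  obtain c where c: "c \<noteq> 0" "\<And>k. k *s w \<in> H \<Longrightarrow> \<gamma> (k *s w) = c powi k"
    using partial_character_root[OF assms] by blast
  define H' where "H' = {h + k *s w | h k. h \<in> H}"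
  \<comment> \<open>The value does not depend on the decomposition \<open>z = h + k w\<close>, as \<open>val\<close> shows.\<close>
  define \<gamma>' where "\<gamma>' z = (let (h, k) = (SOME (h, k). h \<in> H \<and> z = h + k *s w) in \<gamma> h * c powi k)" for z
  have val: "\<gamma>' (h + k *s w) = \<gamma> h * c powi k" if h: "h \<in> H" for h k
  proof -
    let ?z = "h + k *s w"
    obtain h' k' where hk: "(SOME (h, k). h \<in> H \<and> ?z = h + k *s w) = (h', k')" by fastforce
    have "case (SOME (h, k). h \<in> H \<and> ?z = h + k *s w) of (h, k) \<Rightarrow> h \<in> H \<and> ?z = h + k *s w"
      by (rule someI[of _ "(h, k)"]) (use h in simp)
    then have h': "h' \<in> H" "?z = h' + k' *s w" unfolding hk by auto
    have eq: "(k - k') *s w = h' - h"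
      using h'(2) by (simp add: vec_eq_iff algebra_simps)
    have "(k - k') *s w \<in> H" unfolding eq using pc(3) h'(1) h by blast
    from c(2)[OF this] have "c powi (k - k') = \<gamma> (h' - h)" using eq by simp
    moreover have "\<gamma> h' = \<gamma> h * \<gamma> (h' - h)" using pc(6)[OF h pc(3)[OF h'(1) h]] by simp
    ultimately have "\<gamma> h' * c powi k' = \<gamma> h * (c powi (k - k') * c powi k')" by simp
    also have "c powi (k - k') * c powi k' = c powi k" using c(1) by (simp add: power_int_add[symmetric])
    finally show ?thesis unfolding \<gamma>'_def hk by simp
  qed
  have "partial_character H' \<gamma>'"
    unfolding partial_character_def
  proof (intro conjI ballI)
    show "0 \<in> H'" unfolding H'_def mem_Collect_eq using pc(1) by (intro exI[of _ 0]) simp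
    show "\<gamma>' 0 = 1" using val[OF pc(1), of 0] pc(2) by simp
    fix u z assume "u \<in> H'" "z \<in> H'"
    then obtain h k h' k' where hk: "h \<in> H" "u = h + k *s w" "h' \<in> H" "z = h' + k' *s w"
      unfolding H'_def by blast
    have "u - z = (h - h') + (k - k') *s w" unfolding hk by (simp add: vec_eq_iff algebra_simps)
    then show "u - z \<in> H'" unfolding H'_def using pc(3) hk by blast
    have "u + z = (h + h') + (k + k') *s w" unfolding hk by (simp add: vec_eq_iff algebra_simps)
    then have "\<gamma>' (u + z) = \<gamma> (h + h') * c powi (k + k')"
      using val[OF pc(5)[OF hk(1,3)], of "k + k'"] by metis
    then show "\<gamma>' (u + z) = \<gamma>' u * \<gamma>' z"
      unfolding hk val[OF hk(1)] val[OF hk(3)] pc(6)[OF hk(1,3)] using c(1) by (simp add: power_int_add)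
  qed
  moreover have "H \<subseteq> H'" unfolding H'_def by (auto intro!: exI[of _ "0::int"])
  moreover have "w \<in> H'" unfolding H'_def mem_Collect_eq using pc(1) by (intro exI[of _ 0] exI[of _ 1]) simp
  moreover have "\<gamma>' u = \<gamma> u" if "u \<in> H" for u using val[OF that, of 0] by simp
  ultimately show ?thesis by blast
qed

lemma extend_character:
  fixes \<gamma> :: "int ^ 'n \<Rightarrow> 'k::alg_closed_field"
  assumes "partial_character H \<gamma>" "finite W"
  shows "\<exists>H' \<gamma>'. partial_character H' \<gamma>' \<and> H \<subseteq> H' \<and> W \<subseteq> H' \<and> (\<forall>u\<in>H. \<gamma>' u = \<gamma> u)"
  using assms(2)
proof (induction W rule: finite_induct)
  case empty
  then show ?case using assms(1) by blast
next
  case (insert w W)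
  then obtain H1 \<gamma>1 where 1: "partial_character H1 \<gamma>1" "H \<subseteq> H1" "W \<subseteq> H1" "\<forall>u\<in>H. \<gamma>1 u = \<gamma> u" by blast
  obtain H2 \<gamma>2 where 2: "partial_character H2 \<gamma>2" "H1 \<subseteq> H2" "w \<in> H2" "\<forall>u\<in>H1. \<gamma>2 u = \<gamma>1 u"
    using extend_character_one[OF 1(1), of w] by blast
  have "H \<subseteq> H2" "insert w W \<subseteq> H2" "\<forall>u\<in>H. \<gamma>2 u = \<gamma> u" using 1 2 by auto
  then show ?case using 2(1) by blast
qed

lemma pairing_nondegenerate:
  assumes "\<And>w. pairing u w = 0"
  shows "u = 0"
proof -
  have "u $ i = pairing u (axis i 1)" for i
    by (simp add: pairing_def axis_def if_distrib cong: if_cong)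
  then show ?thesis using assms by (simp add: vec_eq_iff)
qed

locale bilateral_fan = toric_fan \<Sigma> m p
  for \<Sigma> :: "(real ^ 'n) set set" and m :: nat and p :: "nat \<Rightarrow> int ^ 'n" +
  fixes n :: nat and a :: "nat \<Rightarrow> nat \<Rightarrow> nat" and q :: "nat \<Rightarrow> int ^ 'n"
  assumes bilateral: "bilateral_numbering n m p a" and dual_q: "dual_basis n p q"
begin

lemma n_le_m: "n \<le> m"
  using bilateral by (simp add: bilateral_numbering_def)

lemma vector_expansion: "\<exists>c. w = (\<Sum>i=1..n. c i *s p i)"
  using bilateral unfolding bilateral_numbering_def lattice_basis_def by metis

lemma functional_eqI:
  assumes "\<And>j. j \<in> {1..n} \<Longrightarrow> pairing u (p j) = pairing w (p j)"
  shows "u = w"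
proof -
  have "pairing (u - w) z = 0" for z
  proof -
    obtain c where "z = (\<Sum>i=1..n. c i *s p i)" using vector_expansion by blast
    then show ?thesis using assms
      by (simp add: pairing_sum_right pairing_scale_right pairing_diff_left)
  qed
  then show ?thesis using pairing_nondegenerate[of "u - w"] by simp
qed

lemma pairing_q: "i \<in> {1..n} \<Longrightarrow> j \<in> {1..n} \<Longrightarrow> pairing (q i) (p j) = (if i = j then 1 else 0)"
  using dual_q by (simp add: dual_basis_def)

lemma q_expansion: "u = (\<Sum>j=1..n. pairing u (p j) *s q j)"
proof (rule functional_eqI)
  fix i assume i: "i \<in> {1..n}"
  have "pairing (\<Sum>j=1..n. pairing u (p j) *s q j) (p i) = (\<Sum>j=1..n. if j = i then pairing u (p i) else 0)"
    unfolding pairing_sum_left pairing_scale_left using i by (intro sum.cong) (auto simp: pairing_q)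
  then show "pairing u (p i) = pairing (\<Sum>j=1..n. pairing u (p j) *s q j) (p i)"
    using i by simp
qed

text \<open>
  Given a point of the orbit of \<open>\<tau>\<close>, extend its character to \<open>M\<close>; set \<open>x\<^sub>l = 0\<close> on the rays of \<open>\<tau>\<close>,
  let the remaining \<open>x\<^sub>j\<close> with \<open>j \<le> n\<close> be the values of the extension at \<open>q\<^sub>j\<close>, and put \<open>x\<^sub>k = 1\<close> for
  all other rays.
\<close>

lemma cox_map_surj:
  fixes P :: "('n, 'k::alg_closed_field) toric_point"
  assumes P: "P \<in> toric_points \<Sigma>"
  shows "\<exists>x\<in>total_space. quot x = P"
proof -
  let ?\<tau> = "fst P" let ?H = "perp_lattice ?\<tau>"
  note pp = point_props[OF P]
  have "partial_character ?H (snd P)"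
    unfolding partial_character_def
    using pp by (auto simp: perp_lattice_def real_vec_add[of _ "- _", simplified] real_vec_uminus inner_diff_left)
  from extend_character[OF this, of "q ` {1..n}"] obtain H \<gamma> where
    H: "partial_character H \<gamma>" "q ` {1..n} \<subseteq> H" "\<And>u. u \<in> ?H \<Longrightarrow> \<gamma> u = snd P u" by auto
  have sum: "(\<Sum>j\<in>J. k j *s q j) \<in> H \<and> \<gamma> (\<Sum>j\<in>J. k j *s q j) = (\<Prod>j\<in>J. \<gamma> (q j) powi k j)"
    if "finite J" "J \<subseteq> {1..n}" for J k
    using that
  proof (induction J rule: finite_induct)
    case empty
    then show ?case using partial_characterD[OF H(1)] by simp
  next
    case (insert j J)
    then have "q j \<in> H" using H(2) by auto
    then show ?case using insert partial_character_scale[OF H(1), of "q j" "k j"] partial_characterD(5,6)[OF H(1)]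
      by auto
  qed
  have \<gamma>: "\<gamma> u = (\<Prod>j=1..n. \<gamma> (q j) powi pairing u (p j))" for u
    using sum[of "{1..n}" "\<lambda>j. pairing u (p j)"] q_expansion[of u] by simp
  define x where "x l = (if l \<in> {1..m} \<and> real_vec (p l) \<in> ?\<tau> then 0 else if l \<le> n then \<gamma> (q l) else 1)" for l
  have x0: "zeros x = {l \<in> {1..m}. real_vec (p l) \<in> ?\<tau>}"
  proof -
    have "\<gamma> (q l) \<noteq> 0" if "l \<in> {1..m}" "l \<le> n" for l
      using H(2) that by (intro partial_characterD(7)[OF H(1)]) auto
    then show ?thesis by (auto simp: zeros_def x_def)
  qed
  have xc: "x \<in> total_space" unfolding cox_space_iff x0 using pp(1) by blast
  have fst: "fst (quot x) = ?\<tau>"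
  proof
    show "fst (quot x) \<subseteq> ?\<tau>" using pp(1) by (simp add: fst_quot_subset_iff x0)
    show "?\<tau> \<subseteq> fst (quot x)"
      unfolding subset_iff_rays[OF fst_quot_in_fan[OF xc] pp(1)]
      using zeros_in_fst_quot[of _ x] x0 by blast
  qed
  have "chi u x = snd P u" if u: "u \<in> ?H" for u
  proof -
    have u0: "pairing u (p l) = 0" if "l \<in> {1..m}" "real_vec (p l) \<in> ?\<tau>" for l
      using u that unfolding perp_lattice_iff[OF pp(1)] by blast
    have "chi u x = (\<Prod>l=1..n. x l powi pairing u (p l))"
      unfolding chi_def using n_le_m u0 by (intro prod.mono_neutral_right) (auto simp: x_def)
    also have "\<dots> = (\<Prod>l=1..n. \<gamma> (q l) powi pairing u (p l))"
      using n_le_m u0 by (intro prod.cong) (auto simp: x_def)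
    finally show ?thesis using \<gamma>[of u] H(3)[OF u] by simp
  qed
  then have "snd (quot x) u = snd P u" for u
    using pp(4) fst by (simp add: cox_map_def chi_def cox_cone_def)
  then show ?thesis using xc fst by (intro bexI[of _ x]) (auto simp: prod_eq_iff fun_eq_iff)
qed

end

section \<open>Root automorphisms\<close>

context toric_fan
begin

text \<open>
  The exponent at the distinguished ray of a root is \<open>nat (-1) = 0\<close>, so the product may run over all
  rays.
\<close>

definition root_monomial :: "int ^ 'n \<Rightarrow> (nat \<Rightarrow> 'k::field) \<Rightarrow> 'k" where
  "root_monomial e x = (\<Prod>s=1..m. x s ^ nat (pairing e (p s)))"

definition root_map :: "nat \<Rightarrow> int ^ 'n \<Rightarrow> 'k::field \<Rightarrow> (nat \<Rightarrow> 'k) \<Rightarrow> (nat \<Rightarrow> 'k)" where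
  "root_map i e \<alpha> x = x(i := x i + \<alpha> * root_monomial e x)"

lemma root_at:
  assumes "e \<in> demazure_roots_at m p i"
  shows "pairing e (p i) = -1" "\<And>s. s \<in> {1..m} \<Longrightarrow> s \<noteq> i \<Longrightarrow> 0 \<le> pairing e (p s)"
  using assms by (auto simp: demazure_roots_at_def)

text \<open>
  If \<open>\<chi>\<^sup>e\<close> does not vanish at a point, its orbit cone lies in \<open>e\<^sup>\<bottom>\<close>.  By completeness some cone
  contains both a relative interior point \<open>w\<close> of the orbit cone and \<open>w + \<epsilon> p\<^sub>i\<close>.  Since \<open>e\<close> is negative at
  the latter and \<open>p\<^sub>i\<close> is the only ray on which \<open>e\<close> is negative, this cone contains \<open>p\<^sub>i\<close>.
\<close>

lemma adjacent_cone:
  assumes "x \<in> total_space" "i \<in> {1..m}" "e \<in> demazure_roots_at m p i" "snd (quot x) e \<noteq> 0"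
  shows "\<exists>\<sigma>\<in>\<Sigma>. fst (quot x) \<subseteq> \<sigma> \<and> real_vec (p i) \<in> \<sigma>"
proof -
  let ?\<tau> = "fst (quot x)"
  have \<tau>: "?\<tau> \<in> \<Sigma>" using fst_quot_in_fan assms(1) by blast
  have "e \<in> perp_lattice ?\<tau>" using assms(4) snd_nonzero_iff quot_in_toric_points assms(1) by blast
  then have e0: "pairing e (p l) = 0" if "l \<in> zeros x" for l
    using zeros_in_fst_quot[OF that] that unfolding perp_lattice_iff[OF \<tau>] by (auto simp: zeros_def)
  define w where "w = (\<Sum>l\<in>zeros x. real_vec (p l))"
  let ?w = "\<lambda>k. w + inverse (real (Suc k)) *\<^sub>R real_vec (p i)"
  have lim: "?w \<longlonglongrightarrow> w"
    using tendsto_add[OF tendsto_const tendsto_scaleR[OF LIMSEQ_inverse_real_of_nat tendsto_const], of w "real_vec (p i)"]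
    by simp
  \<comment> \<open>The cones that miss \<open>w\<close> are closed and finite in number, so they also miss points close to \<open>w\<close>.\<close>
  have "\<forall>\<^sub>F k in sequentially. \<forall>\<sigma>\<in>{\<sigma>\<in>\<Sigma>. w \<notin> \<sigma>}. ?w k \<in> - \<sigma>"
  proof (rule eventually_ball_finite)
    show "finite {\<sigma>\<in>\<Sigma>. w \<notin> \<sigma>}" using finite_fan by simp
    show "\<forall>\<sigma>\<in>{\<sigma>\<in>\<Sigma>. w \<notin> \<sigma>}. \<forall>\<^sub>F k in sequentially. ?w k \<in> - \<sigma>"
    proof
      fix \<sigma> assume "\<sigma> \<in> {\<sigma>\<in>\<Sigma>. w \<notin> \<sigma>}"
      then have "open (- \<sigma>)" "w \<in> - \<sigma>" using cone_closed by (auto simp: open_Compl)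
      then show "\<forall>\<^sub>F k in sequentially. ?w k \<in> - \<sigma>" by (rule topological_tendstoD[OF lim])
    qed
  qed
  then obtain k where k: "\<And>\<sigma>. \<sigma> \<in> \<Sigma> \<Longrightarrow> ?w k \<in> \<sigma> \<Longrightarrow> w \<in> \<sigma>"
    using eventually_happens'[OF sequentially_bot] by blast
  obtain \<sigma> where \<sigma>: "\<sigma> \<in> \<Sigma>" "?w k \<in> \<sigma>" using complete by (auto simp: complete_fan_def)
  have w: "w \<in> \<sigma>" using k \<sigma> by blast
  have "real_vec e \<bullet> ?w k = - inverse (real (Suc k))"
    using e0 root_at(1)[OF assms(3)] by (simp add: w_def inner_add_right inner_sum_right inner_real_vec)
  then have "\<not> (\<forall>z\<in>\<sigma>. 0 \<le> real_vec e \<bullet> z)"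
    using \<sigma>(2) by (metis inverse_positive_iff_positive neg_0_le_iff_le not_le of_nat_0_less_iff zero_less_Suc)
  then obtain l where l: "l \<in> {1..m}" "real_vec (p l) \<in> \<sigma>" "pairing e (p l) < 0"
    unfolding functional_nonneg_iff[OF \<sigma>(1)] inner_real_vec by auto
  then have "l = i" using root_at(2)[OF assms(3)] by force
  moreover have "real_vec (p l) \<in> \<sigma>" if l: "l \<in> zeros x" for l
  proof -
    have "real_vec (p l) \<in> ?\<tau> \<inter> \<sigma>"
    proof (rule face_of_cone_sum[OF cone[OF \<tau>] Int_face[OF \<tau> \<sigma>(1)], of "zeros x"])
      show "finite (zeros x)" by (simp add: zeros_def)
      show "real_vec (p l) \<in> ?\<tau>" if "l \<in> zeros x" for l using zeros_in_fst_quot that by blast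
      then show "(\<Sum>l\<in>zeros x. real_vec (p l)) \<in> ?\<tau> \<inter> \<sigma>"
        using w convex_cone_sum[OF cone[OF \<tau>], of "zeros x" "\<lambda>l. real_vec (p l)"] by (simp add: w_def)
    qed (rule l)
    then show ?thesis by simp
  qed
  ultimately have "fst (quot x) \<subseteq> \<sigma>" "real_vec (p i) \<in> \<sigma>"
    using l(2) unfolding fst_quot_subset_iff[OF \<sigma>(1)] by auto
  then show ?thesis using \<sigma>(1) by blast
qed

lemma powi_add_nonneg: "0 \<le> a \<Longrightarrow> 0 \<le> b \<Longrightarrow> (x::'k::field) powi (a + b) = x powi a * x powi b"
  by (simp add: power_int_def nat_add_distrib power_add)

lemma powi_of_nat_mult: "(x::'k::field) powi (int t * k) = (x powi k) ^ t"
  by (metis mult.commute power_int_mult power_int_of_nat)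

lemma chi_split:
  "i \<in> {1..m} \<Longrightarrow> chi u x = x i powi pairing u (p i) * (\<Prod>l\<in>{1..m} - {i}. x l powi pairing u (p l))"
  by (simp add: chi_def prod.remove)

lemma emon_powi:
  assumes "i \<in> {1..m}" "e \<in> demazure_roots_at m p i"
  shows "root_monomial e x = (\<Prod>l\<in>{1..m} - {i}. x l powi pairing e (p l))"
proof -
  have "root_monomial e x = (\<Prod>l\<in>{1..m} - {i}. x l ^ nat (pairing e (p l)))"
    unfolding root_monomial_def using assms(1) root_at(1)[OF assms(2)] by (simp add: prod.remove)
  also have "\<dots> = (\<Prod>l\<in>{1..m} - {i}. x l powi pairing e (p l))"
    using root_at(2)[OF assms(2)] by (intro prod.cong) (auto simp: power_int_def)
  finally show ?thesis .
qed

text \<open>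
  Binomial expansion of \<open>(x\<^sub>i + \<alpha> x\<^sup>e)\<^sup>d\<close>; the \<open>t\<close>-th term shifts the exponent \<open>u\<close> by \<open>t e\<close>.
\<close>

lemma chi_root_map_inside:
  assumes i: "i \<in> {1..m}" and e: "e \<in> demazure_roots_at m p i"
    and \<sigma>: "\<sigma> \<in> \<Sigma>" "fst (quot x) \<subseteq> \<sigma>" "real_vec (p i) \<in> \<sigma>" and u: "u \<in> dual_monoid \<sigma>"
  defines "d \<equiv> nat (pairing u (p i))"
  shows "chi u (root_map i e \<alpha> x) = (\<Sum>t\<le>d. of_nat (d choose t) * \<alpha> ^ t * chi (u + of_nat t *s e) x)"
proof -
  let ?L = "{1..m} - {i}" let ?y = "root_map i e \<alpha> x"
  have d: "pairing u (p i) = int d" using u i \<sigma>(3) unfolding dual_monoid_iff[OF \<sigma>(1)] d_def by simp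
  note split = chi_split[OF i]
  have rest: "(\<Prod>l\<in>?L. ?y l powi pairing u (p l)) = (\<Prod>l\<in>?L. x l powi pairing u (p l))"
    by (intro prod.cong) (auto simp: root_map_def)
  have expand: "x i ^ (d - t) * root_monomial e x ^ t * (\<Prod>l\<in>?L. x l powi pairing u (p l)) = chi (u + of_nat t *s e) x"
    if t: "t \<le> d" for t
  proof -
    have "pairing (u + of_nat t *s e) (p i) = int (d - t)"
      using d root_at(1)[OF e] t by (simp add: pairing_add_left pairing_scale_left of_nat_diff)
    moreover have "x l powi pairing (u + of_nat t *s e) (p l) = (x l powi pairing e (p l)) ^ t * x l powi pairing u (p l)"
      if l: "l \<in> ?L" for l
    proof (cases "x l = 0")
      case False
      then show ?thesis by (simp add: pairing_add_left pairing_scale_left power_int_add powi_of_nat_mult mult.commute)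
    next
      case True
      then have "l \<in> zeros x" using l by (simp add: zeros_def)
      then have "real_vec (p l) \<in> \<sigma>" using zeros_in_fst_quot \<sigma>(2) by blast
      then have "0 \<le> pairing u (p l)" using u l unfolding dual_monoid_iff[OF \<sigma>(1)] by blast
      moreover have "0 \<le> pairing e (p l)" using root_at(2)[OF e] l by blast
      ultimately show ?thesis
        by (simp add: pairing_add_left pairing_scale_left powi_add_nonneg powi_of_nat_mult mult.commute)
    qed
    ultimately show ?thesis
      unfolding split[of "u + of_nat t *s e" x] emon_powi[OF i e] by (simp add: prod_power_distrib[symmetric] prod.distrib mult_ac)
  qed
  have "chi u ?y = (x i + \<alpha> * root_monomial e x) ^ d * (\<Prod>l\<in>?L. x l powi pairing u (p l))"
    unfolding split[of u] rest d by (simp add: root_map_def)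
  also have "(x i + \<alpha> * root_monomial e x) ^ d = (\<Sum>t\<le>d. of_nat (d choose t) * (\<alpha> * root_monomial e x) ^ t * x i ^ (d - t))"
    using binomial_ring[of "\<alpha> * root_monomial e x" "x i" d] by (simp add: add.commute)
  also have "\<dots> * (\<Prod>l\<in>?L. x l powi pairing u (p l))
      = (\<Sum>t\<le>d. of_nat (d choose t) * \<alpha> ^ t * (x i ^ (d - t) * root_monomial e x ^ t * (\<Prod>l\<in>?L. x l powi pairing u (p l))))"
    unfolding sum_distrib_right by (intro sum.cong) (simp_all add: power_mult_distrib mult_ac)
  also have "\<dots> = (\<Sum>t\<le>d. of_nat (d choose t) * \<alpha> ^ t * chi (u + of_nat t *s e) x)"
    by (intro sum.cong refl) (simp only: expand atMost_iff)
  finally show ?thesis .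
qed

lemma root_power_in_dual:
  assumes i: "i \<in> {1..m}" and e: "e \<in> demazure_roots_at m p i"
    and \<sigma>: "\<sigma> \<in> \<Sigma>" and u: "u \<in> dual_monoid \<sigma>" and t: "int t \<le> pairing u (p i)"
  shows "u + of_nat t *s e \<in> dual_monoid \<sigma>"
  unfolding dual_monoid_iff[OF \<sigma>]
proof (intro ballI impI)
  fix l assume l: "l \<in> {1..m}" "real_vec (p l) \<in> \<sigma>"
  have "0 \<le> pairing u (p l)" using u l unfolding dual_monoid_iff[OF \<sigma>] by blast
  moreover have "0 \<le> pairing e (p l)" if "l \<noteq> i" using root_at(2)[OF e] l that by blast
  ultimately show "0 \<le> pairing (u + of_nat t *s e) (p l)"
    using root_at(1)[OF e] t by (cases "l = i") (auto simp: pairing_add_left pairing_scale_left)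
qed

text \<open>
  Here \<open>x\<^sub>i\<close> is invertible and \<open>x\<^sup>e = x\<^sub>i \<chi>\<^sup>e(x)\<close>.
\<close>

lemma root_map_outside:
  assumes i: "i \<in> {1..m}" and e: "e \<in> demazure_roots_at m p i" and "x i \<noteq> 0"
  shows "root_map i e \<alpha> x i = x i * (1 + \<alpha> * chi e x)"
    "chi u (root_map i e \<alpha> x) = chi u x * (1 + \<alpha> * chi e x) powi pairing u (p i)"
proof -
  let ?L = "{1..m} - {i}"
  have "root_monomial e x = x i * chi e x"
    unfolding chi_split[OF i] emon_powi[OF i e] using root_at(1)[OF e] \<open>x i \<noteq> 0\<close> by (simp add: power_int_minus)
  then show 1: "root_map i e \<alpha> x i = x i * (1 + \<alpha> * chi e x)"
    by (simp add: root_map_def algebra_simps)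
  show "chi u (root_map i e \<alpha> x) = chi u x * (1 + \<alpha> * chi e x) powi pairing u (p i)"
  proof -
    have "(\<Prod>l\<in>?L. root_map i e \<alpha> x l powi pairing u (p l)) = (\<Prod>l\<in>?L. x l powi pairing u (p l))"
      by (intro prod.cong) (auto simp: root_map_def)
    then show ?thesis unfolding chi_split[OF i, of u] 1 by (simp add: power_int_mult_distrib mult_ac)
  qed
qed

text \<open>
  The root substitution maps the nonvanishing locus of this function in the chart of \<open>\<sigma>\<close> into that
  chart.
\<close>

definition denominator :: "nat \<Rightarrow> int ^ 'n \<Rightarrow> 'k::field \<Rightarrow> (real ^ 'n) set \<Rightarrow> ('n, 'k) toric_point \<Rightarrow> 'k" where
  "denominator i e \<alpha> \<sigma> P = (if real_vec (p i) \<in> \<sigma> then 1 else 1 + \<alpha> * snd P e)"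

lemma root_in_dual:
  assumes "i \<in> {1..m}" "e \<in> demazure_roots_at m p i" "\<sigma> \<in> \<Sigma>" "real_vec (p i) \<notin> \<sigma>"
  shows "e \<in> dual_monoid \<sigma>"
  using assms root_at(2)[OF assms(2)] unfolding dual_monoid_iff[OF assms(3)] by metis

lemma regular_fun_denominator:
  assumes "i \<in> {1..m}" "e \<in> demazure_roots_at m p i" "\<sigma> \<in> \<Sigma>"
  shows "regular_fun \<sigma> (denominator i e \<alpha> \<sigma>)"
proof (cases "real_vec (p i) \<in> \<sigma>")
  case True
  then have "denominator i e \<alpha> \<sigma> = (\<lambda>P. 1)" by (auto simp: denominator_def)
  then show ?thesis using regular_fun_const by simp
next
  case False
  then have "denominator i e \<alpha> \<sigma> = (\<lambda>P. 1 + \<alpha> * snd P e)" by (auto simp: denominator_def)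
  then show ?thesis
    by (simp only:) (intro regular_fun_add regular_fun_const regular_fun_scale regular_fun_char root_in_dual[OF assms False])
qed

lemma root_map_chart:
  assumes x: "x \<in> total_space" and i: "i \<in> {1..m}" and e: "e \<in> demazure_roots_at m p i"
    and \<sigma>: "\<sigma> \<in> \<Sigma>" "quot x \<in> chart \<sigma>" and \<delta>: "denominator i e \<alpha> \<sigma> (quot x) \<noteq> 0"
  shows "root_map i e \<alpha> x \<in> total_space" "quot (root_map i e \<alpha> x) \<in> chart \<sigma>"
proof -
  have sub: "\<forall>l\<in>zeros x. real_vec (p l) \<in> \<sigma>"
    using \<sigma> fst_quot_subset_iff by (auto simp: affine_chart_def)
  have z: "\<forall>l\<in>zeros (root_map i e \<alpha> x). real_vec (p l) \<in> \<sigma>"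
  proof
    fix l assume l: "l \<in> zeros (root_map i e \<alpha> x)"
    show "real_vec (p l) \<in> \<sigma>"
    proof (cases "l = i")
      case False
      then have "l \<in> zeros x" using l by (auto simp: zeros_def root_map_def)
      then show ?thesis using sub by blast
    next
      case True
      show ?thesis
      proof (rule ccontr)
        assume no: "real_vec (p l) \<notin> \<sigma>"
        then have xi: "x i \<noteq> 0" using sub i True by (auto simp: zeros_def)
        have "snd (quot x) e = chi e x"
          using root_in_dual[OF i e \<sigma>(1)] no True \<sigma> x by (intro snd_quot_chart) (auto simp: affine_chart_def)
        then have "1 + \<alpha> * chi e x \<noteq> 0" using \<delta> no True by (simp add: denominator_def)
        then have "root_map i e \<alpha> x i \<noteq> 0"
          using root_map_outside(1)[OF i e, where x = x, OF xi] xi by simp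
        then show False using l True by (simp add: zeros_def)
      qed
    qed
  qed
  show 1: "root_map i e \<alpha> x \<in> total_space" unfolding cox_space_iff using z \<sigma>(1) by blast
  show "quot (root_map i e \<alpha> x) \<in> chart \<sigma>"
    using quot_in_toric_points[OF 1] z \<sigma>(1) by (simp add: affine_chart_def fst_quot_subset_iff)
qed

text \<open>
  The pulled back character only depends on the image point, which is why the substitution descends.
\<close>

lemma root_map_pullback:
  fixes \<alpha> :: "'k::field"
  assumes i: "i \<in> {1..m}" and e: "e \<in> demazure_roots_at m p i"
    and \<sigma>: "\<sigma> \<in> \<Sigma>" and u: "u \<in> dual_monoid \<sigma>"
  shows "\<exists>k F. regular_fun \<sigma> F \<and> (\<forall>x\<in>total_space. quot x \<in> chart \<sigma> \<longrightarrow> denominator i e \<alpha> \<sigma> (quot x) \<noteq> 0 \<longrightarrow>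
     snd (quot (root_map i e \<alpha> x)) u * denominator i e \<alpha> \<sigma> (quot x) ^ k = F (quot x))"
proof -
  have val: "snd (quot (root_map i e \<alpha> x)) u = chi u (root_map i e \<alpha> x)"
    if "x \<in> total_space" "quot x \<in> chart \<sigma>" "denominator i e \<alpha> \<sigma> (quot x) \<noteq> 0" for x
    using root_map_chart[OF that(1) i e \<sigma> that(2,3)] u \<sigma> by (intro snd_quot_chart) (auto simp: affine_chart_def)
  have val0: "snd (quot x) w = chi w x" if "x \<in> total_space" "quot x \<in> chart \<sigma>" "w \<in> dual_monoid \<sigma>"
    for w and x :: "nat \<Rightarrow> 'k"
    using that \<sigma> by (intro snd_quot_chart) (auto simp: affine_chart_def)
  show ?thesis
  proof (cases "real_vec (p i) \<in> \<sigma>")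
    case True
    define d where "d = nat (pairing u (p i))"
    have d: "pairing u (p i) = int d" using u i True unfolding dual_monoid_iff[OF \<sigma>] d_def by simp
    have dual: "u + of_nat t *s e \<in> dual_monoid \<sigma>" if "t \<le> d" for t
      using that d by (intro root_power_in_dual[OF i e \<sigma> u]) simp
    let ?F = "\<lambda>P. \<Sum>t\<le>d. (of_nat (d choose t) * \<alpha> ^ t) * snd P (u + of_nat t *s e)"
    have "regular_fun \<sigma> ?F" using dual by (intro regular_fun_sum regular_fun_scale regular_fun_char) auto
    moreover have "snd (quot (root_map i e \<alpha> x)) u * denominator i e \<alpha> \<sigma> (quot x) ^ 0 = ?F (quot x)"
      if x: "x \<in> total_space" "quot x \<in> chart \<sigma>" "denominator i e \<alpha> \<sigma> (quot x) \<noteq> 0" for x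
    proof -
      have "chi u (root_map i e \<alpha> x) = (\<Sum>t\<le>d. of_nat (d choose t) * \<alpha> ^ t * chi (u + of_nat t *s e) x)"
        unfolding d_def using x(2) by (intro chi_root_map_inside[OF i e \<sigma> _ True u]) (simp add: affine_chart_def)
      also have "\<dots> = ?F (quot x)" using val0[OF x(1,2) dual] by (intro sum.cong) auto
      finally show ?thesis using val[OF x] by simp
    qed
    ultimately show ?thesis by blast
  next
    case False
    note ed = root_in_dual[OF i e \<sigma> False]
    have key: "snd (quot (root_map i e \<alpha> x)) u = snd (quot x) u * denominator i e \<alpha> \<sigma> (quot x) powi pairing u (p i)"
      if x: "x \<in> total_space" "quot x \<in> chart \<sigma>" "denominator i e \<alpha> \<sigma> (quot x) \<noteq> 0" for x
    proof -
      have "i \<notin> zeros x" using False x(2) \<sigma> fst_quot_subset_iff by (auto simp: affine_chart_def)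
      then have xi: "x i \<noteq> 0" using i by (simp add: zeros_def)
      have "denominator i e \<alpha> \<sigma> (quot x) = 1 + \<alpha> * chi e x"
        using False val0[OF x(1,2) ed] by (simp add: denominator_def)
      then show ?thesis using val[OF x] val0[OF x(1,2) u] root_map_outside(2)[OF i e, where x = x, OF xi] by simp
    qed
    let ?d = "pairing u (p i)"
    let ?F = "\<lambda>P. snd P u * denominator i e \<alpha> \<sigma> P ^ nat ?d"
    have "regular_fun \<sigma> ?F" by (intro regular_fun_mult[OF \<sigma>] regular_fun_char[OF u] regular_fun_power[OF \<sigma>] regular_fun_denominator i e \<sigma>)
    moreover have "snd (quot (root_map i e \<alpha> x)) u * denominator i e \<alpha> \<sigma> (quot x) ^ nat (- ?d) = ?F (quot x)"
      if x: "x \<in> total_space" "quot x \<in> chart \<sigma>" "denominator i e \<alpha> \<sigma> (quot x) \<noteq> 0" for x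
      unfolding key[OF x] using x(3) by (simp add: power_int_def power_inverse field_simps)
    ultimately show ?thesis by blast
  qed
qed

text \<open>
  If no cone around the orbit cone contains \<open>p\<^sub>i\<close>, then \<open>\<chi>\<^sup>e\<close> vanishes at the point, and \<open>1 + \<alpha> \<chi>\<^sup>e\<close> has
  the value \<open>1\<close> there.
\<close>

lemma good_chart_exists:
  assumes x: "x \<in> total_space" and i: "i \<in> {1..m}" and e: "e \<in> demazure_roots_at m p i"
  shows "\<exists>\<sigma>\<in>\<Sigma>. quot x \<in> chart \<sigma> \<and> denominator i e \<alpha> \<sigma> (quot x) \<noteq> 0"
proof (cases "\<exists>\<sigma>\<in>\<Sigma>. fst (quot x) \<subseteq> \<sigma> \<and> real_vec (p i) \<in> \<sigma>")
  case True
  then obtain \<sigma> where "\<sigma>\<in>\<Sigma>" "fst (quot x) \<subseteq> \<sigma>" "real_vec (p i) \<in> \<sigma>" by blast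
  then show ?thesis using quot_in_toric_points[OF x]
    by (intro bexI[of _ \<sigma>]) (auto simp: affine_chart_def denominator_def)
next
  case False
  then have "snd (quot x) e = 0" using adjacent_cone[OF x i e] by blast
  then show ?thesis using quot_in_toric_points[OF x] fst_quot_in_fan[OF x]
    by (intro bexI[of _ "fst (quot x)"]) (auto simp: affine_chart_def denominator_def)
qed

lemma root_map_cox_space:
  assumes x: "x \<in> total_space" and i: "i \<in> {1..m}" and e: "e \<in> demazure_roots_at m p i"
  shows "root_map i e \<alpha> x \<in> total_space"
  using good_chart_exists[OF assms, of \<alpha>] root_map_chart(1)[OF assms] by blast

text \<open>
  For fans that are not simplicial the fibres of the quotient map need not be single orbits of a
  group, so equality of the images is checked on the coordinates of a chart.
\<close>

lemma root_map_well_defined: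
  fixes x y :: "nat \<Rightarrow> 'k::field"
  assumes i: "i \<in> {1..m}" and e: "e \<in> demazure_roots_at m p i"
    and x: "x \<in> total_space" and y: "y \<in> total_space" and eq: "quot x = quot y"
  shows "quot (root_map i e \<alpha> x) = quot (root_map i e \<alpha> y)"
proof -
  obtain \<sigma> where \<sigma>: "\<sigma> \<in> \<Sigma>" "quot x \<in> chart \<sigma>" "denominator i e \<alpha> \<sigma> (quot x) \<noteq> 0"
    using good_chart_exists[OF x i e] by blast
  note \<sigma>' = \<sigma>(2,3)[unfolded eq]
  show ?thesis
  proof (rule chart_point_eqI[OF \<sigma>(1)])
    show "quot (root_map i e \<alpha> x) \<in> chart \<sigma>" using root_map_chart(2)[OF x i e \<sigma>] .
    show "quot (root_map i e \<alpha> y) \<in> chart \<sigma>"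
      using root_map_chart(2)[OF y i e \<sigma>(1) \<sigma>'] .
    fix u assume "u \<in> dual_monoid \<sigma>"
    then obtain k and F :: "('n, 'k) toric_point \<Rightarrow> 'k" where
      F: "\<And>x. x \<in> total_space \<Longrightarrow> quot x \<in> chart \<sigma> \<Longrightarrow> denominator i e \<alpha> \<sigma> (quot x) \<noteq> 0 \<Longrightarrow>
        snd (quot (root_map i e \<alpha> x)) u * denominator i e \<alpha> \<sigma> (quot x) ^ k = F (quot x)"
      using root_map_pullback[OF i e \<sigma>(1), of u \<alpha>] by blast
    show "snd (quot (root_map i e \<alpha> x)) u = snd (quot (root_map i e \<alpha> y)) u"
      using F[OF x \<sigma>(2,3)] F[OF y \<sigma>'] \<sigma>'(2) unfolding eq by (metis mult_cancel_right power_eq_0_iff)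
  qed
qed

end

context bilateral_fan
begin

text \<open>
  The choice of the preimage is immaterial by \<open>root_map_well_defined\<close>.
\<close>

definition root_aut :: "nat \<Rightarrow> int ^ 'n \<Rightarrow> 'k::alg_closed_field \<Rightarrow> ('n, 'k) toric_point \<Rightarrow> ('n, 'k) toric_point" where
  "root_aut i e \<alpha> P = quot (root_map i e \<alpha> (SOME x. x \<in> total_space \<and> quot x = P))"

lemma root_aut_quot:
  assumes i: "i \<in> {1..m}" and e: "e \<in> demazure_roots_at m p i" and x: "x \<in> total_space"
  shows "root_aut i e \<alpha> (quot x) = quot (root_map i e \<alpha> x)"
proof -
  let ?y = "SOME y. y \<in> total_space \<and> quot y = quot x"
  have "?y \<in> total_space \<and> quot ?y = quot x" by (rule someI[of _ x]) (use x in simp)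
  then show ?thesis unfolding root_aut_def using root_map_well_defined[OF i e _ x] by blast
qed

lemma root_aut_locally_rational:
  fixes \<alpha> :: "'k::alg_closed_field"
  assumes i: "i \<in> {1..m}" and e: "e \<in> demazure_roots_at m p i"
  shows "locally_rational (root_aut i e \<alpha>)"
  unfolding locally_rational_def
proof
  fix P :: "('n, 'k) toric_point" assume "P \<in> toric_points \<Sigma>"
  then obtain x where x: "x \<in> total_space" "quot x = P" using cox_map_surj by blast
  obtain \<sigma> where \<sigma>: "\<sigma> \<in> \<Sigma>" "P \<in> chart \<sigma>" "denominator i e \<alpha> \<sigma> P \<noteq> 0"
    using good_chart_exists[OF x(1) i e] x(2) by blast
  have lift: "\<exists>y\<in>total_space. quot y = Q" if "Q \<in> chart \<sigma>" for Q :: "('n, 'k) toric_point"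
    using that cox_map_surj[of Q] by (simp add: affine_chart_def)
  have "root_aut i e \<alpha> Q \<in> chart \<sigma>" if Q: "Q \<in> chart \<sigma>" "denominator i e \<alpha> \<sigma> Q \<noteq> 0"
    for Q
  proof -
    obtain y where y: "y \<in> total_space" "quot y = Q" using lift[OF Q(1)] by blast
    show ?thesis using root_map_chart(2)[OF y(1) i e \<sigma>(1), of \<alpha>] root_aut_quot[OF i e y(1)] Q
      unfolding y(2) by simp
  qed
  moreover have "\<exists>k F. regular_fun \<sigma> F \<and> (\<forall>Q\<in>chart \<sigma>. denominator i e \<alpha> \<sigma> Q \<noteq> 0 \<longrightarrow>
      snd (root_aut i e \<alpha> Q) u * denominator i e \<alpha> \<sigma> Q ^ k = F Q)" if u: "u \<in> dual_monoid \<sigma>" for u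
  proof -
    obtain k and F :: "('n, 'k) toric_point \<Rightarrow> 'k" where F: "regular_fun \<sigma> F"
      "\<And>x. x \<in> total_space \<Longrightarrow> quot x \<in> chart \<sigma> \<Longrightarrow> denominator i e \<alpha> \<sigma> (quot x) \<noteq> 0 \<Longrightarrow>
        snd (quot (root_map i e \<alpha> x)) u * denominator i e \<alpha> \<sigma> (quot x) ^ k = F (quot x)"
      using root_map_pullback[OF i e \<sigma>(1) u, of \<alpha>] by blast
    have "snd (root_aut i e \<alpha> Q) u * denominator i e \<alpha> \<sigma> Q ^ k = F Q" if Q: "Q \<in> chart \<sigma>" "denominator i e \<alpha> \<sigma> Q \<noteq> 0"
      for Q
    proof -
      obtain y where y: "y \<in> total_space" "quot y = Q" using lift[OF Q(1)] by blast
      show ?thesis using F(2)[OF y(1)] root_aut_quot[OF i e y(1)] Q unfolding y(2) by simp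
    qed
    then show ?thesis using F(1) by blast
  qed
  ultimately show "\<exists>\<sigma>\<in>\<Sigma>. \<exists>\<delta>. regular_fun \<sigma> \<delta> \<and> P \<in> chart \<sigma> \<and> \<delta> P \<noteq> 0 \<and>
     (\<forall>Q\<in>chart \<sigma>. \<delta> Q \<noteq> 0 \<longrightarrow> root_aut i e \<alpha> Q \<in> chart \<sigma>) \<and>
     (\<forall>u\<in>dual_monoid \<sigma>. \<exists>k F. regular_fun \<sigma> F \<and> (\<forall>Q\<in>chart \<sigma>. \<delta> Q \<noteq> 0 \<longrightarrow> snd (root_aut i e \<alpha> Q) u * \<delta> Q ^ k = F Q))"
    using \<sigma> regular_fun_denominator[OF i e \<sigma>(1), of \<alpha>] by (intro bexI[of _ \<sigma>] exI[of _ "denominator i e \<alpha> \<sigma>"]) auto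
qed

lemma root_map_inverse:
  assumes "e \<in> demazure_roots_at m p i"
  shows "root_map i e (- \<alpha>) (root_map i e \<alpha> x) = x"
proof -
  have "root_monomial e (root_map i e \<alpha> x) = root_monomial e x"
    unfolding root_monomial_def using root_at(1)[OF assms] by (intro prod.cong) (auto simp: root_map_def)
  then show ?thesis by (simp add: root_map_def)
qed

lemma root_aut_in_Aut:
  fixes \<alpha> :: "'k::alg_closed_field"
  assumes i: "i \<in> {1..m}" and e: "e \<in> demazure_roots_at m p i"
  shows "restrict (root_aut i e \<alpha>) (toric_points \<Sigma>) \<in> carrier (Aut_variety \<Sigma>)"
proof (rule Aut_I[of _ "root_aut i e (- \<alpha>)"])
  have inv: "root_aut i e (- \<beta>) (root_aut i e \<beta> P) = P" if P: "P \<in> toric_points \<Sigma>"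
    for P and \<beta> :: 'k
  proof -
    obtain x where x: "x \<in> total_space" "quot x = P" using cox_map_surj[OF P] by blast
    then show ?thesis
      using root_aut_quot[OF i e x(1), of \<beta>] root_aut_quot[OF i e root_map_cox_space[OF x(1) i e, of \<beta>], of "- \<beta>"]
        root_map_inverse[OF e, of \<beta> x] by simp
  qed
  show "root_aut i e (- \<alpha>) (root_aut i e \<alpha> P) = P" if "P \<in> toric_points \<Sigma>" for P
    using inv[OF that] .
  show "root_aut i e \<alpha> (root_aut i e (- \<alpha>) P) = P" if "P \<in> toric_points \<Sigma>" for P
    using inv[OF that, of "- \<alpha>"] by simp
qed (intro root_aut_locally_rational i e)+

end

section \<open>Exponentials of root derivations\<close>

lemma mvar_power: "mvar s ^ k = (Poly_Mapping.single (Poly_Mapping.single s k) 1 :: 'k::field mpoly)"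
proof (induction k)
  case 0
  then show ?case by (simp add: one_poly_mapping.abs_eq single.abs_eq when_def) 
next
  case (Suc k)
  then show ?case by (simp add: mvar_def Poly_Mapping.mult_single Poly_Mapping.single_add[symmetric])
qed

lemma prod_mvar_power:
  "finite S \<Longrightarrow> (\<Prod>s\<in>S. mvar s ^ k s)
     = (Poly_Mapping.single (\<Sum>s\<in>S. Poly_Mapping.single s (k s)) 1 :: 'k::field mpoly)"
  by (induction S rule: finite_induct) (simp_all add: mvar_power Poly_Mapping.mult_single)

lemma lookup_sum_single:
  "finite S \<Longrightarrow> Poly_Mapping.lookup (\<Sum>s\<in>S. Poly_Mapping.single s (k s)) l = (if l \<in> S then k l else (0::nat))"
  by (simp add: Poly_Mapping.lookup_sum Poly_Mapping.lookup_single when_def)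

lemma mpderiv_single:
  "mpderiv i (Poly_Mapping.single t c) =
     Poly_Mapping.single (t - Poly_Mapping.single i 1) (of_nat (Poly_Mapping.lookup t i) * c)"
  by (cases "c = 0") (simp_all add: mpderiv_def)

lemma meval_superset:
  assumes "finite K" "Poly_Mapping.keys f \<subseteq> K"
  shows "meval x f = (\<Sum>t\<in>K. Poly_Mapping.lookup f t *
     (\<Prod>l\<in>Poly_Mapping.keys t. x l ^ Poly_Mapping.lookup t l))"
  unfolding meval_def using assms
  by (intro sum.mono_neutral_left) (auto simp: Poly_Mapping.in_keys_iff)

lemma meval_add: "meval x (f + g) = meval x f + meval x g"
proof -
  let ?K = "Poly_Mapping.keys f \<union> Poly_Mapping.keys g"
  have "Poly_Mapping.keys (f + g) \<subseteq> ?K" by (rule Poly_Mapping.keys_add)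
  then show ?thesis
    using meval_superset[of ?K f x] meval_superset[of ?K g x] meval_superset[of ?K "f + g" x]
    by (simp add: Poly_Mapping.lookup_add distrib_right sum.distrib)
qed

lemma meval_single:
  "meval x (Poly_Mapping.single t c) = c * (\<Prod>l\<in>Poly_Mapping.keys t. x l ^ Poly_Mapping.lookup t l)"
  by (cases "c = 0") (simp_all add: meval_def)

lemma single_one_nonzero: "Poly_Mapping.single t (1 :: 'k::field) \<noteq> 0"
  by (metis Poly_Mapping.lookup_single_eq Poly_Mapping.lookup_zero zero_neq_one)

text \<open>
  The derivation sends \<open>x\<^sub>i\<close> to a monomial free of \<open>x\<^sub>i\<close>, which it kills together with all other
  variables, so the exponential series stops after the linear term.
\<close>

lemma exp_root_derivation:
  fixes \<alpha> :: "'k::field_char_0"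
  assumes i: "i \<in> {1..m}" and e: "e \<in> demazure_roots_at m p i"
  shows "point_map (exp_derivation (root_derivation m p i e) \<alpha>) x
     = x(i := x i + \<alpha> * (\<Prod>s=1..m. x s ^ nat (pairing e (p s))))"
proof
  fix l
  let ?D = "root_derivation m p i e :: 'k mpoly \<Rightarrow> 'k mpoly"
  define T where "T = (\<Sum>s\<in>{1..m} - {i}. Poly_Mapping.single s (nat (pairing e (p s))))"
  have T: "Poly_Mapping.lookup T s = (if s \<in> {1..m} - {i} then nat (pairing e (p s)) else 0)" for s
    unfolding T_def by (rule lookup_sum_single) simp
  have D: "?D f = Poly_Mapping.single T 1 * mpderiv i f" for f
    unfolding root_derivation_def T_def by (subst prod_mvar_power) simp_all
  have D0: "?D 0 = 0" unfolding D by (simp add: mpderiv_def)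
  have D0': "(?D ^^ j) 0 = 0" for j by (induction j) (simp_all add: D0)
  have var: "mvar l \<noteq> (0 :: 'k mpoly)"
    unfolding mvar_def by (rule single_one_nonzero)
  show "point_map (exp_derivation ?D \<alpha>) x l = (x(i := x i + \<alpha> * (\<Prod>s=1..m. x s ^ nat (pairing e (p s))))) l"
  proof (cases "l = i")
    case False
    have "?D (mvar l) = 0" unfolding D mvar_def mpderiv_single using False
      by (simp add: Poly_Mapping.lookup_single)
    then have "(?D ^^ Suc j) (mvar l) = 0" for j by (simp add: funpow_Suc_right D0' del: funpow.simps)
    then have "(?D ^^ j) (mvar l) \<noteq> 0 \<longleftrightarrow> j \<in> {0}" for j
      using var by (cases j) (simp_all del: funpow.simps)
    then have "{j. (?D ^^ j) (mvar l) \<noteq> 0} = {0}" by blast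
    then have "exp_derivation ?D \<alpha> (mvar l) = mvar l" by (simp add: exp_derivation_def)
    then show ?thesis using False by (simp add: point_map_def mvar_def meval_single)
  next
    case True
    have D1: "?D (mvar i) = Poly_Mapping.single T 1" unfolding D mvar_def mpderiv_single
      by (simp add: Poly_Mapping.mult_single)
    have D2: "?D (Poly_Mapping.single T 1) = 0" unfolding D mpderiv_single by (simp add: T)
    have "(?D ^^ Suc (Suc j)) (mvar i) = 0" for j by (simp add: funpow_Suc_right D1 D2 D0' del: funpow.simps)
    moreover have "(?D ^^ 1) (mvar i) \<noteq> 0" by (simp add: D1 single_one_nonzero)
    ultimately have "(?D ^^ j) (mvar i) \<noteq> 0 \<longleftrightarrow> j \<in> {0, 1}" for j
    proof (cases j)
      case (Suc j')
      then show ?thesis using \<open>\<And>j. (?D ^^ Suc (Suc j)) (mvar i) = 0\<close> \<open>(?D ^^ 1) (mvar i) \<noteq> 0\<close>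
        by (cases j') (simp_all del: funpow.simps)
    qed (use var True in simp)
    then have "{j. (?D ^^ j) (mvar i) \<noteq> 0} = {0, 1}" by blast
    then have "exp_derivation ?D \<alpha> (mvar i) = mvar i + Poly_Mapping.single T \<alpha>"
      by (simp add: exp_derivation_def D1 Poly_Mapping.mult_single)
    then have "point_map (exp_derivation ?D \<alpha>) x i
        = x i + \<alpha> * (\<Prod>l\<in>Poly_Mapping.keys T. x l ^ Poly_Mapping.lookup T l)"
      by (simp add: point_map_def meval_add mvar_def meval_single)
    also have "(\<Prod>l\<in>Poly_Mapping.keys T. x l ^ Poly_Mapping.lookup T l) = (\<Prod>l\<in>{1..m} - {i}. x l ^ Poly_Mapping.lookup T l)"
      by (intro prod.mono_neutral_left) (auto simp: Poly_Mapping.in_keys_iff T split: if_splits)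
    also have "\<dots> = (\<Prod>l\<in>{1..m} - {i}. x l ^ nat (pairing e (p l)))"
      by (intro prod.cong) (auto simp: T)
    also have "\<dots> = (\<Prod>l=1..m. x l ^ nat (pairing e (p l)))"
      using i e by (simp add: prod.remove[of _ i] demazure_roots_at_def)
    finally show ?thesis using True by simp
  qed
qed

section \<open>Triangular substitutions and the height filtration\<close>

text \<open>
  Induction on the variables: for fixed values of the others, the expression is a polynomial in one
  variable with infinitely many zeros, so its coefficients vanish.  Restricting to nonzero values
  keeps infinitely many points and fits the open torus orbit.
\<close>

lemma monomials_independent:
  fixes c :: "'r \<Rightarrow> 'k::field_char_0" and \<mu> :: "'r \<Rightarrow> 's \<Rightarrow> nat"
  assumes "finite S" "finite A"
    and "\<And>a b. a \<in> A \<Longrightarrow> b \<in> A \<Longrightarrow> (\<And>s. s \<in> S \<Longrightarrow> \<mu> a s = \<mu> b s) \<Longrightarrow> a = b"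
    and "\<And>x. (\<And>s. s \<in> S \<Longrightarrow> x s \<noteq> 0) \<Longrightarrow> (\<Sum>a\<in>A. c a * (\<Prod>s\<in>S. x s ^ \<mu> a s)) = 0"
    and "a \<in> A"
  shows "c a = 0"
  using assms
proof (induction S arbitrary: A a rule: finite_induct)
  case empty
  have "A = {a}" using empty.prems(2,4) by auto
  then show ?case using empty.prems(3)[of "\<lambda>_. 1"] by simp
next
  case (insert j S)
  define d where "d = \<mu> a j"
  define B where "B = {b \<in> A. \<mu> b j = d}"
  have "finite B" "a \<in> B" using insert.prems by (auto simp: B_def d_def)
  moreover have "b = b'" if "b \<in> B" "b' \<in> B" "\<And>s. s \<in> S \<Longrightarrow> \<mu> b s = \<mu> b' s"
    for b b'
  proof (rule insert.prems(2))
    show "\<mu> b s = \<mu> b' s" if "s \<in> insert j S" for s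
      using that \<open>b \<in> B\<close> \<open>b' \<in> B\<close> \<open>\<And>s. s \<in> S \<Longrightarrow> \<mu> b s = \<mu> b' s\<close> by (auto simp: B_def)
  qed (use that in \<open>auto simp: B_def\<close>)
  moreover have "(\<Sum>b\<in>B. c b * (\<Prod>s\<in>S. x s ^ \<mu> b s)) = 0" if x: "\<And>s. s \<in> S \<Longrightarrow> x s \<noteq> 0"
    for x
  proof -
    let ?e = "\<lambda>b. c b * (\<Prod>s\<in>S. x s ^ \<mu> b s)"
    define P where "P = (\<Sum>b\<in>A. monom (?e b) (\<mu> b j))"
    have "poly P t = 0" if "t \<noteq> 0" for t
    proof -
      have "poly P t = (\<Sum>b\<in>A. ?e b * t ^ \<mu> b j)"
        by (simp add: P_def poly_sum poly_monom)
      also have "\<dots> = (\<Sum>b\<in>A. c b * (\<Prod>s\<in>insert j S. (x(j := t)) s ^ \<mu> b s))"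
      proof (rule sum.cong)
        fix b
        have "(\<Prod>s\<in>S. (x(j := t)) s ^ \<mu> b s) = (\<Prod>s\<in>S. x s ^ \<mu> b s)"
          using insert.hyps by (intro prod.cong) auto
        then show "?e b * t ^ \<mu> b j = c b * (\<Prod>s\<in>insert j S. (x(j := t)) s ^ \<mu> b s)"
          using insert.hyps by simp
      qed simp
      also have "\<dots> = 0" using x that by (intro insert.prems(3)) auto
      finally show ?thesis .
    qed
    then have "- {0} \<subseteq> {t. poly P t = 0}" by auto
    moreover have "infinite (- {0 :: 'k})"
      by (simp add: Compl_eq_Diff_UNIV infinite_UNIV_char_0)
    ultimately have "P = 0" using poly_roots_finite[of P] finite_subset by blast
    then have "0 = coeff P d" by simp
    also have "\<dots> = (\<Sum>b\<in>A. if \<mu> b j = d then ?e b else 0)"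
      by (simp add: P_def coeff_sum)
    also have "\<dots> = (\<Sum>b\<in>B. ?e b)"
      unfolding B_def using insert.prems(1) by (simp add: sum.inter_filter)
    finally show ?thesis by simp
  qed
  ultimately show ?case using insert.IH by blast
qed

text \<open>
  An abstraction of the positive roots: \<open>w e s\<close> stands for \<open>\<langle>e, p\<^sub>s\<rangle>\<close> and \<open>idx e\<close> for the ray at which \<open>e\<close>
  has the value \<open>-1\<close>.  The last three conditions say that \<open>ht\<close> behaves like the length of a longest
  path ending in a root.
\<close>

locale graded_roots =
  fixes R :: "'r::ab_group_add set" and S :: "nat set"
    and w :: "'r \<Rightarrow> nat \<Rightarrow> int" and idx :: "'r \<Rightarrow> nat" and ht :: "'r \<Rightarrow> nat"
  assumes finite_R: "finite R" and finite_S: "finite S"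
    and idx_in: "a \<in> R \<Longrightarrow> idx a \<in> S"
    and w_add: "w (a + b) s = w a s + w b s"
    and w_idx: "a \<in> R \<Longrightarrow> w a (idx a) = -1"
    and w_nonneg: "a \<in> R \<Longrightarrow> s \<in> S \<Longrightarrow> s \<noteq> idx a \<Longrightarrow> 0 \<le> w a s"
    and w_inj: "a \<in> R \<Longrightarrow> b \<in> R \<Longrightarrow> (\<And>s. s \<in> S \<Longrightarrow> w a s = w b s) \<Longrightarrow> a = b"
    and add_root: "a \<in> R \<Longrightarrow> b \<in> R \<Longrightarrow> 0 < w a (idx b) \<Longrightarrow> a + b \<in> R \<and> idx (a + b) = idx a \<and> w b (idx a) = 0"
    and ht_pos: "a \<in> R \<Longrightarrow> 0 < ht a"
    and ht_add: "a \<in> R \<Longrightarrow> b \<in> R \<Longrightarrow> a + b \<in> R \<Longrightarrow> ht a < ht (a + b)"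
    and ht_pred: "r \<in> R \<Longrightarrow> 1 < ht r \<Longrightarrow> \<exists>a\<in>R. \<exists>b\<in>R. r = a + b \<and> Suc (ht a) = ht r"
begin

lemma ht_add_max:
  assumes "a \<in> R" "b \<in> R" "a + b \<in> R"
  shows "max (ht a) (ht b) < ht (a + b)"
  using ht_add[of a b] ht_add[of b a] assms by (simp add: add.commute)

text \<open>
  At the index of the sum one summand must be \<open>-1\<close> and the other \<open>0\<close>; at the index of the latter,
  where it is \<open>-1\<close>, the former has to be positive.
\<close>

lemma add_root_converse:
  assumes "a \<in> R" "b \<in> R" "a + b \<in> R"
  shows "0 < w a (idx b) \<or> 0 < w b (idx a)"
proof -
  have *: "0 < w a (idx b)" if "a \<in> R" "b \<in> R" "a + b \<in> R" "idx (a + b) = idx a" "a \<noteq> b" for a b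
  proof -
    have "w b (idx a) = 0" using w_idx[of "a + b"] w_idx[of a] w_add[of a b] that by simp
    then have "idx b \<noteq> idx a" using w_idx[of b] that by auto
    then have "0 \<le> w (a + b) (idx b)" using that idx_in by (intro w_nonneg) auto
    then show ?thesis using w_add w_idx[of b] that by simp
  qed
  have "idx (a + b) = idx a \<or> idx (a + b) = idx b"
  proof (rule ccontr)
    assume "\<not> ?thesis"
    then have "0 \<le> w a (idx (a + b))" "0 \<le> w b (idx (a + b))"
      using assms idx_in by (auto intro!: w_nonneg)
    then show False using w_idx[OF assms(3)] w_add by simp
  qed
  moreover have "a \<noteq> b"
  proof
    assume "a = b"
    then have "w (a + b) (idx (a + b)) = 2 * w a (idx (a + b))" using w_add by simp
    then show False using w_idx[OF assms(3)] by presburger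
  qed
  ultimately show ?thesis
    using *[of a b] *[of b a] assms by (auto simp: add.commute)
qed

definition monomial :: "(nat \<Rightarrow> nat) \<Rightarrow> (nat \<Rightarrow> 'k::field_char_0) \<Rightarrow> 'k" where
  "monomial \<mu> x = (\<Prod>s\<in>S. x s ^ \<mu> s)"

text \<open>
  The exponent of the variable with the index of the root is \<open>nat (-1) = 0\<close>.
\<close>

definition expo :: "'r \<Rightarrow> nat \<Rightarrow> nat" where
  "expo a s = nat (w a s)"

definition combo :: "nat \<Rightarrow> ('r \<Rightarrow> 'k::field_char_0) \<Rightarrow> (nat \<Rightarrow> 'k) \<Rightarrow> 'k" where
  "combo i c x = (\<Sum>a | a \<in> R \<and> idx a = i. c a * monomial (expo a) x)"

definition shift :: "('r \<Rightarrow> 'k::field_char_0) \<Rightarrow> (nat \<Rightarrow> 'k) \<Rightarrow> nat \<Rightarrow> 'k" where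
  "shift c x = (\<lambda>t. x t + combo t c x)"

definition vanishes_below :: "nat \<Rightarrow> ('r \<Rightarrow> 'k::field_char_0) \<Rightarrow> bool" where
  "vanishes_below k c \<longleftrightarrow> (\<forall>a\<in>R. ht a < k \<longrightarrow> c a = 0)"

definition span_above :: "nat \<Rightarrow> nat \<Rightarrow> ((nat \<Rightarrow> 'k::field_char_0) \<Rightarrow> 'k) set" where
  "span_above i k = {f. \<exists>c. vanishes_below k c \<and> f = combo i c}"

lemma combo_add: "combo i (\<lambda>a. c a + d a) x = combo i c x + combo i d x"
  by (simp add: combo_def distrib_right sum.distrib)

lemma combo_scale: "combo i (\<lambda>a. t * c a) x = t * combo i c x"
  by (simp add: combo_def sum_distrib_left mult.assoc)

lemma combo_diff: "combo i (\<lambda>a. c a - d a) x = combo i c x - combo i d x"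
  by (simp add: combo_def left_diff_distrib sum_subtractf)

lemma below_mono: "vanishes_below k c \<Longrightarrow> j \<le> k \<Longrightarrow> vanishes_below j c"
  by (auto simp: vanishes_below_def)

lemma span_above_mono: "f \<in> span_above i k \<Longrightarrow> j \<le> k \<Longrightarrow> f \<in> span_above i j"
  using below_mono by (auto simp: span_above_def)

lemma span_above_0: "(\<lambda>x. 0) \<in> span_above i k"
  by (auto simp: span_above_def vanishes_below_def combo_def intro!: exI[of _ "\<lambda>_. 0"])

lemma span_above_add: "f \<in> span_above i k \<Longrightarrow> g \<in> span_above i k \<Longrightarrow> (\<lambda>x. f x + g x) \<in> span_above i k"
  unfolding span_above_def
proof clarsimp
  fix c d :: "'r \<Rightarrow> 'a" assume "vanishes_below k c" "vanishes_below k d"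
  then show "\<exists>e. vanishes_below k e \<and> (\<lambda>x. combo i c x + combo i d x) = combo i e"
    by (intro exI[of _ "\<lambda>a. c a + d a"]) (auto simp: vanishes_below_def combo_add)
qed

lemma span_above_scale: "f \<in> span_above i k \<Longrightarrow> (\<lambda>x. t * f x) \<in> span_above i k"
  unfolding span_above_def
proof clarsimp
  fix c :: "'r \<Rightarrow> 'a" assume "vanishes_below k c"
  then show "\<exists>e. vanishes_below k e \<and> (\<lambda>x. t * combo i c x) = combo i e"
    by (intro exI[of _ "\<lambda>a. t * c a"]) (auto simp: vanishes_below_def combo_scale)
qed

lemma span_above_sum:
  assumes "\<And>b. b \<in> B \<Longrightarrow> f b \<in> span_above i k"
  shows "(\<lambda>x. \<Sum>b\<in>B. f b x) \<in> span_above i k"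
  using assms by (induction B rule: infinite_finite_induct) (auto intro: span_above_0 span_above_add)

lemma span_above_combo: "vanishes_below k c \<Longrightarrow> combo i c \<in> span_above i k"
  by (auto simp: span_above_def)

lemma span_above_monomial:
  assumes "a \<in> R" "idx a = i" "k \<le> ht a"
  shows "monomial (expo a) \<in> span_above i k"
proof -
  have "combo i (\<lambda>b. if b = a then 1 else 0) x = monomial (expo a) x" for x :: "nat \<Rightarrow> 'a"
  proof -
    have "combo i (\<lambda>b. if b = a then 1 else 0) x = (\<Sum>b | b \<in> R \<and> idx b = i. if b = a then monomial (expo a) x else 0)"
      unfolding combo_def by (intro sum.cong) auto
    then show ?thesis using assms finite_R by simp
  qed
  then have "monomial (expo a) = combo i (\<lambda>b. if b = a then 1 else (0::'a))" by auto
  moreover have "vanishes_below k (\<lambda>b. if b = a then 1 else (0::'a))"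
    using assms by (auto simp: vanishes_below_def)
  ultimately show ?thesis by (auto simp: span_above_def)
qed

lemma span_above_choice:
  fixes F :: "nat \<Rightarrow> (nat \<Rightarrow> 'k::field_char_0) \<Rightarrow> 'k"
  assumes "\<And>t. F t \<in> span_above t k"
  shows "\<exists>d. vanishes_below k d \<and> (\<forall>t x. F t x = combo t d x)"
proof -
  obtain c where c: "\<And>t. vanishes_below k (c t)" "\<And>t. F t = combo t (c t)"
    using assms unfolding span_above_def mem_Collect_eq by metis
  have "combo t (\<lambda>a. c (idx a) a) x = combo t (c t) x" for t x
    by (auto simp: combo_def intro!: sum.cong)
  then show ?thesis using c by (intro exI[of _ "\<lambda>a. c (idx a) a"]) (auto simp: vanishes_below_def)
qed

lemma monomial_mult: "monomial \<mu> x * monomial \<nu> x = monomial (\<lambda>s. \<mu> s + \<nu> s) x"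
  by (simp add: monomial_def prod.distrib power_add)

lemma monomial_cong: "(\<And>s. s \<in> S \<Longrightarrow> \<mu> s = \<nu> s) \<Longrightarrow> monomial \<mu> = monomial \<nu>"
  by (auto simp: monomial_def fun_eq_iff intro!: prod.cong)

lemma monomial_split: "j \<in> S \<Longrightarrow> 0 < \<nu> j \<Longrightarrow> monomial \<nu> x = x j * monomial (\<nu>(j := \<nu> j - 1)) x"
  by (cases "\<nu> j") (auto simp: monomial_def finite_S prod.remove intro!: prod.cong)

text \<open>
  The key computation.  Variables collected in \<open>\<nu>\<close> are still to be substituted, those in \<open>\<mu>\<close> already
  have been.  Replacing one factor \<open>x\<^sub>j\<close> by \<open>\<gamma>\<^sub>b x\<^sup>b\<close>, where \<open>b\<close> has index \<open>j\<close>, turns \<open>x\<^sup>a\<close> into the monomial of the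
  root \<open>a + b\<close>, which is higher than \<open>a\<close> and \<open>b\<close>.  Terms with at least two replacements are at
  least two steps above the maximum of \<open>ht a\<close> and \<open>k\<close>.
\<close>

lemma substitute_monomial:
  fixes \<gamma> :: "'r \<Rightarrow> 'k::field_char_0"
  assumes "a \<in> R" "vanishes_below k \<gamma>" "\<And>s. s \<in> S \<Longrightarrow> \<mu> s + \<nu> s = expo a s"
  shows "(\<lambda>x. monomial \<mu> x * monomial \<nu> (shift \<gamma> x)
            - (monomial (expo a) x + (\<Sum>b\<in>R. of_nat (\<nu> (idx b)) * \<gamma> b * monomial (expo (a + b)) x)))
          \<in> span_above (idx a) (max (ht a) k + 2)"
  using assms(1,3)
proof (induction "\<Sum>s\<in>S. \<nu> s" arbitrary: a \<mu> \<nu> rule: less_induct)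
  case less
  show ?case
  proof (cases "\<exists>j\<in>S. 0 < \<nu> j")
    case False
    then have nu: "\<nu> s = 0" if "s \<in> S" for s using that by auto
    then have "monomial \<nu> y = 1" for y :: "nat \<Rightarrow> 'k" by (simp add: monomial_def)
    moreover have "(monomial \<mu> :: (nat \<Rightarrow> 'k) \<Rightarrow> 'k) = monomial (expo a)"
      using nu less.prems(2) by (intro monomial_cong) auto
    moreover have "(\<Sum>b\<in>R. of_nat (\<nu> (idx b)) * \<gamma> b * monomial (expo (a + b)) x) = 0" for x
      using nu idx_in by (intro sum.neutral) auto
    ultimately show ?thesis using span_above_0 by simp
  next
    case True
    then obtain j where j: "j \<in> S" "0 < \<nu> j" by blast
    \<comment> \<open>One factor \<open>x\<^sub>j\<close> is substituted; the induction hypothesis handles the remaining ones.\<close>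
    define \<nu>' where "\<nu>' = \<nu>(j := \<nu> j - 1)"
    have smaller: "(\<Sum>s\<in>S. \<nu>' s) < (\<Sum>s\<in>S. \<nu> s)"
      using j finite_S by (intro sum_strict_mono_ex1) (auto simp: \<nu>'_def)
    let ?B = "{b \<in> R. idx b = j}"
    let ?K = "max (ht a) k + 2"
    have exj: "0 < expo a j" using less.prems(2)[OF j(1)] j(2) by simp
    then have waj: "0 < w a j" by (simp add: expo_def)
    have ab: "a + b \<in> R" "idx (a + b) = idx a" "w b (idx a) = 0" if "b \<in> ?B" for b
      using add_root[of a b] that waj less.prems(1) by auto
    define D where "D a \<mu> x = monomial \<mu> x * monomial \<nu>' (shift \<gamma> x)
            - (monomial (expo a) x + (\<Sum>b\<in>R. of_nat (\<nu>' (idx b)) * \<gamma> b * monomial (expo (a + b)) x))" for a \<mu> x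
    define L where "L a x = (\<Sum>b\<in>R. of_nat (\<nu>' (idx b)) * \<gamma> b * monomial (expo (a + b)) x)" for a x
    have D_L: "monomial \<mu> x * monomial \<nu>' (shift \<gamma> x) = D a \<mu> x + monomial (expo a) x + L a x"
      for a \<mu> x
      by (simp add: D_def L_def)
    have 1: "D a (\<mu>(j := \<mu> j + 1)) \<in> span_above (idx a) ?K"
      unfolding D_def
    proof (intro less.hyps[OF smaller] less.prems(1))
      show "(\<mu>(j := \<mu> j + 1)) s + \<nu>' s = expo a s" if "s \<in> S" for s
        using less.prems(2)[OF that] j by (auto simp: \<nu>'_def)
    qed
    have 2: "D (a + b) (\<lambda>s. \<mu> s + expo b s) \<in> span_above (idx a) (max (ht (a + b)) k + 2)" if b: "b \<in> ?B"
      for b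
    proof -
      have "\<mu> s + expo b s + \<nu>' s = expo (a + b) s" if s: "s \<in> S" for s
      proof -
        consider "s = j" | "s = idx a" "s \<noteq> j" | "s \<noteq> j" "s \<noteq> idx a" by blast
        then show ?thesis
        proof cases
          case 1
          then show ?thesis using less.prems(2)[OF s] j b w_idx[of b] w_add[of a b] waj
            by (auto simp: \<nu>'_def expo_def nat_diff_distrib)
        next
          case 2
          then show ?thesis using less.prems(2)[OF s] ab[OF b] w_idx[of a] w_add[of a b] less.prems(1)
            by (auto simp: \<nu>'_def expo_def)
        next
          case 3
          then have "0 \<le> w a s" "0 \<le> w b s" using w_nonneg[of a s] w_nonneg[of b s] b s less.prems(1) by auto
          then show ?thesis using 3 less.prems(2)[OF s] w_add[of a b]
            by (auto simp: \<nu>'_def expo_def nat_add_distrib)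
        qed
      qed
      then have "D (a + b) (\<lambda>s. \<mu> s + expo b s) \<in> span_above (idx (a + b)) (max (ht (a + b)) k + 2)"
        unfolding D_def using ab(1)[OF b] by (intro less.hyps[OF smaller]) auto
      then show ?thesis using ab(2)[OF b] by simp
    qed
    have 3: "L (a + b) \<in> span_above (idx a) (ht (a + b) + 1)" if b: "b \<in> ?B" for b
      unfolding L_def
    proof (rule span_above_sum)
      fix b' assume b': "b' \<in> R"
      show "(\<lambda>x. of_nat (\<nu>' (idx b')) * \<gamma> b' * monomial (expo (a + b + b')) x) \<in> span_above (idx a) (ht (a + b) + 1)"
      proof (cases "\<nu>' (idx b') = 0")
        case True
        then show ?thesis using span_above_0 by simp
      next
        case False
        have s: "idx b' \<in> S" using b' idx_in by simp
        have "\<mu> (idx b') + expo b (idx b') + \<nu>' (idx b') = expo (a + b) (idx b')"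
        proof -
          have "idx b' \<noteq> idx a"
          proof
            assume "idx b' = idx a"
            then have "\<nu> (idx b') = 0" using less.prems(2)[OF s] w_idx[OF less.prems(1)] by (simp add: expo_def)
            then show False using False by (auto simp: \<nu>'_def split: if_splits)
          qed
          then have "0 \<le> w a (idx b')" using w_nonneg[of a] less.prems(1) s by auto
          moreover have "idx b' \<noteq> j \<Longrightarrow> 0 \<le> w b (idx b')" using w_nonneg[of b] b s by auto
          ultimately show ?thesis using less.prems(2)[OF s] j b w_idx[of b] w_add[of a b] waj
            by (auto simp: \<nu>'_def expo_def nat_add_distrib nat_diff_distrib)
        qed
        then have "0 < w (a + b) (idx b')" using False by (simp add: expo_def)
        then have r: "a + b + b' \<in> R" "idx (a + b + b') = idx a"
          using add_root[of "a + b" b'] ab[OF b] b' by auto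
        have "ht (a + b) < ht (a + b + b')" using ht_add[of "a + b" b'] r ab[OF b] b' by auto
        then have "monomial (expo (a + b + b')) \<in> span_above (idx a) (ht (a + b) + 1)"
          using r by (intro span_above_monomial) auto
        then show ?thesis by (rule span_above_scale)
      qed
    qed
    \<comment> \<open>\<open>f\<close> collects the error terms of the induction hypotheses and the second order terms \<open>L\<close>.\<close>
    define f where "f x = D a (\<mu>(j := \<mu> j + 1)) x
        + (\<Sum>b\<in>?B. \<gamma> b * (D (a + b) (\<lambda>s. \<mu> s + expo b s) x + L (a + b) x))" for x
    have "f \<in> span_above (idx a) ?K"
    proof -
      have "(\<lambda>x. \<gamma> b * (D (a + b) (\<lambda>s. \<mu> s + expo b s) x + L (a + b) x)) \<in> span_above (idx a) ?K"
        if b: "b \<in> ?B" for b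
      proof (cases "\<gamma> b = 0")
        case True
        then show ?thesis using span_above_0 by simp
      next
        case False
        then have "k \<le> ht b" using assms(2) b by (auto simp: vanishes_below_def not_less[symmetric])
        moreover have "max (ht a) (ht b) < ht (a + b)"
          using ht_add_max[of a b] ab[OF b] b less.prems by auto
        ultimately have "?K \<le> ht (a + b) + 1" "?K \<le> max (ht (a + b)) k + 2" by linarith+
        then show ?thesis using span_above_mono[OF 2[OF b], of ?K] span_above_mono[OF 3[OF b], of ?K]
          by (intro span_above_scale span_above_add) auto
      qed
      then show ?thesis unfolding f_def by (intro span_above_add 1 span_above_sum)
    qed
    moreover have "f x = monomial \<mu> x * monomial \<nu> (shift \<gamma> x)
            - (monomial (expo a) x + (\<Sum>b\<in>R. of_nat (\<nu> (idx b)) * \<gamma> b * monomial (expo (a + b)) x))" for x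
    proof -
      have xj: "monomial \<mu> x * x j = monomial (\<mu>(j := \<mu> j + 1)) x"
        using monomial_split[of j "\<mu>(j := \<mu> j + 1)" x] j by (simp add: mult.commute)
      have "monomial \<mu> x * monomial \<nu> (shift \<gamma> x) = monomial \<mu> x * (shift \<gamma> x j * monomial \<nu>' (shift \<gamma> x))"
        unfolding \<nu>'_def using monomial_split j by metis
      also have "\<dots> = monomial (\<mu>(j := \<mu> j + 1)) x * monomial \<nu>' (shift \<gamma> x) + combo j \<gamma> x * monomial \<mu> x * monomial \<nu>' (shift \<gamma> x)"
        unfolding shift_def[of \<gamma> x] xj[symmetric] by (simp add: algebra_simps)
      also have "combo j \<gamma> x * monomial \<mu> x * monomial \<nu>' (shift \<gamma> x)
          = (\<Sum>b\<in>?B. \<gamma> b * (monomial (\<lambda>s. \<mu> s + expo b s) x * monomial \<nu>' (shift \<gamma> x)))"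
        by (simp add: combo_def sum_distrib_left sum_distrib_right monomial_mult[symmetric] mult_ac)
      also have "\<dots> = (\<Sum>b\<in>?B. \<gamma> b * (D (a + b) (\<lambda>s. \<mu> s + expo b s) x + L (a + b) x))
                     + (\<Sum>b\<in>?B. \<gamma> b * monomial (expo (a + b)) x)"
      proof -
        have "\<gamma> b * (monomial (\<lambda>s. \<mu> s + expo b s) x * monomial \<nu>' (shift \<gamma> x))
            = \<gamma> b * (D (a + b) (\<lambda>s. \<mu> s + expo b s) x + L (a + b) x) + \<gamma> b * monomial (expo (a + b)) x" for b
          unfolding D_L[of "\<lambda>s. \<mu> s + expo b s" x "a + b"] by (simp add: algebra_simps)
        then show ?thesis by (simp only: sum.distrib)
      qed
      also have "monomial (\<mu>(j := \<mu> j + 1)) x * monomial \<nu>' (shift \<gamma> x) = D a (\<mu>(j := \<mu> j + 1)) x + monomial (expo a) x + L a x"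
        by (rule D_L)
      also have "(\<Sum>b\<in>?B. \<gamma> b * monomial (expo (a + b)) x) = (\<Sum>b\<in>R. if idx b = j then \<gamma> b * monomial (expo (a + b)) x else 0)"
        using finite_R by (simp add: sum.inter_filter)
      finally have "monomial \<mu> x * monomial \<nu> (shift \<gamma> x) = f x + monomial (expo a) x
          + (L a x + (\<Sum>b\<in>R. if idx b = j then \<gamma> b * monomial (expo (a + b)) x else 0))"
        unfolding f_def by (simp only: add_ac)
      moreover have "L a x + (\<Sum>b\<in>R. if idx b = j then \<gamma> b * monomial (expo (a + b)) x else 0)
          = (\<Sum>b\<in>R. of_nat (\<nu> (idx b)) * \<gamma> b * monomial (expo (a + b)) x)"
        unfolding L_def sum.distrib[symmetric]
        using j by (intro sum.cong) (auto simp: \<nu>'_def of_nat_diff algebra_simps)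
      ultimately show ?thesis by simp
    qed
    ultimately show ?thesis by (metis (no_types, lifting) ext)
  qed
qed


text \<open>
  The first order part of a substitution: the vector fields \<open>x\<^sup>a \<partial>/\<partial>x\<^sub>i\<close> form a pre-Lie algebra under
  \<open>(x\<^sup>b \<partial>/\<partial>x\<^sub>j)(x\<^sup>a) \<partial>/\<partial>x\<^sub>i = a\<^sub>j x\<^sup>a\<^sup>+\<^sup>b \<partial>/\<partial>x\<^sub>i\<close>.
\<close>

definition prelie :: "('r \<Rightarrow> 'k::field_char_0) \<Rightarrow> ('r \<Rightarrow> 'k) \<Rightarrow> 'r \<Rightarrow> 'k" where
  "prelie c \<gamma> r = (\<Sum>b | b \<in> R \<and> r - b \<in> R. of_nat (expo (r - b) (idx b)) * c (r - b) * \<gamma> b)"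

lemma below_prelie:
  assumes "vanishes_below k1 c" "vanishes_below k2 \<gamma>"
  shows "vanishes_below (max k1 k2 + 1) (prelie c \<gamma>)"
  unfolding vanishes_below_def
proof (intro ballI impI)
  fix r assume r: "r \<in> R" "ht r < max k1 k2 + 1"
  show "prelie c \<gamma> r = 0"
    unfolding prelie_def
  proof (intro sum.neutral ballI)
    fix b assume b: "b \<in> {b. b \<in> R \<and> r - b \<in> R}"
    have "max (ht (r - b)) (ht b) < ht r" using ht_add_max[of "r - b" b] b r by auto
    then have "ht (r - b) < k1 \<or> ht b < k2" using r by auto
    then show "of_nat (expo (r - b) (idx b)) * c (r - b) * \<gamma> b = 0"
      using b assms by (auto simp: vanishes_below_def)
  qed
qed

lemma combo_prelie:
  "(\<Sum>a | a \<in> R \<and> idx a = i. c a * (\<Sum>b\<in>R. of_nat (expo a (idx b)) * \<gamma> b * monomial (expo (a + b)) x))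
     = combo i (prelie c \<gamma>) x"
proof -
  let ?A = "{a. a \<in> R \<and> idx a = i}"
  let ?P = "{(a, b). a \<in> R \<and> idx a = i \<and> b \<in> R \<and> 0 < w a (idx b)}"
  let ?Q = "{(r, b). r \<in> R \<and> idx r = i \<and> b \<in> R \<and> r - b \<in> R \<and> 0 < w (r - b) (idx b)}"
  have idx_diff: "idx (r - b) = idx r" if "r \<in> R" "b \<in> R" "r - b \<in> R" "0 < w (r - b) (idx b)" for r b
    using add_root[of "r - b" b] that by simp
  have "(\<Sum>a\<in>?A. c a * (\<Sum>b\<in>R. of_nat (expo a (idx b)) * \<gamma> b * monomial (expo (a + b)) x))
      = (\<Sum>a\<in>?A. \<Sum>b\<in>R. of_nat (expo a (idx b)) * c a * \<gamma> b * monomial (expo (a + b)) x)"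
    by (simp add: sum_distrib_left mult_ac)
  also have "\<dots> = (\<Sum>(a, b)\<in>?A \<times> R. of_nat (expo a (idx b)) * c a * \<gamma> b * monomial (expo (a + b)) x)"
    by (simp add: sum.cartesian_product)
  also have "\<dots> = (\<Sum>(a, b)\<in>?P. of_nat (expo a (idx b)) * c a * \<gamma> b * monomial (expo (a + b)) x)"
    using finite_R by (intro sum.mono_neutral_right) (auto simp: expo_def)
  also have "\<dots> = (\<Sum>(r, b)\<in>?Q. of_nat (expo (r - b) (idx b)) * c (r - b) * \<gamma> b * monomial (expo r) x)"
  proof (rule sum.reindex_bij_witness[of _ "\<lambda>(r, b). (r - b, b)" "\<lambda>(a, b). (a + b, b)"])
    show "(\<lambda>(a, b). (a + b, b)) z \<in> ?Q" if "z \<in> ?P" for z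
      using that add_root[of "fst z" "snd z"] by auto
    show "(\<lambda>(r, b). (r - b, b)) z \<in> ?P" if "z \<in> ?Q" for z
      using that idx_diff[of "fst z" "snd z"] by auto
  qed (auto split: prod.splits)
  also have "\<dots> = (\<Sum>(r, b)\<in>(SIGMA r:?A. {b. b \<in> R \<and> r - b \<in> R}).
       of_nat (expo (r - b) (idx b)) * c (r - b) * \<gamma> b * monomial (expo r) x)"
    using finite_R by (intro sum.mono_neutral_left finite_SigmaI) (auto simp: expo_def)
  also have "\<dots> = (\<Sum>r\<in>?A. \<Sum>b | b \<in> R \<and> r - b \<in> R. of_nat (expo (r - b) (idx b)) * c (r - b) * \<gamma> b * monomial (expo r) x)"
    using finite_R by (subst sum.Sigma) auto
  also have "\<dots> = combo i (prelie c \<gamma>) x"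
    by (simp add: combo_def prelie_def sum_distrib_right)
  finally show ?thesis .
qed

lemma substitute_combo:
  assumes "vanishes_below k1 c" "vanishes_below k2 \<gamma>"
  shows "(\<lambda>x. combo i c (shift \<gamma> x) - (combo i c x + combo i (prelie c \<gamma>) x)) \<in> span_above i (max k1 k2 + 2)"
proof -
  let ?A = "{a. a \<in> R \<and> idx a = i}"
  define F where "F a x = monomial (expo a) (shift \<gamma> x)
            - (monomial (expo a) x + (\<Sum>b\<in>R. of_nat (expo a (idx b)) * \<gamma> b * monomial (expo (a + b)) x))" for a x
  have "(\<lambda>x. c a * F a x) \<in> span_above i (max k1 k2 + 2)" if a: "a \<in> ?A" for a
  proof (cases "c a = 0")
    case True
    then show ?thesis using span_above_0 by simp
  next
    case False
    then have "k1 \<le> ht a" using assms(1) a by (auto simp: vanishes_below_def not_less[symmetric])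
    then have le: "max k1 k2 + 2 \<le> max (ht a) k2 + 2" by linarith
    have "F a \<in> span_above (idx a) (max (ht a) k2 + 2)"
      unfolding F_def using substitute_monomial[of a k2 \<gamma> "\<lambda>_. 0" "expo a"] a assms(2) by (simp add: monomial_def)
    then have "F a \<in> span_above i (max k1 k2 + 2)" using span_above_mono[OF _ le] a by auto
    then show ?thesis by (rule span_above_scale)
  qed
  then have "(\<lambda>x. \<Sum>a\<in>?A. c a * F a x) \<in> span_above i (max k1 k2 + 2)"
    by (rule span_above_sum)
  moreover have "(\<Sum>a\<in>?A. c a * F a x) = combo i c (shift \<gamma> x) - (combo i c x + combo i (prelie c \<gamma>) x)"
    for x
    unfolding combo_prelie[symmetric, of i c \<gamma> x]
    by (simp only: combo_def F_def right_diff_distrib distrib_left sum_subtractf sum.distrib)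
  ultimately show ?thesis by simp
qed

lemma substitute_combo_above:
  assumes "vanishes_below k1 c" "vanishes_below k2 \<gamma>"
  shows "(\<lambda>x. combo i c (shift \<gamma> x) - combo i c x) \<in> span_above i (max k1 k2 + 1)"
proof -
  have "combo i (prelie c \<gamma>) \<in> span_above i (max k1 k2 + 1)"
    by (intro span_above_combo below_prelie assms)
  moreover have "(\<lambda>x. combo i c (shift \<gamma> x) - (combo i c x + combo i (prelie c \<gamma>) x)) \<in> span_above i (max k1 k2 + 1)"
    by (rule span_above_mono[OF substitute_combo[OF assms]]) linarith
  ultimately have "(\<lambda>x. (combo i c (shift \<gamma> x) - (combo i c x + combo i (prelie c \<gamma>) x)) + combo i (prelie c \<gamma>) x)
      \<in> span_above i (max k1 k2 + 1)"
    by (intro span_above_add)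
  then show ?thesis by (simp add: algebra_simps)
qed

lemma below_0 [simp]: "vanishes_below 0 c"
  by (simp add: vanishes_below_def)

text \<open>
  That the inverse is again of the form \<open>shift\<close> is part of the definition; its coefficients then
  automatically vanish below \<open>k\<close> as well.
\<close>

definition filtration :: "nat \<Rightarrow> ((nat \<Rightarrow> 'k::field_char_0) \<Rightarrow> (nat \<Rightarrow> 'k)) set" where
  "filtration k = {g. bij g \<and> (\<exists>\<gamma>. vanishes_below k \<gamma> \<and> g = shift \<gamma>) \<and> (\<exists>\<gamma>. inv_into UNIV g = shift \<gamma>)}"

lemma shift_zero: "shift (\<lambda>_. 0) = id"
  by (simp add: shift_def combo_def fun_eq_iff)

lemma shift_comp:
  assumes "vanishes_below k c" "vanishes_below k d"
  shows "\<exists>e. vanishes_below k e \<and> shift c \<circ> shift d = shift e"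
proof -
  have "(\<lambda>x. combo t d x + ((combo t c (shift d x) - combo t c x) + combo t c x)) \<in> span_above t k" for t
    by (intro span_above_add span_above_combo assms span_above_mono[OF substitute_combo_above[OF assms]]) auto
  then have "(\<lambda>x. combo t d x + combo t c (shift d x)) \<in> span_above t k" for t
    by simp
  from span_above_choice[OF this] obtain e where "vanishes_below k e" "\<And>t x. combo t d x + combo t c (shift d x) = combo t e x"
    by blast
  then show ?thesis by (intro exI[of _ e]) (simp add: fun_eq_iff shift_def add.assoc)
qed

lemma filtration_id: "id \<in> filtration k"
  unfolding filtration_def using shift_zero[symmetric] by (auto simp: vanishes_below_def inv_id intro!: exI[of _ "\<lambda>_. 0"])

lemma filtration_comp:
  assumes "g \<in> filtration k" "h \<in> filtration k"
  shows "g \<circ> h \<in> filtration k"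
proof -
  obtain c d c' d' where "bij g" "bij h" and c: "vanishes_below k c" "g = shift c" and d: "vanishes_below k d" "h = shift d"
    and "inv_into UNIV g = shift c'" "inv_into UNIV h = shift d'"
    using assms unfolding filtration_def by blast
  then show ?thesis
    using shift_comp[OF c(1) d(1)] shift_comp[of 0 d' c'] unfolding filtration_def
    by (simp add: bij_comp o_inv_distrib)
qed

text \<open>
  From \<open>shift c \<circ> shift d = id\<close> the correction made by \<open>shift d\<close> is minus that of \<open>shift c\<close>, evaluated
  at substituted variables, which does not lower heights.
\<close>

lemma filtration_inv:
  assumes "g \<in> filtration k"
  shows "inv_into UNIV g \<in> filtration k"
proof -
  obtain c d where g: "bij g" "vanishes_below k c" "g = shift c" "inv_into UNIV g = shift d"
    using assms unfolding filtration_def by blast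
  have "(\<lambda>x. (- 1) * ((combo t c (shift d x) - combo t c x) + combo t c x)) \<in> span_above t k" for t
    using g(2) by (intro span_above_scale span_above_add span_above_combo span_above_mono[OF substitute_combo_above[OF g(2) below_0]]) auto
  then have "(\<lambda>x. - combo t c (shift d x)) \<in> span_above t k" for t by simp
  from span_above_choice[OF this] obtain e where e: "vanishes_below k e" "\<And>t x. - combo t c (shift d x) = combo t e x" by blast
  have "shift d x = shift e x" for x
  proof
    fix t
    have "shift c (shift d x) = x" using g by (metis bij_inv_eq_iff)
    then have "shift d x t + combo t c (shift d x) = x t" by (metis shift_def)
    then have "shift d x t = x t + - combo t c (shift d x)" by (metis add_diff_cancel_right' diff_conv_add_uminus)
    then show "shift d x t = shift e x t" unfolding e(2) by (simp add: shift_def)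
  qed
  then have "inv_into UNIV g = shift e" using g(4) by auto
  moreover have "inv_into UNIV (inv_into UNIV g) = shift c" using inv_inv_eq[OF g(1)] g(3) by simp
  ultimately show ?thesis unfolding filtration_def using e(1) bij_imp_bij_inv[OF g(1)] by blast
qed

lemma filtration_mono: "j \<le> k \<Longrightarrow> filtration k \<subseteq> filtration j"
  unfolding filtration_def using below_mono by blast

text \<open>
  Write \<open>g h = h g + r\<close> with a correction \<open>r\<close>.  To first order \<open>r\<close> is the commutator of the pre-Lie
  product, and composing with the inverse of \<open>h g\<close> changes \<open>r\<close> only in height at least \<open>k + 2\<close>.
\<close>

lemma commutator_expansion:
  assumes g: "bij g" "g = shift c" "inv_into UNIV g = shift c'" "vanishes_below k c"
    and h: "bij h" "h = shift d" "inv_into UNIV h = shift d'" "vanishes_below 1 d" and "1 \<le> k"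
  shows "\<exists>e. g \<circ> h \<circ> inv_into UNIV g \<circ> inv_into UNIV h = shift e \<and> vanishes_below (k + 1) e \<and>
     (\<forall>r\<in>R. ht r = k + 1 \<longrightarrow> e r = prelie c d r - prelie d c r)"
proof -
  define s where "s r = prelie c d r - prelie d c r" for r
  have below_s: "vanishes_below (k + 1) s"
  proof -
    have "vanishes_below (max k 1 + 1) (prelie c d)" "vanishes_below (max 1 k + 1) (prelie d c)"
      by (intro below_prelie g h)+
    then show ?thesis using \<open>1 \<le> k\<close> by (auto simp: vanishes_below_def s_def max_absorb1 max_absorb2)
  qed
  have diff: "(\<lambda>x. ((g \<circ> h) x t - (h \<circ> g) x t) - combo t s x) \<in> span_above t (k + 2)" for t
  proof -
    have "(\<lambda>x. (combo t c (shift d x) - (combo t c x + combo t (prelie c d) x))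
          + (- 1) * (combo t d (shift c x) - (combo t d x + combo t (prelie d c) x))) \<in> span_above t (k + 2)"
      using substitute_combo[OF g(4) h(4), of t] substitute_combo[OF h(4) g(4), of t] \<open>1 \<le> k\<close>
      by (intro span_above_add span_above_scale) (auto simp: max_absorb1 max_absorb2)
    moreover have "((g \<circ> h) x t - (h \<circ> g) x t) - combo t s x = (combo t c (shift d x) - (combo t c x + combo t (prelie c d) x))
          + (- 1) * (combo t d (shift c x) - (combo t d x + combo t (prelie d c) x))" for x
      by (simp add: g(2) h(2) shift_def s_def[abs_def] combo_diff)
    ultimately show ?thesis by simp
  qed
  from span_above_choice[OF this] obtain u where u: "vanishes_below (k + 2) u"
    "\<And>t x. ((g \<circ> h) x t - (h \<circ> g) x t) - combo t s x = combo t u x" by blast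
  define v where "v a = s a + u a" for a
  have below_v: "vanishes_below (k + 1) v" using below_s u(1) by (auto simp: vanishes_below_def v_def)
  have gh: "(g \<circ> h) x t = (h \<circ> g) x t + combo t v x" for x t
    unfolding v_def[abs_def] combo_add u(2)[symmetric] by simp
  obtain b where b: "inv_into UNIV g \<circ> inv_into UNIV h = shift b"
    using shift_comp[of 0 c' d'] g h by auto
  have "(\<lambda>x. combo t v (shift b x) - combo t v x) \<in> span_above t (k + 2)" for t
    using substitute_combo_above[OF below_v below_0, of t b] by simp
  from span_above_choice[OF this] obtain z where z: "vanishes_below (k + 2) z"
    "\<And>t x. combo t v (shift b x) - combo t v x = combo t z x" by blast
  define e where "e a = v a + z a" for a
  have "(g \<circ> h \<circ> inv_into UNIV g \<circ> inv_into UNIV h) x = shift e x" for x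
  proof
    fix t
    have "h (g (inv_into UNIV g (inv_into UNIV h x))) = x" using g(1) h(1) by (simp add: bij_is_surj surj_f_inv_f)
    then have "(h \<circ> g) (shift b x) = x" unfolding b[symmetric] by simp
    then have "(g \<circ> h) (shift b x) t = x t + combo t v (shift b x)" using gh by simp
    also have "\<dots> = x t + combo t e x" unfolding e_def[abs_def] combo_add z(2)[symmetric] by simp
    finally show "(g \<circ> h \<circ> inv_into UNIV g \<circ> inv_into UNIV h) x t = shift e x t"
      unfolding b[symmetric] by (simp add: shift_def)
  qed
  moreover have "vanishes_below (k + 1) e" using below_v z(1) by (auto simp: vanishes_below_def e_def)
  moreover have "e r = prelie c d r - prelie d c r" if "r \<in> R" "ht r = k + 1" for r
    using that u(1) z(1) by (auto simp: vanishes_below_def e_def v_def s_def)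
  ultimately show ?thesis by blast
qed

lemma filtration_commutator:
  assumes "g \<in> filtration k" "h \<in> filtration 1" "1 \<le> k"
  shows "g \<circ> h \<circ> inv_into UNIV g \<circ> inv_into UNIV h \<in> filtration (k + 1)"
proof -
  have "g \<in> filtration 1" using assms filtration_mono by blast
  then have "g \<circ> h \<circ> inv_into UNIV g \<circ> inv_into UNIV h \<in> filtration 1"
    using assms by (intro filtration_comp filtration_inv)
  moreover obtain c d c' d' where "bij g" "bij h" "vanishes_below k c" "g = shift c" "vanishes_below 1 d" "h = shift d"
    "inv_into UNIV g = shift c'" "inv_into UNIV h = shift d'"
    using assms unfolding filtration_def by blast
  then have "\<exists>e. vanishes_below (k + 1) e \<and> g \<circ> h \<circ> inv_into UNIV g \<circ> inv_into UNIV h = shift e"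
    using commutator_expansion assms(3) by blast
  ultimately show ?thesis unfolding filtration_def by blast
qed

lemma filtration_trivial:
  assumes "\<And>a. a \<in> R \<Longrightarrow> ht a < k" "g \<in> filtration k"
  shows "g = id"
proof -
  obtain c where c: "vanishes_below k c" "g = shift c" using assms(2) unfolding filtration_def by blast
  then have "c a = 0" if "a \<in> R" for a using assms(1) that by (auto simp: vanishes_below_def)
  then show ?thesis using c by (auto simp: shift_def combo_def fun_eq_iff)
qed

definition elementary :: "'r \<Rightarrow> 'k::field_char_0 \<Rightarrow> (nat \<Rightarrow> 'k) \<Rightarrow> (nat \<Rightarrow> 'k)" where
  "elementary e \<alpha> x = x(idx e := x (idx e) + \<alpha> * monomial (expo e) x)"

lemma elementary_shift:
  assumes "e \<in> R"
  shows "elementary e \<alpha> = shift (\<lambda>a. if a = e then \<alpha> else 0)"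
proof (intro ext)
  fix x :: "nat \<Rightarrow> 'a" and t
  have "combo t (\<lambda>a. if a = e then \<alpha> else 0) x = (\<Sum>a | a \<in> R \<and> idx a = t. if a = e then \<alpha> * monomial (expo e) x else 0)"
    unfolding combo_def by (intro sum.cong) auto
  also have "\<dots> = (if idx e = t then \<alpha> * monomial (expo e) x else 0)"
    using assms finite_R by simp
  finally show "elementary e \<alpha> x t = shift (\<lambda>a. if a = e then \<alpha> else 0) x t"
    by (simp add: elementary_def shift_def)
qed

lemma elementary_inverse:
  assumes "e \<in> R"
  shows "elementary e (- \<alpha>) (elementary e \<alpha> x) = x"
proof -
  have "monomial (expo e) (elementary e \<alpha> x) = monomial (expo e) x"
    unfolding monomial_def using w_idx[OF assms] by (intro prod.cong) (auto simp: elementary_def expo_def)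
  then show ?thesis by (simp add: elementary_def)
qed

lemma elementary_bij: "e \<in> R \<Longrightarrow> bij (elementary e \<alpha>)" "e \<in> R \<Longrightarrow> inv_into UNIV (elementary e \<alpha>) = elementary e (- \<alpha>)"
proof -
  assume e: "e \<in> R"
  have "elementary e (- \<alpha>) \<circ> elementary e \<alpha> = id" "elementary e \<alpha> \<circ> elementary e (- \<alpha>) = id"
    using elementary_inverse[OF e, of \<alpha>] elementary_inverse[OF e, of "- \<alpha>"] by auto
  then show "bij (elementary e \<alpha>)" "inv_into UNIV (elementary e \<alpha>) = elementary e (- \<alpha>)"
    using o_bij inv_unique_comp by blast+
qed

lemma elementary_filtration:
  assumes "e \<in> R"
  shows "elementary e \<alpha> \<in> filtration 1"
proof -
  have "vanishes_below 1 (\<lambda>a. if a = e then \<alpha> else 0)"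
    using ht_pos[OF assms] by (auto simp: vanishes_below_def)
  moreover have "inv_into UNIV (elementary e \<alpha>) = shift (\<lambda>a. if a = e then - \<alpha> else 0)"
    unfolding elementary_bij(2)[OF assms] by (rule elementary_shift[OF assms])
  ultimately show ?thesis unfolding filtration_def using elementary_bij(1)[OF assms] elementary_shift[OF assms] by blast
qed

text \<open>
  One of the two families of coefficients is concentrated at \<open>e\<close>, so only the decomposition \<open>a + e\<close>
  contributes.  Of the two exponents involved one is positive and the other zero, so their
  difference is a nonzero integer.
\<close>

lemma bracket_coefficient:
  assumes "a \<in> R" "e \<in> R" "a + e \<in> R" "c a \<noteq> 0"
  shows "prelie c (\<lambda>b. if b = e then 1 else 0) (a + e) - prelie (\<lambda>b. if b = e then 1 else 0) c (a + e) \<noteq> 0"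
proof -
  let ?d = "\<lambda>b. if b = e then 1 else 0"
  have "prelie c ?d (a + e) = (\<Sum>b | b \<in> R \<and> a + e - b \<in> R. if b = e then of_nat (expo a (idx e)) * c a else 0)"
    unfolding prelie_def by (intro sum.cong) auto
  also have "\<dots> = of_nat (expo a (idx e)) * c a"
    using assms finite_R by simp
  finally have 1: "prelie c ?d (a + e) = of_nat (expo a (idx e)) * c a" .
  have "prelie ?d c (a + e) = (\<Sum>b | b \<in> R \<and> a + e - b \<in> R. if b = a then of_nat (expo e (idx a)) * c a else 0)"
    unfolding prelie_def by (intro sum.cong) (auto simp: algebra_simps)
  also have "\<dots> = of_nat (expo e (idx a)) * c a"
    using assms finite_R by (simp add: algebra_simps)
  finally have 2: "prelie ?d c (a + e) = of_nat (expo e (idx a)) * c a" .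
  consider "0 < w a (idx e)" "w e (idx a) = 0" | "0 < w e (idx a)" "w a (idx e) = 0"
    using add_root_converse[OF assms(1-3)] add_root[OF assms(1,2)] add_root[OF assms(2,1)] by blast
  then have "expo a (idx e) \<noteq> expo e (idx a)" by cases (auto simp: expo_def)
  then have "(of_nat (expo a (idx e)) :: 'a) - of_nat (expo e (idx a)) \<noteq> 0" by simp
  then show ?thesis unfolding 1 2 using assms(4) by (metis left_diff_distrib mult_eq_0_iff)
qed

lemma shift_nontrivial:
  assumes "r \<in> R" "c r \<noteq> 0"
  shows "\<exists>x. (\<forall>s\<in>S. x s \<noteq> 0) \<and> shift c x (idx r) \<noteq> x (idx r)"
proof (rule ccontr)
  assume "\<not> ?thesis"
  then have 0: "combo (idx r) c x = 0" if "\<And>s. s \<in> S \<Longrightarrow> x s \<noteq> 0" for x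
    using that by (auto simp: shift_def)
  have "c r = 0"
  proof (rule monomials_independent[of S "{a. a \<in> R \<and> idx a = idx r}" expo c])
    fix a b assume a: "a \<in> {a. a \<in> R \<and> idx a = idx r}" and b: "b \<in> {a. a \<in> R \<and> idx a = idx r}"
      and eq: "\<And>s. s \<in> S \<Longrightarrow> expo a s = expo b s"
    have "w a s = w b s" if s: "s \<in> S" for s
      using eq[OF s] w_idx[of a] w_idx[of b] w_nonneg[of a s] w_nonneg[of b s] a b s
      by (cases "s = idx r") (auto simp: expo_def)
    then show "a = b" using w_inj a b by auto
  qed (use finite_S finite_R assms 0 in \<open>auto simp: combo_def monomial_def\<close>)
  then show False using assms by simp
qed

lemma ht_attained:
  assumes "r \<in> R" "1 \<le> j" "j \<le> ht r"
  shows "\<exists>a\<in>R. ht a = j"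
  using assms
proof (induction "ht r" arbitrary: r)
  case 0
  then show ?case by simp
next
  case (Suc k)
  show ?case
  proof (cases "j = ht r")
    case False
    then have "1 < ht r" using Suc by linarith
    then obtain a where a: "a \<in> R" "Suc (ht a) = ht r" using ht_pred[OF Suc.prems(1)] by blast
    then show ?thesis using Suc.hyps(1)[of a] Suc False by auto
  qed (use Suc in auto)
qed

end

section \<open>Heights in the root graph\<close>

text \<open>
  A predicate such as \<open>neg\<close> makes walks strictly monotone, so the graph is acyclic and every walk is
  a path.  The height of a root is one plus the length of a longest walk that ends in it.
\<close>

lemma root_graph_heights:
  fixes R :: "(int ^ 'n) set"
  assumes "finite R" "R \<noteq> {}"
    and neg: "\<And>e. e \<in> R \<Longrightarrow> neg e" "\<And>x y. neg x \<Longrightarrow> neg y \<Longrightarrow> neg (x + y)" "\<not> neg 0"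
  obtains ht :: "int ^ 'n \<Rightarrow> nat" and l
  where "longest_path_length (root_graph R) l"
    and "\<forall>a\<in>R. 0 < ht a \<and> ht a \<le> l + 1" and "\<exists>a\<in>R. ht a = l + 1"
    and "\<forall>a\<in>R. \<forall>b\<in>R. a + b \<in> R \<longrightarrow> ht a < ht (a + b)"
    and "\<forall>r\<in>R. 1 < ht r \<longrightarrow> (\<exists>a\<in>R. \<exists>b\<in>R. r = a + b \<and> Suc (ht a) = ht r)"
proof -
  let ?G = "root_graph R"
  have sel: "verts ?G = R" "tail ?G = fst" "head ?G = snd"
    "arcs ?G = {(a, b). a \<in> R \<and> b \<in> R \<and> (\<exists>e\<in>R. b = a + e)}"
    by (simp_all add: root_graph_def)
  interpret fin_digraph ?G
  proof
    show "finite (verts ?G)" using assms(1) by (simp add: sel)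
    have "arcs ?G \<subseteq> R \<times> R" by (auto simp: sel)
    then show "finite (arcs ?G)" using assms(1) finite_subset by blast
  qed (auto simp: sel)
  have reach: "z = u \<or> neg (z - u)" if "awalk u P w" "z \<in> set (awalk_verts u P)" for u P w z
    using that
  proof (induction P arbitrary: u)
    case (Cons e P)
    then have e: "e \<in> arcs ?G" "fst e = u" "awalk (snd e) P w" by (auto simp: awalk_Cons_iff sel)
    then have 1: "neg (snd e - u)" using neg(1) by (auto simp: sel)
    have "z = u \<or> z \<in> set (awalk_verts (snd e) P)" using Cons.prems(2) e by (auto simp: sel)
    then show ?case
    proof
      assume "z \<in> set (awalk_verts (snd e) P)"
      then have "z = snd e \<or> neg (z - snd e)" using Cons.IH[OF e(3)] by blast
      then show ?thesis using 1 neg(2)[of "z - snd e" "snd e - u"] by auto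
    qed simp
  qed simp
  have apath: "apath u P w" if "awalk u P w" for u P w
  proof -
    have "distinct (awalk_verts u P)"
      using that
    proof (induction P arbitrary: u)
      case (Cons e P)
      then have e: "e \<in> arcs ?G" "fst e = u" "awalk (snd e) P w" by (auto simp: awalk_Cons_iff sel)
      then have 1: "neg (snd e - u)" using neg(1) by (auto simp: sel)
      have "u \<notin> set (awalk_verts (snd e) P)"
      proof
        assume "u \<in> set (awalk_verts (snd e) P)"
        then have "u = snd e \<or> neg (u - snd e)" using reach[OF e(3)] by blast
        then show False using 1 neg(3) neg(2)[OF 1, of "u - snd e"] by auto
      qed
      then show ?case using Cons.IH[OF e(3)] e by (simp add: sel)
    qed simp
    then show ?thesis using that by (simp add: apath_def)
  qed
  define L where "L b = {length P | u P. awalk u P b}" for b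
  have "{length P | u P w. apath u P w} = (\<lambda>(u, P, w). length P) ` {(u, P, w). apath u P w}" by force
  then have fin: "finite {length P | u P w. apath u P w}" using apaths_finite_triple by simp
  have finL: "finite (L b)" for b unfolding L_def using apath by (intro finite_subset[OF _ fin]) blast
  have L0: "0 \<in> L b" if "b \<in> R" for b
    unfolding L_def mem_Collect_eq using that by (intro exI[of _ b] exI[of _ "[]"]) (simp add: awalk_Nil_iff sel)
  define ht where "ht b = Suc (Max (L b))" for b
  have ht_ge: "Suc (length P) \<le> ht b" if "awalk u P b" for u P b
    unfolding ht_def using that finL by (auto simp: L_def intro!: Max_ge)
  have ht_path: "\<exists>u P. awalk u P b \<and> ht b = Suc (length P)" if "b \<in> R" for b
  proof -
    have "Max (L b) \<in> L b" using finL L0[OF that] by (intro Max_in) auto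
    then show ?thesis unfolding ht_def by (auto simp: L_def)
  qed
  have ht_add: "ht a < ht (a + b)" if "a \<in> R" "b \<in> R" "a + b \<in> R" for a b
  proof -
    obtain u P where P: "awalk u P a" "ht a = Suc (length P)" using ht_path[OF \<open>a \<in> R\<close>] by blast
    have "awalk a [(a, a + b)] (a + b)" using that by (auto simp: awalk_Cons_iff awalk_Nil_iff sel)
    with P(1) have "awalk u (P @ [(a, a + b)]) (a + b)" by (rule awalk_appendI)
    from ht_ge[OF this] show ?thesis using P(2) by simp
  qed
  have ht_pred: "\<exists>a\<in>R. \<exists>b\<in>R. r = a + b \<and> Suc (ht a) = ht r" if r: "r \<in> R" "1 < ht r"
    for r
  proof -
    obtain u P where P: "awalk u P r" "ht r = Suc (length P)" using ht_path[OF r(1)] by blast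
    then obtain P' e where P': "P = P' @ [e]" using r(2) by (cases P rule: rev_cases) auto
    with P(1) have "awalk u P' (fst e)" "e \<in> arcs ?G" "snd e = r"
      by (auto simp: awalk_append_iff awalk_Cons_iff awalk_Nil_iff sel)
    then obtain b where b: "fst e \<in> R" "b \<in> R" "r = fst e + b" by (auto simp: sel)
    have "Suc (length P') \<le> ht (fst e)" using ht_ge \<open>awalk u P' (fst e)\<close> by blast
    moreover have "ht (fst e) < ht r" using ht_add[OF b(1,2)] b(3) r(1) by simp
    ultimately have "Suc (ht (fst e)) = ht r" using P(2) P' by simp
    then show ?thesis using b by blast
  qed
  define l where "l = Max (ht ` R) - 1"
  have ht_pos: "0 < ht a" for a by (simp add: ht_def)
  have Max: "Max (ht ` R) \<in> ht ` R" "\<And>a. a \<in> R \<Longrightarrow> ht a \<le> Max (ht ` R)"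
    using assms(1,2) by auto
  then have l: "Max (ht ` R) = l + 1" using ht_pos unfolding l_def by (metis Suc_eq_plus1 Suc_pred' imageE)
  obtain a0 where a0: "a0 \<in> R" "ht a0 = l + 1" using Max(1) l by auto
  have le: "ht a \<le> l + 1" if "a \<in> R" for a using Max(2)[OF that] l by simp
  have "longest_path_length ?G l"
    unfolding longest_path_length_def
  proof (intro conjI allI impI)
    obtain u P where "awalk u P a0" "ht a0 = Suc (length P)" using ht_path[OF a0(1)] by blast
    then have "apath u P a0 \<and> length P = l" using a0(2) apath by simp
    then show "\<exists>u P w. apath u P w \<and> length P = l" by blast
    fix u P w assume "apath u P w"
    then have "awalk u P w" by (simp add: apath_def)
    moreover from this have "w \<in> R" using awalk_last_in_verts sel(1) by metis
    ultimately show "length P \<le> l" using ht_ge[of u P w] le[of w] by simp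
  qed
  then show thesis
    by (rule that[of l ht]) (use ht_pos le a0 ht_add ht_pred in blast)+
qed

section \<open>Positive roots as triangular roots\<close>

locale radiant_fan = bilateral_fan \<Sigma> m p n a q
  for \<Sigma> :: "(real ^ 'n) set set" and m n :: nat and p q :: "nat \<Rightarrow> int ^ 'n"
    and a :: "nat \<Rightarrow> nat \<Rightarrow> nat" +
  fixes r :: nat and c :: "nat \<Rightarrow> nat" and v :: "int ^ 'n"
  assumes classes: "class_numbering n m a r c"
    and v_mono: "\<And>i j. i \<in> {1..n} \<Longrightarrow> j \<in> {1..n} \<Longrightarrow> i < j \<Longrightarrow> pairing (q i) v < pairing (q j) v"
    and v_neg: "\<And>i. i \<in> {1..n} \<Longrightarrow> pairing (q i) v < 0"
begin

text \<open>
  Strict domination between two elements passes to their classes, which are consecutive intervals in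
  the order prescribed by the numbering.
\<close>

lemma strict_dominance_order:
  assumes i: "i \<in> {1..n}" and j: "j \<in> {1..n}" and ij: "dominates n m a i j" "\<not> dominates n m a j i"
  shows "i < j"
proof -
  let ?E = "{(i, j). i \<in> {1..n} \<and> j \<in> {1..n} \<and> dominates n m a i j \<and> dominates n m a j i}"
  let ?I = "\<lambda>s. {c (s - 1) + 1..c s}"
  have quot: "{1..n} // ?E = ?I ` {1..r}" and c: "strict_mono_on {0..r} c"
    and ord: "\<And>l s. l \<in> {1..r} \<Longrightarrow> s \<in> {1..r} \<Longrightarrow>
        (\<forall>i\<in>?I l. \<forall>j\<in>?I s. dominates n m a i j \<and> \<not> dominates n m a j i) \<Longrightarrow> l < s"
    using classes by (auto simp: class_numbering_def)
  have trans: "dominates n m a x z" if "dominates n m a x y" "dominates n m a y z" for x y z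
    using that unfolding dominates_def by (meson le_trans)
  have cls: "\<exists>l\<in>{1..r}. ?E `` {x} = ?I l" if "x \<in> {1..n}" for x
  proof -
    have "?E `` {x} \<in> {1..n} // ?E" using that by (rule quotientI)
    then show ?thesis unfolding quot by blast
  qed
  have self: "x \<in> ?E `` {x}" if "x \<in> {1..n}" for x using that by (auto simp: dominates_def)
  obtain l where l: "l \<in> {1..r}" "?E `` {i} = ?I l" using cls[OF i] by blast
  obtain s where s: "s \<in> {1..r}" "?E `` {j} = ?I s" using cls[OF j] by blast
  have "dominates n m a x y \<and> \<not> dominates n m a y x" if "x \<in> ?I l" "y \<in> ?I s" for x y
  proof -
    have "x \<in> ?E `` {i}" "y \<in> ?E `` {j}" unfolding l(2) s(2) using that by blast+
    then show ?thesis using ij trans by blast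
  qed
  then have "l < s" using ord l(1) s(1) by blast
  have "i \<in> ?I l" using self[OF i] unfolding l(2) .
  then have "i \<le> c l" by simp
  also have "c l \<le> c (s - 1)"
  proof (cases "l = s - 1")
    case False
    then have "c l < c (s - 1)" using \<open>l < s\<close> l(1) s(1) by (intro strict_mono_onD[OF c]) auto
    then show ?thesis by simp
  qed simp
  also have "c (s - 1) < j"
  proof -
    have "j \<in> ?I s" using self[OF j] unfolding s(2) .
    then show ?thesis by simp
  qed
  finally show ?thesis .
qed

lemma pairing_p_high:
  assumes "k \<in> {n<..m}"
  shows "pairing e (p k) = - (\<Sum>j=1..n. int (a k j) * pairing e (p j))"
  using bilateral assms unfolding bilateral_numbering_def
  by (simp add: pairing_uminus_right pairing_sum_right pairing_scale_right)

text \<open>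
  Otherwise \<open>q\<^sub>j\<close> would be nonnegative on all rays, hence on the whole space.
\<close>

lemma positive_coefficient:
  assumes j: "j \<in> {1..n}"
  shows "\<exists>k\<in>{n<..m}. 0 < a k j"
proof -
  let ?y = "real_vec (- p j)"
  obtain \<sigma> where \<sigma>: "\<sigma> \<in> \<Sigma>" "?y \<in> \<sigma>" using complete by (auto simp: complete_fan_def)
  have "real_vec (q j) \<bullet> ?y < 0" using j by (simp add: inner_real_vec pairing_uminus_right pairing_q)
  then have "\<not> (\<forall>z\<in>\<sigma>. 0 \<le> real_vec (q j) \<bullet> z)" using \<sigma>(2) by force
  then obtain l where l: "l \<in> {1..m}" "pairing (q j) (p l) < 0"
    unfolding functional_nonneg_iff[OF \<sigma>(1)] inner_real_vec by auto
  have k: "l \<in> {n<..m}"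
  proof (rule ccontr)
    assume "l \<notin> {n<..m}"
    then have "l \<in> {1..n}" using l(1) by auto
    then show False using l(2) pairing_q[OF j, of l] by (auto split: if_splits)
  qed
  have "(\<Sum>i=1..n. int (a l i) * pairing (q j) (p i)) = (\<Sum>i=1..n. if i = j then int (a l j) else 0)"
    using j by (intro sum.cong) (auto simp: pairing_q)
  then have "pairing (q j) (p l) = - int (a l j)" unfolding pairing_p_high[OF k] using j by simp
  then show ?thesis using l(2) k by (intro bexI[of _ l]) auto
qed

lemma pairing_q_high: "j \<in> {1..n} \<Longrightarrow> k \<in> {n<..m} \<Longrightarrow> pairing (q j) (p k) = - int (a k j)"
proof -
  assume j: "j \<in> {1..n}" and k: "k \<in> {n<..m}"
  have "(\<Sum>i=1..n. int (a k i) * pairing (q j) (p i)) = (\<Sum>i=1..n. if i = j then int (a k j) else 0)"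
    using j by (intro sum.cong) (auto simp: pairing_q)
  then show ?thesis unfolding pairing_p_high[OF k] using j by simp
qed

lemma neg_q_root:
  assumes "j \<in> {1..n}"
  shows "- q j \<in> demazure_roots_at m p j"
  unfolding demazure_roots_at_def
proof (intro CollectI conjI ballI)
  show "pairing (- q j) (p j) = -1" using assms by (simp add: pairing_uminus_left pairing_q)
  fix s assume s: "s \<in> {1..m} - {j}"
  show "0 \<le> pairing (- q j) (p s)"
  proof (cases "s \<le> n")
    case True
    then show ?thesis using s assms by (simp add: pairing_uminus_left pairing_q)
  next
    case False
    then show ?thesis using s assms by (simp add: pairing_uminus_left pairing_q_high)
  qed
qed

lemma root_dominated:
  assumes i: "i \<in> {1..n}" and e: "e \<in> demazure_roots_at m p i" and k: "k \<in> {n<..m}"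
  shows "(\<Sum>j\<in>{1..n} - {i}. int (a k j) * pairing e (p j)) \<le> int (a k i)"
proof -
  have "0 \<le> pairing e (p k)" using i k by (intro root_at(2)[OF e]) auto
  then show ?thesis unfolding pairing_p_high[OF k]
    using i root_at(1)[OF e] by (simp add: sum.remove)
qed

text \<open>
  For a root at \<open>p\<^sub>k\<close> with \<open>k > n\<close> the nonnegative numbers \<open>a\<^sub>k\<^sub>j \<langle>e, p\<^sub>j\<rangle>\<close> sum to \<open>1\<close>, and \<open>a\<^sub>k\<^sub>j\<close> is positive
  whenever \<open>\<langle>e, p\<^sub>j\<rangle>\<close> is, since every column has a positive entry and the other rows contribute \<open>0\<close>.
\<close>

lemma high_root_eq_q:
  assumes k: "k \<in> {n<..m}" and e: "e \<in> demazure_roots_at m p k"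
  shows "\<exists>j\<in>{1..n}. e = q j"
proof -
  have nonneg: "0 \<le> pairing e (p j)" if "j \<in> {1..n}" for j
    using that n_le_m k by (intro root_at(2)[OF e]) auto
  have sum_k: "(\<Sum>j=1..n. int (a k j) * pairing e (p j)) = 1"
    using root_at(1)[OF e] pairing_p_high[OF k, of e] by simp
  have other: "int (a k' j) * pairing e (p j) = 0" if "k' \<in> {n<..m}" "k' \<noteq> k" "j \<in> {1..n}" for k' j
  proof -
    have "0 \<le> pairing e (p k')" using that by (intro root_at(2)[OF e]) auto
    then have "(\<Sum>j=1..n. int (a k' j) * pairing e (p j)) \<le> 0" unfolding pairing_p_high[OF that(1)] by simp
    moreover have "0 \<le> (\<Sum>j=1..n. int (a k' j) * pairing e (p j))" using nonneg by (intro sum_nonneg) auto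
    ultimately have "(\<Sum>j=1..n. int (a k' j) * pairing e (p j)) = 0" by simp
    then show ?thesis using nonneg that by (subst (asm) sum_nonneg_eq_0_iff) auto
  qed
  have big: "1 \<le> a k j" if j: "j \<in> {1..n}" "0 < pairing e (p j)" for j
  proof -
    obtain k' where k': "k' \<in> {n<..m}" "0 < a k' j" using positive_coefficient[OF j(1)] by blast
    then have "k' = k" using other[OF k'(1) _ j(1)] j(2) by auto
    then show ?thesis using k' by simp
  qed
  obtain j where j: "j \<in> {1..n}" "0 < pairing e (p j)"
  proof -
    have "\<exists>j\<in>{1..n}. int (a k j) * pairing e (p j) \<noteq> 0"
    proof (rule ccontr)
      assume "\<not> ?thesis"
      then have "(\<Sum>j=1..n. int (a k j) * pairing e (p j)) = 0" by (intro sum.neutral) blast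
      then show False using sum_k by simp
    qed
    then obtain j where j: "j \<in> {1..n}" "int (a k j) * pairing e (p j) \<noteq> 0" ..
    then have "pairing e (p j) \<noteq> 0" by auto
    then show ?thesis using nonneg[OF j(1)] that[OF j(1)] by linarith
  qed
  let ?S = "\<Sum>l\<in>{1..n} - {j}. int (a k l) * pairing e (p l)"
  have split: "int (a k j) * pairing e (p j) + ?S = 1" using sum_k j(1) by (simp add: sum.remove)
  have "1 * 1 \<le> int (a k j) * pairing e (p j)" using big[OF j] j(2) by (intro mult_mono) auto
  moreover have "0 \<le> ?S" using nonneg by (intro sum_nonneg) auto
  ultimately have S: "?S = 0" and one: "int (a k j) * pairing e (p j) = 1" using split by linarith+
  have ej: "pairing e (p j) = 1" using one j(2) by (simp add: zmult_eq_1_iff)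
  have "pairing e (p l) = pairing (q j) (p l)" if l: "l \<in> {1..n}" for l
  proof (cases "l = j")
    case True
    then show ?thesis using ej pairing_q j(1) by simp
  next
    case False
    have "int (a k l) * pairing e (p l) = 0"
      using S nonneg l False by (subst (asm) sum_nonneg_eq_0_iff) auto
    then have "pairing e (p l) = 0" using big[OF l] nonneg[OF l] by fastforce
    then show ?thesis using False l j(1) pairing_q by simp
  qed
  then have "e = q j" by (rule functional_eqI)
  then show ?thesis using j(1) by blast
qed

definition triangular_root_at :: "nat \<Rightarrow> int ^ 'n \<Rightarrow> bool" where
  "triangular_root_at i e \<longleftrightarrow> i \<in> {1..n} \<and> e \<in> demazure_roots_at m p i \<and>
     (\<forall>s\<in>{1..m}. 0 < pairing e (p s) \<longrightarrow> i < s)"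

lemma roots_at_subset: "i \<in> {1..m} \<Longrightarrow> demazure_roots_at m p i \<subseteq> demazure_roots m p"
  by (auto simp: demazure_roots_def)

lemma semisimpleI: "e \<in> demazure_roots m p \<Longrightarrow> - e \<in> demazure_roots m p \<Longrightarrow> e \<in> semisimple_roots m p"
  unfolding semisimple_roots_def by (metis IntI add.inverse_inverse imageI)

text \<open>
  Roots at \<open>k > n\<close> are of the form \<open>q\<^sub>j\<close>; they are semisimple and negative on \<open>v\<close>.  For a root at \<open>i \<le> n\<close>
  and \<open>s \<le> n\<close> with \<open>\<langle>e, p\<^sub>s\<rangle> > 0\<close>, the condition at the remaining rays shows \<open>i \<succeq> s\<close>.  If the domination is
  strict, the numbering of the classes gives \<open>i < s\<close>.  Otherwise \<open>e = q\<^sub>s - q\<^sub>i\<close> is semisimple and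
  positivity on \<open>v\<close> gives \<open>i < s\<close>.
\<close>

lemma positive_root_triangular:
  assumes "e \<in> positive_roots m p v"
  shows "\<exists>i. triangular_root_at i e"
proof -
  have e: "e \<in> demazure_roots m p" and S: "e \<in> semisimple_roots m p \<Longrightarrow> 0 < pairing e v"
    using assms by (auto simp: positive_roots_def unipotent_roots_def semisimple_roots_def)
  obtain i where i: "i \<in> {1..m}" "e \<in> demazure_roots_at m p i" using e by (auto simp: demazure_roots_def)
  have in_n: "i \<in> {1..n}"
  proof (rule ccontr)
    assume "i \<notin> {1..n}"
    then have "i \<in> {n<..m}" using i(1) by auto
    then obtain j where j: "j \<in> {1..n}" "e = q j" using high_root_eq_q i(2) by blast
    then have "- e \<in> demazure_roots m p" using neg_q_root[OF j(1)] n_le_m roots_at_subset[of j] by auto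
    then have "0 < pairing e v" using S semisimpleI[OF e] by blast
    then show False using v_neg j by force
  qed
  have nonneg: "0 \<le> pairing e (p j)" if "j \<in> {1..n} - {i}" for j
    using that n_le_m by (intro root_at(2)[OF i(2)]) auto
  have "i < s" if s: "s \<in> {1..m}" "0 < pairing e (p s)" for s
  proof (cases "s \<le> n")
    case False
    then show ?thesis using in_n by auto
  next
    case True
    then have sn: "s \<in> {1..n}" and si: "s \<noteq> i" using s root_at(1)[OF i(2)] by auto
    have bound: "int (a k s) * pairing e (p s) + (\<Sum>j\<in>{1..n} - {i} - {s}. int (a k j) * pairing e (p j)) \<le> int (a k i)"
      if "k \<in> {n<..m}" for k
    proof -
      have "(\<Sum>j\<in>{1..n} - {i}. int (a k j) * pairing e (p j))
          = int (a k s) * pairing e (p s) + (\<Sum>j\<in>{1..n} - {i} - {s}. int (a k j) * pairing e (p j))"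
        using sn si by (intro sum.remove) auto
      then show ?thesis using root_dominated[OF in_n i(2) that] by simp
    qed
    have rest: "0 \<le> (\<Sum>j\<in>{1..n} - {i} - {s}. int (a k j) * pairing e (p j))" for k
      using nonneg by (intro sum_nonneg) auto
    have "dominates n m a i s"
      unfolding dominates_def
    proof
      fix k assume k: "k \<in> {n<..m}"
      have "int (a k s) * 1 \<le> int (a k s) * pairing e (p s)" using s by (intro mult_left_mono) auto
      then have "int (a k s) \<le> int (a k i)" using bound[OF k] rest[of k] by linarith
      then show "a k s \<le> a k i" by simp
    qed
    show ?thesis
    proof (cases "dominates n m a s i")
      case False
      then show ?thesis using strict_dominance_order[OF in_n sn \<open>dominates n m a i s\<close>] by blast
    next
      case True
      have eq: "a k i = a k s" if "k \<in> {n<..m}" for k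
        using True \<open>dominates n m a i s\<close> that unfolding dominates_def by (meson le_antisym)
      have es: "pairing e (p s) = 1"
      proof -
        obtain k where k: "k \<in> {n<..m}" "0 < a k s" using positive_coefficient[OF sn] by blast
        have "int (a k s) * pairing e (p s) \<le> int (a k s) * 1"
          using bound[OF k(1)] rest[of k] eq[OF k(1)] by linarith
        then show ?thesis using k s by (simp add: mult_le_cancel_left)
      qed
      have e0: "pairing e (p j) = 0" if j: "j \<in> {1..n} - {i} - {s}" for j
      proof -
        obtain k where k: "k \<in> {n<..m}" "0 < a k j" using positive_coefficient[of j] j by blast
        have "(\<Sum>j\<in>{1..n} - {i} - {s}. int (a k j) * pairing e (p j)) = 0"
          using bound[OF k(1), unfolded es eq[OF k(1)]] rest[of k] by linarith
        then have "int (a k j) * pairing e (p j) = 0"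
          using j nonneg by (subst (asm) sum_nonneg_eq_0_iff) auto
        then show ?thesis using k by simp
      qed
      have e_eq: "e = q s - q i"
      proof (rule functional_eqI)
        fix j assume "j \<in> {1..n}"
        then show "pairing e (p j) = pairing (q s - q i) (p j)"
          using e0[of j] es root_at(1)[OF i(2)] in_n sn si
          by (cases "j = i"; cases "j = s") (auto simp: pairing_diff_left pairing_q)
      qed
      have "- e \<in> demazure_roots_at m p s"
        unfolding demazure_roots_at_def
      proof (intro CollectI conjI ballI)
        show "pairing (- e) (p s) = -1" using es by (simp add: pairing_uminus_left)
        fix l assume l: "l \<in> {1..m} - {s}"
        show "0 \<le> pairing (- e) (p l)"
        proof (cases "l \<le> n")
          case True
          then show ?thesis using l in_n sn si unfolding e_eq
            by (auto simp: pairing_uminus_left pairing_diff_left pairing_q)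
        next
          case False
          then have "l \<in> {n<..m}" using l by auto
          then show ?thesis using in_n sn eq unfolding e_eq
            by (simp add: pairing_uminus_left pairing_diff_left pairing_q_high)
        qed
      qed
      then have "- e \<in> demazure_roots m p" using s(1) roots_at_subset by blast
      then have "0 < pairing e v" using S semisimpleI[OF e] by blast
      then have "pairing (q i) v < pairing (q s) v" unfolding e_eq by (simp add: pairing_diff_left)
      then show ?thesis using v_mono[OF sn in_n] si by (meson less_asym linorder_neqE_nat)
    qed
  qed
  then show ?thesis using in_n i(2) unfolding triangular_root_at_def by blast
qed

text \<open>
  A semisimple root at \<open>i \<le> n\<close> is \<open>- q\<^sub>i\<close> or \<open>q\<^sub>t - q\<^sub>i\<close>, and triangularity gives \<open>i < t\<close> in the second
  case; both are positive on \<open>v\<close>.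
\<close>

lemma triangular_root_positive:
  assumes "triangular_root_at i e"
  shows "e \<in> positive_roots m p v"
proof -
  have i: "i \<in> {1..n}" "e \<in> demazure_roots_at m p i"
    and tri: "\<And>s. s \<in> {1..m} \<Longrightarrow> 0 < pairing e (p s) \<Longrightarrow> i < s"
    using assms by (auto simp: triangular_root_at_def)
  have im: "i \<in> {1..m}" using i(1) n_le_m by auto
  have e: "e \<in> demazure_roots m p" using roots_at_subset[OF im] i(2) by blast
  have "0 < pairing e v" if S: "e \<in> semisimple_roots m p"
  proof -
    obtain t where t: "t \<in> {1..m}" "- e \<in> demazure_roots_at m p t"
      using S by (auto simp: semisimple_roots_def demazure_roots_def)
    have et: "pairing e (p t) = 1" using root_at(1)[OF t(2)] by (simp add: pairing_uminus_left)
    have e0: "pairing e (p s) = 0" if "s \<in> {1..m}" "s \<noteq> i" "s \<noteq> t" for s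
      using root_at(2)[OF i(2) that(1,2)] root_at(2)[OF t(2) that(1,3)] by (simp add: pairing_uminus_left)
    have "t \<noteq> i" using et root_at(1)[OF i(2)] by auto
    show ?thesis
    proof (cases "t \<le> n")
      case True
      then have tn: "t \<in> {1..n}" using t(1) by simp
      have "e = q t - q i"
      proof (rule functional_eqI)
        fix j assume "j \<in> {1..n}"
        then show "pairing e (p j) = pairing (q t - q i) (p j)"
          using e0[of j] et root_at(1)[OF i(2)] i(1) tn \<open>t \<noteq> i\<close> n_le_m
          by (cases "j = i"; cases "j = t") (auto simp: pairing_diff_left pairing_q)
      qed
      moreover have "i < t" using tri[OF t(1)] et by simp
      ultimately show ?thesis using v_mono[OF i(1) tn] by (simp add: pairing_diff_left)
    next
      case False
      have "e = - q i"
      proof (rule functional_eqI)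
        fix j assume "j \<in> {1..n}"
        then show "pairing e (p j) = pairing (- q i) (p j)"
          using e0[of j] root_at(1)[OF i(2)] i(1) False n_le_m
          by (cases "j = i") (auto simp: pairing_uminus_left pairing_q)
      qed
      then show ?thesis using v_neg[OF i(1)] by (simp add: pairing_uminus_left)
    qed
  qed
  then show ?thesis using e by (auto simp: positive_roots_def unipotent_roots_def)
qed

lemma positive_roots_eq: "positive_roots m p v = {e. \<exists>i. triangular_root_at i e}"
  using positive_root_triangular triangular_root_positive by blast

lemma positive_roots_nonempty:
  assumes "0 < n"
  shows "positive_roots m p v \<noteq> {}"
proof -
  have "triangular_root_at 1 (- q 1)"
  proof -
    have "1 \<in> {1..n}" using assms by simp
    moreover have "1 < s" if "s \<in> {1..m}" "0 < pairing (- q 1) (p s)" for s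
      using that root_at(1)[OF neg_q_root[OF \<open>1 \<in> {1..n}\<close>]] by (cases "s = 1") auto
    ultimately show ?thesis using neg_q_root[of 1] unfolding triangular_root_at_def by blast
  qed
  then show ?thesis unfolding positive_roots_eq by blast
qed

text \<open>
  A coordinate \<open>\<langle>e, p\<^sub>j\<rangle>\<close> with \<open>j \<noteq> i\<close> is bounded by \<open>a\<^sub>k\<^sub>i\<close> for any \<open>k\<close> with \<open>a\<^sub>k\<^sub>j > 0\<close>.
\<close>

lemma finite_positive_roots: "finite (positive_roots m p v)"
proof -
  let ?R = "positive_roots m p v"
  \<comment> \<open>A crude common bound for all coordinates of all roots.\<close>
  define B where "B = (\<Sum>k\<in>{n<..m}. \<Sum>i\<in>{1..n}. int (a k i))"
  let ?f = "\<lambda>e. restrict (\<lambda>j. pairing e (p j)) {1..n}"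
  have "?f ` ?R \<subseteq> PiE {1..n} (\<lambda>_. {-1..B})"
  proof
    fix g assume "g \<in> ?f ` ?R"
    then obtain e i where e: "g = ?f e" "i \<in> {1..n}" "e \<in> demazure_roots_at m p i"
      unfolding positive_roots_eq triangular_root_at_def by blast
    have nonneg: "0 \<le> pairing e (p j)" if "j \<in> {1..n} - {i}" for j
      using that n_le_m by (intro root_at(2)[OF e(3)]) auto
    have B0: "0 \<le> B" unfolding B_def by (intro sum_nonneg) auto
    have "pairing e (p j) \<in> {-1..B}" if j: "j \<in> {1..n}" for j
    proof (cases "j = i")
      case True
      then show ?thesis using root_at(1)[OF e(3)] B0 by simp
    next
      case False
      obtain k where k: "k \<in> {n<..m}" "0 < a k j" using positive_coefficient[OF j] by blast
      have "1 * pairing e (p j) \<le> int (a k j) * pairing e (p j)"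
        using k nonneg[of j] j False by (intro mult_right_mono) auto
      also have "\<dots> \<le> (\<Sum>j\<in>{1..n} - {i}. int (a k j) * pairing e (p j))"
        using j False nonneg by (intro member_le_sum[of j _ "\<lambda>j. int (a k j) * pairing e (p j)"]) auto
      also have "\<dots> \<le> int (a k i)" by (rule root_dominated[OF e(2,3) k(1)])
      also have "\<dots> \<le> (\<Sum>i\<in>{1..n}. int (a k i))"
        using e(2) by (intro member_le_sum[of i _ "\<lambda>i. int (a k i)"]) auto
      also have "\<dots> \<le> B" unfolding B_def
        using k(1) by (intro member_le_sum[of k _ "\<lambda>k. \<Sum>i\<in>{1..n}. int (a k i)"]) (auto intro: sum_nonneg)
      finally show ?thesis using nonneg[of j] j False by simp
    qed
    then show "g \<in> PiE {1..n} (\<lambda>_. {-1..B})" unfolding e(1) by simp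
  qed
  then have "finite (?f ` ?R)" by (rule finite_subset) (auto intro: finite_PiE)
  moreover have "inj_on ?f ?R"
  proof (rule inj_onI)
    fix e e' assume "?f e = ?f e'"
    then show "e = e'" by (intro functional_eqI) (metis restrict_apply')
  qed
  ultimately show ?thesis by (rule finite_imageD)
qed

definition root_index :: "int ^ 'n \<Rightarrow> nat" where
  "root_index e = (THE i. triangular_root_at i e)"

lemma root_index_eq:
  assumes "triangular_root_at i e"
  shows "root_index e = i"
  unfolding root_index_def
proof (rule the_equality[of "\<lambda>i. triangular_root_at i e" i, OF assms])
  fix j assume "triangular_root_at j e"
  then have j: "e \<in> demazure_roots_at m p j" "j \<in> {1..m}" using n_le_m by (auto simp: triangular_root_at_def)
  have i: "e \<in> demazure_roots_at m p i" "i \<in> {1..m}" using assms n_le_m by (auto simp: triangular_root_at_def)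
  show "j = i" using root_at(2)[OF i(1) j(2)] root_at(1)[OF j(1)] by (cases "j = i") auto
qed

lemma positive_root_index: "e \<in> positive_roots m p v \<Longrightarrow> triangular_root_at (root_index e) e"
  unfolding positive_roots_eq using root_index_eq by auto

text \<open>
  Since \<open>i < j\<close>, the root \<open>f\<close> vanishes at \<open>p\<^sub>i\<close>, and the value \<open>-1\<close> of \<open>f\<close> at \<open>p\<^sub>j\<close> is compensated by \<open>e\<close>.
\<close>

lemma triangular_root_add:
  assumes e: "triangular_root_at i e" and f: "triangular_root_at j f" and pos: "0 < pairing e (p j)"
  shows "triangular_root_at i (e + f) \<and> pairing f (p i) = 0"
proof -
  have i: "i \<in> {1..n}" "i \<in> {1..m}" "e \<in> demazure_roots_at m p i"
    and tri_e: "\<And>s. s \<in> {1..m} \<Longrightarrow> 0 < pairing e (p s) \<Longrightarrow> i < s"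
    using e n_le_m by (auto simp: triangular_root_at_def)
  have j: "j \<in> {1..m}" "f \<in> demazure_roots_at m p j"
    and tri_f: "\<And>s. s \<in> {1..m} \<Longrightarrow> 0 < pairing f (p s) \<Longrightarrow> j < s"
    using f n_le_m by (auto simp: triangular_root_at_def)
  have "i < j" using tri_e[OF j(1) pos] .
  then have fi: "pairing f (p i) = 0"
    using tri_f[OF i(2)] root_at(2)[OF j(2) i(2)] by linarith
  have "e + f \<in> demazure_roots_at m p i"
    unfolding demazure_roots_at_def
  proof (intro CollectI conjI ballI)
    show "pairing (e + f) (p i) = -1" using root_at(1)[OF i(3)] fi by (simp add: pairing_add_left)
    fix s assume "s \<in> {1..m} - {i}"
    then have s: "s \<in> {1..m}" "s \<noteq> i" by auto
    show "0 \<le> pairing (e + f) (p s)"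
      using root_at(2)[OF i(3) s] root_at(2)[OF j(2) s(1)] root_at(1)[OF j(2)] pos
      by (cases "s = j") (auto simp: pairing_add_left)
  qed
  moreover have "i < s" if s: "s \<in> {1..m}" "0 < pairing (e + f) (p s)" for s
  proof -
    have "0 < pairing e (p s) \<or> 0 < pairing f (p s)" using s(2) by (auto simp: pairing_add_left)
    then show ?thesis using tri_e[OF s(1)] tri_f[OF s(1)] \<open>i < j\<close> by auto
  qed
  ultimately show ?thesis using i fi by (simp add: triangular_root_at_def)
qed

text \<open>
  The negative elements of a translation invariant strict order on \<open>M\<close>.  All positive roots are negative
  for it, so walks in the root graph descend strictly.
\<close>

definition lex_negative :: "int ^ 'n \<Rightarrow> bool" where
  "lex_negative e \<longleftrightarrow> (\<exists>i\<in>{1..n}. pairing e (p i) < 0 \<and> (\<forall>s\<in>{1..n}. s < i \<longrightarrow> pairing e (p s) = 0))"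

lemma lex_negative_root: "e \<in> positive_roots m p v \<Longrightarrow> lex_negative e"
proof -
  assume "e \<in> positive_roots m p v"
  then obtain i where e: "triangular_root_at i e" using positive_root_triangular by blast
  then have i: "i \<in> {1..n}" "e \<in> demazure_roots_at m p i" by (auto simp: triangular_root_at_def)
  have "pairing e (p s) = 0" if s: "s \<in> {1..n}" "s < i" for s
  proof -
    have sm: "s \<in> {1..m}" using s n_le_m by auto
    then have "\<not> 0 < pairing e (p s)" using e s by (auto simp: triangular_root_at_def)
    moreover have "0 \<le> pairing e (p s)" using root_at(2)[OF i(2) sm] s by simp
    ultimately show ?thesis by simp
  qed
  then show ?thesis unfolding lex_negative_def using i root_at(1)[OF i(2)] by (intro bexI[of _ i]) auto
qed

lemma lex_negative_add:
  assumes "lex_negative e" "lex_negative f"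
  shows "lex_negative (e + f)"
proof -
  obtain i where i: "i \<in> {1..n}" "pairing e (p i) < 0" "\<And>s. s \<in> {1..n} \<Longrightarrow> s < i \<Longrightarrow> pairing e (p s) = 0"
    using assms(1) by (auto simp: lex_negative_def)
  obtain j where j: "j \<in> {1..n}" "pairing f (p j) < 0" "\<And>s. s \<in> {1..n} \<Longrightarrow> s < j \<Longrightarrow> pairing f (p s) = 0"
    using assms(2) by (auto simp: lex_negative_def)
  have "pairing (e + f) (p (min i j)) < 0"
    using i j by (cases i j rule: linorder_cases) (auto simp: pairing_add_left)
  moreover have "\<forall>s\<in>{1..n}. s < min i j \<longrightarrow> pairing (e + f) (p s) = 0"
    using i(3) j(3) by (simp add: pairing_add_left)
  ultimately show ?thesis unfolding lex_negative_def using i(1) j(1) by (intro bexI[of _ "min i j"]) auto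
qed

lemma lex_negative_irrefl: "\<not> lex_negative 0"
  by (simp add: lex_negative_def)

end

section \<open>The lower central series\<close>

locale graded_radiant_fan = radiant_fan \<Sigma> m n p q a r c v
  for \<Sigma> :: "(real ^ 'n) set set" and m n :: nat and p q :: "nat \<Rightarrow> int ^ 'n"
    and a :: "nat \<Rightarrow> nat \<Rightarrow> nat" and r :: nat and c :: "nat \<Rightarrow> nat" and v :: "int ^ 'n" +
  fixes ht :: "int ^ 'n \<Rightarrow> nat"
  assumes height_pos: "\<And>e. e \<in> positive_roots m p v \<Longrightarrow> 0 < ht e"
    and height_add: "\<And>e f. e \<in> positive_roots m p v \<Longrightarrow> f \<in> positive_roots m p v \<Longrightarrow>
      e + f \<in> positive_roots m p v \<Longrightarrow> ht e < ht (e + f)"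
    and height_pred: "\<And>e. e \<in> positive_roots m p v \<Longrightarrow> 1 < ht e \<Longrightarrow>
      \<exists>f\<in>positive_roots m p v. \<exists>g\<in>positive_roots m p v. e = f + g \<and> Suc (ht f) = ht e"
begin

abbreviation R :: "(int ^ 'n) set" where "R \<equiv> positive_roots m p v"

lemma root_index_at:
  assumes "e \<in> R"
  shows "root_index e \<in> {1..n}" "root_index e \<in> {1..m}" "e \<in> demazure_roots_at m p (root_index e)"
  using positive_root_index[OF assms] n_le_m by (auto simp: triangular_root_at_def)

sublocale roots: graded_roots R "{1..m}" "\<lambda>e s. pairing e (p s)" root_index ht
proof
  show "finite R" by (rule finite_positive_roots)
  show "finite {1..m}" by simp
  fix e assume e: "e \<in> R"
  note at = root_index_at[OF e]
  show "root_index e \<in> {1..m}" by (rule at(2))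
  show "pairing e (p (root_index e)) = - 1" by (rule root_at(1)[OF at(3)])
  show "0 \<le> pairing e (p s)" if "s \<in> {1..m}" "s \<noteq> root_index e" for s
    by (rule root_at(2)[OF at(3) that])
  show "0 < ht e" by (rule height_pos[OF e])
  show "\<exists>f\<in>R. \<exists>g\<in>R. e = f + g \<and> Suc (ht f) = ht e" if "1 < ht e"
    by (rule height_pred[OF e that])
  fix f assume f: "f \<in> R"
  show "e = f" if "\<And>s. s \<in> {1..m} \<Longrightarrow> pairing e (p s) = pairing f (p s)"
    using that n_le_m by (intro functional_eqI) auto
  show "e + f \<in> R \<and> root_index (e + f) = root_index e \<and> pairing f (p (root_index e)) = 0"
    if "0 < pairing e (p (root_index f))"
    using triangular_root_add[OF positive_root_index[OF e] positive_root_index[OF f] that]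
      triangular_root_positive root_index_eq by blast
  show "ht e < ht (e + f)" if "e + f \<in> R" by (rule height_add[OF e f that])
qed (rule pairing_add_left)

lemma elementary_eq_root_map: "roots.elementary e \<alpha> = root_map (root_index e) e \<alpha>"
  by (simp add: fun_eq_iff roots.elementary_def root_map_def roots.monomial_def roots.expo_def root_monomial_def del: One_nat_def)

text \<open>
  Requiring equality instead of inclusion of the image makes the relation pass to inverses.
\<close>

definition lifts :: "(('n, 'k::{alg_closed_field, field_char_0}) toric_point \<Rightarrow> ('n, 'k) toric_point) \<Rightarrow>
    ((nat \<Rightarrow> 'k) \<Rightarrow> nat \<Rightarrow> 'k) \<Rightarrow> bool" where
  "lifts \<phi> g \<longleftrightarrow> g ` total_space = total_space \<and> (\<forall>x\<in>total_space. \<phi> (quot x) = quot (g x))"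

lemma elementary_cox_space:
  assumes "e \<in> R"
  shows "roots.elementary e (\<alpha> :: 'k::{alg_closed_field, field_char_0}) ` total_space = total_space"
proof -
  have total_space: "roots.elementary e \<alpha> x \<in> total_space" if "x \<in> total_space"
    for \<alpha> and x :: "nat \<Rightarrow> 'k"
    unfolding elementary_eq_root_map using that by (rule root_map_cox_space[OF _ root_index_at(2,3)[OF assms]])
  show ?thesis
  proof (intro subset_antisym subsetI)
    fix x :: "nat \<Rightarrow> 'k" assume "x \<in> total_space"
    moreover have "x = roots.elementary e \<alpha> (roots.elementary e (- \<alpha>) x)"
      using roots.elementary_inverse[OF assms, of "- \<alpha>" x] by simp
    ultimately show "x \<in> roots.elementary e \<alpha> ` total_space" using total_space by blast
  qed (use total_space in blast)
qed

lemma root_subgroup_iff: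
  fixes \<phi> :: "('n, 'k::{alg_closed_field, field_char_0}) toric_point \<Rightarrow> ('n, 'k) toric_point"
  assumes e: "e \<in> R"
  shows "\<phi> \<in> root_subgroup \<Sigma> m p e \<longleftrightarrow> \<phi> \<in> carrier (Aut_variety \<Sigma>) \<and> (\<exists>\<alpha>. lifts \<phi> (roots.elementary e \<alpha>))"
proof -
  note at = root_index_at[OF e]
  have image: "roots.elementary e \<alpha> ` total_space = (total_space :: (nat \<Rightarrow> 'k) set)" for \<alpha>
    by (rule elementary_cox_space[OF e])
  then have total_space: "roots.elementary e \<alpha> x \<in> total_space" if "x \<in> total_space" for \<alpha> and x :: "nat \<Rightarrow> 'k"
    using that by blast
  have point: "point_map (exp_derivation (root_derivation m p i e) \<alpha>) x = roots.elementary e \<alpha> x"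
    if "i \<in> {1..m}" "e \<in> demazure_roots_at m p i" for i \<alpha> and x :: "nat \<Rightarrow> 'k"
  proof -
    have "root_index e = i"
      using root_at(1)[OF that(2)] root_at(2)[OF at(3) that(1)] by (cases "root_index e = i") auto
    then show ?thesis unfolding exp_root_derivation[OF that]
      by (simp add: elementary_eq_root_map root_map_def root_monomial_def del: One_nat_def)
  qed
  show ?thesis
    unfolding root_subgroup_def mem_Collect_eq Let_def lifts_def image
    using point at total_space by (auto cong: conj_cong)
qed

lemma root_automorphism:
  assumes "e \<in> R"
  shows "\<exists>\<phi>\<in>root_subgroup \<Sigma> m p e. lifts \<phi> (roots.elementary e (\<alpha> :: 'k::{alg_closed_field, field_char_0}))"
proof -
  note at = root_index_at[OF assms]
  let ?\<phi> = "restrict (root_aut (root_index e) e \<alpha>) (toric_points \<Sigma>)"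
  have aut: "?\<phi> \<in> carrier (Aut_variety \<Sigma>)" by (rule root_aut_in_Aut[OF at(2,3)])
  have "?\<phi> (quot x) = quot (roots.elementary e \<alpha> x)" if "x \<in> total_space" for x
    using quot_in_toric_points[OF that] root_aut_quot[OF at(2,3) that, of \<alpha>] by (simp add: elementary_eq_root_map del: One_nat_def)
  then have "lifts ?\<phi> (roots.elementary e \<alpha>)"
    unfolding lifts_def using elementary_cox_space[OF assms] by blast
  then show ?thesis using aut root_subgroup_iff[OF assms] by blast
qed

abbreviation Aut :: "(('n, 'k::{alg_closed_field, field_char_0}) toric_point \<Rightarrow> ('n, 'k) toric_point) monoid" where
  "Aut \<equiv> Aut_variety \<Sigma>"

abbreviation U :: "(('n, 'k::{alg_closed_field, field_char_0}) toric_point \<Rightarrow> ('n, 'k) toric_point) monoid" where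
  "U \<equiv> U_max \<Sigma> m p v"

lemma lifts_mult:
  assumes "\<phi> \<in> carrier Aut" "\<psi> \<in> carrier Aut" "lifts \<phi> g" "lifts \<psi> h"
  shows "lifts (\<phi> \<otimes>\<^bsub>Aut_variety \<Sigma>\<^esub> \<psi>) (g \<circ> h)"
proof -
  have "(\<phi> \<otimes>\<^bsub>Aut_variety \<Sigma>\<^esub> \<psi>) (quot x) = quot ((g \<circ> h) x)" if x: "x \<in> total_space"
    for x
  proof -
    have "h x \<in> total_space" using assms(4) x unfolding lifts_def by blast
    then show ?thesis
      using Aut_mult[OF assms(1,2) quot_in_toric_points[OF x]] assms(3,4) x by (simp add: lifts_def)
  qed
  moreover have "(g \<circ> h) ` total_space = total_space" using assms(3,4) unfolding lifts_def by (metis image_comp)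
  ultimately show ?thesis by (simp add: lifts_def)
qed

lemma lifts_inv:
  fixes \<phi> :: "('n, 'k::{alg_closed_field, field_char_0}) toric_point \<Rightarrow> ('n, 'k) toric_point"
  assumes "\<phi> \<in> carrier Aut" "lifts \<phi> g" "bij g"
  shows "lifts (inv\<^bsub>Aut_variety \<Sigma>\<^esub> \<phi>) (inv_into UNIV g)"
  unfolding lifts_def
proof (intro conjI ballI)
  have g: "g ` total_space = total_space" using assms(2) by (simp add: lifts_def)
  have "inv_into UNIV g ` (g ` total_space) = total_space" using assms(3) by (simp add: bij_is_inj image_inv_f_f)
  then show "inv_into UNIV g ` total_space = total_space" unfolding g .
  fix x :: "nat \<Rightarrow> 'k" assume "x \<in> total_space"
  then obtain y where y: "y \<in> total_space" "x = g y" using g by blast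
  then have "quot x = \<phi> (quot y)" using assms(2) by (simp add: lifts_def)
  then show "(inv\<^bsub>Aut_variety \<Sigma>\<^esub> \<phi>) (quot x) = quot (inv_into UNIV g x)"
    using Aut_inv[OF assms(1) quot_in_toric_points[OF y(1)]] y assms(3) by (simp add: bij_is_inj)
qed

text \<open>
  An automorphism is determined by any of its lifts, because the quotient map is onto.
\<close>

lemma lifts_id_unique:
  assumes "\<phi> \<in> carrier Aut" "lifts \<phi> id"
  shows "\<phi> = \<one>\<^bsub>Aut_variety \<Sigma>\<^esub>"
proof (rule Aut_eqI[OF assms(1)])
  interpret A: group Aut by (rule group_Aut)
  show "\<one>\<^bsub>Aut_variety \<Sigma>\<^esub> \<in> carrier Aut" by simp
  fix P :: "('n, 'a) toric_point" assume P: "P \<in> toric_points \<Sigma>"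
  then obtain x where "x \<in> total_space" "quot x = P" using cox_map_surj by blast
  then show "\<phi> P = \<one>\<^bsub>Aut_variety \<Sigma>\<^esub> P"
    using assms(2) P by (auto simp: lifts_def Aut_one)
qed

definition lifted :: "nat \<Rightarrow> (('n, 'k::{alg_closed_field, field_char_0}) toric_point \<Rightarrow> ('n, 'k) toric_point) set" where
  "lifted k = {\<phi> \<in> carrier Aut. \<exists>g\<in>roots.filtration k. lifts \<phi> g}"

lemma filtration_bij: "g \<in> roots.filtration k \<Longrightarrow> bij g"
  by (simp add: roots.filtration_def del: One_nat_def)

lemma lifted_subgroup: "subgroup (lifted k) Aut"
proof -
  interpret A: group Aut by (rule group_Aut)
  have "lifts \<one>\<^bsub>Aut_variety \<Sigma>\<^esub> id"
    using quot_in_toric_points by (auto simp: lifts_def Aut_one)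
  then have one: "\<one>\<^bsub>Aut_variety \<Sigma>\<^esub> \<in> lifted k"
    using roots.filtration_id by (auto simp: lifted_def)
  show ?thesis
  proof (rule A.subgroupI)
    show "lifted k \<noteq> {}" using one by blast
    show "inv\<^bsub>Aut_variety \<Sigma>\<^esub> \<phi> \<in> lifted k" if "\<phi> \<in> lifted k" for \<phi>
      using that lifts_inv roots.filtration_inv filtration_bij by (fastforce simp: lifted_def)
    show "\<phi> \<otimes>\<^bsub>Aut_variety \<Sigma>\<^esub> \<psi> \<in> lifted k" if \<phi>\<psi>: "\<phi> \<in> lifted k" "\<psi> \<in> lifted k"
      for \<phi> \<psi>
    proof -
      obtain g h where gh: "\<phi> \<in> carrier Aut" "g \<in> roots.filtration k" "lifts \<phi> g"
        "\<psi> \<in> carrier Aut" "h \<in> roots.filtration k" "lifts \<psi> h"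
        using \<phi>\<psi> unfolding lifted_def by blast
      then have "lifts (\<phi> \<otimes>\<^bsub>Aut_variety \<Sigma>\<^esub> \<psi>) (g \<circ> h)"
        by (intro lifts_mult)
      then show ?thesis unfolding lifted_def using roots.filtration_comp[OF gh(2,5)] gh(1,4) by blast
    qed
  qed (auto simp: lifted_def)
qed

lemma root_subgroups_in_Aut: "(\<Union>e\<in>R. root_subgroup \<Sigma> m p e) \<subseteq> carrier Aut"
  by (auto simp: root_subgroup_def)

lemma carrier_U: "carrier U = generate Aut (\<Union>e\<in>R. root_subgroup \<Sigma> m p e)"
  by (simp add: U_max_def)

lemma U_eq: "U = Aut\<lparr>carrier := carrier U\<rparr>"
  by (simp add: U_max_def)

lemma U_subgroup: "subgroup (carrier U) Aut"
  unfolding carrier_U by (intro group.generate_is_subgroup group_Aut root_subgroups_in_Aut)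

lemma group_U: "group U"
  using subgroup.subgroup_is_group[OF U_subgroup group_Aut] U_eq by metis

lemma U_mult: "\<phi> \<otimes>\<^bsub>U\<^esub> \<psi> = \<phi> \<otimes>\<^bsub>Aut_variety \<Sigma>\<^esub> \<psi>"
  by (simp add: U_max_def)

lemma U_one: "\<one>\<^bsub>U\<^esub> = \<one>\<^bsub>Aut_variety \<Sigma>\<^esub>"
  by (simp add: U_max_def)

lemma U_inv: "\<phi> \<in> carrier U \<Longrightarrow> inv\<^bsub>U\<^esub> \<phi> = inv\<^bsub>Aut_variety \<Sigma>\<^esub> \<phi>"
  using group.m_inv_consistent[OF group_Aut U_subgroup] U_eq by metis

lemma carrier_U_lifted: "carrier U \<subseteq> lifted 1"
  unfolding carrier_U
proof (rule group.generate_subgroup_incl[OF group_Aut _ lifted_subgroup])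
  show "(\<Union>e\<in>R. root_subgroup \<Sigma> m p e) \<subseteq> lifted 1"
    using root_subgroup_iff roots.elementary_filtration by (fastforce simp: lifted_def)
qed

lemma commutator_lifts:
  assumes \<phi>: "\<phi> \<in> carrier U" "lifts \<phi> g" "bij g" and \<psi>: "\<psi> \<in> carrier U" "lifts \<psi> h" "bij h"
  shows "lifts (\<phi> \<otimes>\<^bsub>U\<^esub> \<psi> \<otimes>\<^bsub>U\<^esub> inv\<^bsub>U\<^esub> \<phi> \<otimes>\<^bsub>U\<^esub> inv\<^bsub>U\<^esub> \<psi>) (g \<circ> h \<circ> inv_into UNIV g \<circ> inv_into UNIV h)"
proof -
  interpret A: group Aut by (rule group_Aut)
  have "\<phi> \<in> carrier Aut" "\<psi> \<in> carrier Aut"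
    using subgroup.subset[OF U_subgroup] \<phi> \<psi> by auto
  then show ?thesis
    unfolding U_mult U_inv[OF \<phi>(1)] U_inv[OF \<psi>(1)]
    by (intro lifts_mult lifts_inv \<phi> \<psi> A.m_closed A.inv_closed)
qed

lemma lower_central_subset: "lower_central U k \<subseteq> carrier U \<inter> lifted (k + 1)"
proof (induction k)
  case 0
  then show ?case using carrier_U_lifted by simp
next
  case (Suc k)
  interpret UG: group U by (rule group_U)
  let ?H = "carrier U \<inter> lifted (Suc k + 1)"
  note TS = lifted_subgroup[of "Suc k + 1"]
  have H: "subgroup ?H U"
  proof (rule UG.subgroupI)
    have "\<one>\<^bsub>U\<^esub> \<in> ?H" using subgroup.one_closed[OF TS] UG.one_closed unfolding U_one by blast
    then show "?H \<noteq> {}" by blast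
    show "inv\<^bsub>U\<^esub> \<phi> \<in> ?H" if \<phi>: "\<phi> \<in> ?H" for \<phi>
      using UG.inv_closed[of \<phi>] subgroup.m_inv_closed[OF TS, of \<phi>] U_inv[of \<phi>] \<phi> by auto
    show "\<phi> \<otimes>\<^bsub>U\<^esub> \<psi> \<in> ?H" if \<phi>: "\<phi> \<in> ?H" "\<psi> \<in> ?H"
      for \<phi> \<psi>
      using UG.m_closed[of \<phi> \<psi>] subgroup.m_closed[OF TS, of \<phi> \<psi>] U_mult[of \<phi> \<psi>] \<phi> by auto
  qed auto
  show ?case
    unfolding lower_central.simps
  proof (rule UG.generate_subgroup_incl[OF _ H], clarify)
    fix \<phi> \<psi> :: "('n, 'a) toric_point \<Rightarrow> ('n, 'a) toric_point"
    assume \<phi>: "\<phi> \<in> lower_central U k" and \<psi>: "\<psi> \<in> carrier U"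
    have \<phi>U: "\<phi> \<in> carrier U" using Suc.IH \<phi> by blast
    obtain g where g: "g \<in> roots.filtration (k + 1)" "lifts \<phi> g" using Suc.IH \<phi> unfolding lifted_def by blast
    obtain h where h: "h \<in> roots.filtration 1" "lifts \<psi> h" using carrier_U_lifted \<psi> unfolding lifted_def by blast
    let ?c = "\<phi> \<otimes>\<^bsub>U\<^esub> \<psi> \<otimes>\<^bsub>U\<^esub> inv\<^bsub>U\<^esub> \<phi> \<otimes>\<^bsub>U\<^esub> inv\<^bsub>U\<^esub> \<psi>"
    have cU: "?c \<in> carrier U" using \<phi>U \<psi> by simp
    have "lifts ?c (g \<circ> h \<circ> inv_into UNIV g \<circ> inv_into UNIV h)"
      by (intro commutator_lifts \<phi>U \<psi> g h filtration_bij[OF g(1)] filtration_bij[OF h(1)])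
    moreover have "g \<circ> h \<circ> inv_into UNIV g \<circ> inv_into UNIV h \<in> roots.filtration (k + 1 + 1)"
      by (rule roots.filtration_commutator[OF g(1) h(1)]) simp
    ultimately show "?c \<in> ?H" unfolding lifted_def using cU subgroup.subset[OF U_subgroup] by auto
  qed
qed

text \<open>
  Induction along a longest path ending in \<open>e\<close>: take the commutator of an element with nonzero
  coefficient at the previous vertex and an elementary substitution of the root on the arrow.
\<close>

lemma lower_central_leading_term:
  assumes "e \<in> R" "ht e = k + 1"
  shows "\<exists>\<phi>\<in>lower_central (U :: (('n, 'k::{alg_closed_field, field_char_0}) toric_point \<Rightarrow> ('n, 'k) toric_point) monoid) k.
    \<exists>\<zeta>. lifts \<phi> (roots.shift \<zeta>) \<and> roots.shift \<zeta> \<in> roots.filtration 1 \<and> roots.vanishes_below (k + 1) \<zeta> \<and> \<zeta> e \<noteq> 0"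
  using assms
proof (induction k arbitrary: e)
  case 0
  obtain \<phi> where \<phi>: "\<phi> \<in> root_subgroup \<Sigma> m p e" "lifts \<phi> (roots.elementary e (1::'k))"
    using root_automorphism[OF 0(1)] by blast
  have "\<phi> \<in> lower_central U 0" using \<phi>(1) 0(1) by (auto simp: carrier_U intro: generate.incl)
  moreover have "roots.vanishes_below (0 + 1) (\<lambda>f. if f = e then (1::'k) else 0)"
    using height_pos[OF 0(1)] by (auto simp: roots.vanishes_below_def)
  ultimately show ?case
    using \<phi>(2) roots.elementary_filtration[OF 0(1), of "1::'k"] unfolding roots.elementary_shift[OF 0(1)]
    by (intro bexI[of _ \<phi>] exI[of _ "\<lambda>f. if f = e then 1 else 0"]) auto
next
  case (Suc k)
  have "1 < ht e" using Suc.prems(2) by simp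
  then obtain f b where f: "f \<in> R" and b: "b \<in> R" and e: "e = f + b" and "Suc (ht f) = ht e"
    using height_pred[OF Suc.prems(1)] by blast
  then have "ht f = k + 1" using Suc.prems(2) by simp
  from Suc.IH[OF f this] obtain \<phi> and \<zeta> :: "int ^ 'n \<Rightarrow> 'k" where \<phi>: "\<phi> \<in> lower_central U k" "lifts \<phi> (roots.shift \<zeta>)"
    and \<zeta>: "roots.shift \<zeta> \<in> roots.filtration 1" "roots.vanishes_below (k + 1) \<zeta>" "\<zeta> f \<noteq> 0" by blast
  obtain \<psi> where \<psi>: "\<psi> \<in> root_subgroup \<Sigma> m p b" "lifts \<psi> (roots.elementary b (1::'k))"
    using root_automorphism[OF b] by blast
  let ?d = "\<lambda>x. if x = b then (1::'k) else 0"
  let ?g = "roots.shift \<zeta>" let ?h = "roots.elementary b (1::'k)"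
  have \<phi>U: "\<phi> \<in> carrier U" using \<phi>(1) lower_central_subset by blast
  have \<psi>U: "\<psi> \<in> carrier U" using \<psi>(1) b by (auto simp: carrier_U intro: generate.incl)
  let ?c = "\<phi> \<otimes>\<^bsub>U\<^esub> \<psi> \<otimes>\<^bsub>U\<^esub> inv\<^bsub>U\<^esub> \<phi> \<otimes>\<^bsub>U\<^esub> inv\<^bsub>U\<^esub> \<psi>"
  have c: "?c \<in> lower_central U (Suc k)"
    unfolding lower_central.simps using \<phi>(1) \<psi>U by (intro generate.incl) blast
  have h: "?h \<in> roots.filtration 1" by (rule roots.elementary_filtration[OF b])
  have lift: "lifts ?c (?g \<circ> ?h \<circ> inv_into UNIV ?g \<circ> inv_into UNIV ?h)"
    by (intro commutator_lifts \<phi>U \<psi>U \<phi>(2) \<psi>(2) filtration_bij[OF \<zeta>(1)] filtration_bij[OF h])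
  obtain \<zeta>' where \<zeta>': "inv_into UNIV ?g = roots.shift \<zeta>'" using \<zeta>(1) unfolding roots.filtration_def by blast
  obtain d' where d': "inv_into UNIV ?h = roots.shift d'" using h unfolding roots.filtration_def by blast
  have "roots.vanishes_below 1 ?d" using height_pos[OF b] by (auto simp: roots.vanishes_below_def)
  from roots.commutator_expansion[OF filtration_bij[OF \<zeta>(1)] refl \<zeta>' \<zeta>(2) filtration_bij[OF h] roots.elementary_shift[OF b] d' this]
  obtain \<eta> where \<eta>: "?g \<circ> ?h \<circ> inv_into UNIV ?g \<circ> inv_into UNIV ?h = roots.shift \<eta>" "roots.vanishes_below (k + 1 + 1) \<eta>"
    "\<And>r. r \<in> R \<Longrightarrow> ht r = k + 1 + 1 \<Longrightarrow> \<eta> r = roots.prelie \<zeta> ?d r - roots.prelie ?d \<zeta> r" by auto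
  have "\<eta> e \<noteq> 0"
    using roots.bracket_coefficient[OF f b, of \<zeta>] Suc.prems \<zeta>(3) \<eta>(3)[OF Suc.prems(1)] unfolding e by simp
  moreover have "?g \<circ> ?h \<circ> inv_into UNIV ?g \<circ> inv_into UNIV ?h \<in> roots.filtration 1"
    by (intro roots.filtration_comp roots.filtration_inv \<zeta>(1) h)
  ultimately show ?case
    using c lift \<eta>(2) unfolding \<eta>(1) by (intro bexI[of _ ?c] exI[of _ \<eta>]) auto
qed

text \<open>
  Choose \<open>x\<close> with nonzero coordinates that is moved in the coordinate \<open>i\<close>.  If the automorphism were the
  identity, \<open>x\<close> and its image would have equal values of \<open>\<chi>\<close> at \<open>q\<^sub>i\<close>, which is \<open>x\<^sub>i\<close> times a nonzero
  expression in the variables with index above \<open>n\<close>, and those are fixed.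
\<close>

lemma nontrivial_lift:
  fixes \<zeta> :: "int ^ 'n \<Rightarrow> 'k::{alg_closed_field, field_char_0}"
  assumes e: "e \<in> R" and "\<zeta> e \<noteq> 0" and lift: "lifts \<phi> (roots.shift \<zeta>)"
  shows "\<phi> \<noteq> \<one>\<^bsub>Aut_variety \<Sigma>\<^esub>"
proof
  assume one: "\<phi> = \<one>\<^bsub>Aut_variety \<Sigma>\<^esub>"
  let ?i = "root_index e"
  obtain x where x: "\<And>s. s \<in> {1..m} \<Longrightarrow> x s \<noteq> 0" "roots.shift \<zeta> x ?i \<noteq> x ?i"
    using roots.shift_nontrivial[OF e, of \<zeta>] assms(2) by blast
  let ?y = "roots.shift \<zeta> x"
  have zx: "zeros x = {}" using x(1) by (auto simp: zeros_def)
  have xc: "x \<in> total_space" unfolding cox_space_iff zx using zero_cone by blast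
  then have eq: "quot ?y = quot x"
    using lift quot_in_toric_points[OF xc] unfolding one lifts_def Aut_one by auto
  have fx: "fst (quot x) \<subseteq> {0}" using fst_quot_subset_iff[OF zero_cone] zx by blast
  have zy: "zeros ?y = {}"
  proof (rule ccontr)
    assume "zeros ?y \<noteq> {}"
    then obtain l where l: "l \<in> zeros ?y" by blast
    then have "real_vec (p l) \<in> fst (quot ?y)" by (rule zeros_in_fst_quot)
    then have "real_vec (p l) = real_vec 0" unfolding eq using fx by auto
    then show False using p_nonzero[of l] l unfolding real_vec_eq_iff by (auto simp: zeros_def)
  qed
  have yc: "?y \<in> total_space" unfolding cox_space_iff zy using zero_cone by blast
  have dual: "u \<in> dual_monoid {0}" for u :: "int ^ 'n" by (simp add: dual_monoid_def)
  have chi: "chi u ?y = chi u x" for u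
    using snd_quot_chart[OF xc zero_cone fx dual, of u] snd_quot_chart[OF yc zero_cone _ dual, of u] fx eq by simp
  have i: "?i \<in> {1..n}" "?i \<in> {1..m}" using root_index_at[OF e] by auto
  have split: "chi (q ?i) z = z ?i * (\<Prod>l\<in>{n<..m}. z l powi pairing (q ?i) (p l))"
    for z :: "nat \<Rightarrow> 'k"
  proof -
    have "{1..m} = {1..n} \<union> {n<..m}" using n_le_m by auto
    then have "chi (q ?i) z = (\<Prod>l=1..n. z l powi pairing (q ?i) (p l)) * (\<Prod>l\<in>{n<..m}. z l powi pairing (q ?i) (p l))"
      unfolding chi_def by (simp only:) (intro prod.union_disjoint, auto)
    also have "(\<Prod>l=1..n. z l powi pairing (q ?i) (p l)) = (\<Prod>l=1..n. if l = ?i then z ?i else 1)"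
      using i(1) by (intro prod.cong) (auto simp: pairing_q)
    finally show ?thesis using i(1) by simp
  qed
  have "?y l = x l" if "l \<in> {n<..m}" for l
  proof -
    have "root_index f \<noteq> l" if "f \<in> R" for f
      using root_index_at(1)[OF that] \<open>l \<in> {n<..m}\<close> by auto
    then have "roots.combo l \<zeta> x = 0" unfolding roots.combo_def by (intro sum.neutral) blast
    then show ?thesis unfolding roots.shift_def by simp
  qed
  define C where "C = (\<Prod>l\<in>{n<..m}. x l powi pairing (q ?i) (p l))"
  have Cy: "(\<Prod>l\<in>{n<..m}. ?y l powi pairing (q ?i) (p l)) = C"
    unfolding C_def using \<open>\<And>l. l \<in> {n<..m} \<Longrightarrow> ?y l = x l\<close> by (intro prod.cong) auto
  have "C \<noteq> 0" unfolding C_def using x(1) by (auto simp: prod_zero_iff)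
  have "?y ?i * C = x ?i * C" using chi[of "q ?i"] unfolding split Cy C_def[symmetric] .
  then have "?y ?i = x ?i" using \<open>C \<noteq> 0\<close> by (simp only: mult_cancel_right) blast
  then show False using x(2) by simp
qed

lemma nilpotency_class_eq_max_height:
  assumes "\<And>e. e \<in> R \<Longrightarrow> ht e \<le> h" "e0 \<in> R" "ht e0 = h"
  shows "has_nilpotency_class (U :: (('n, 'k::{alg_closed_field, field_char_0}) toric_point \<Rightarrow> ('n, 'k) toric_point) monoid) h"
  unfolding has_nilpotency_class_def
proof (intro conjI allI impI)
  let ?U = "U :: (('n, 'k) toric_point \<Rightarrow> ('n, 'k) toric_point) monoid"
  show "group ?U" by (rule group_U)
  have "0 < h" using height_pos[OF assms(2)] assms(3) by simp
  show "lower_central ?U h = {\<one>\<^bsub>?U\<^esub>}"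
  proof
    show "{\<one>\<^bsub>?U\<^esub>} \<subseteq> lower_central ?U h"
      using \<open>0 < h\<close> by (cases h) (auto intro: generate.one)
    show "lower_central ?U h \<subseteq> {\<one>\<^bsub>?U\<^esub>}"
    proof
      fix \<phi> assume "\<phi> \<in> lower_central ?U h"
      then have "\<phi> \<in> lifted (h + 1)" using lower_central_subset by blast
      then obtain g where g: "\<phi> \<in> carrier Aut" "g \<in> roots.filtration (h + 1)" "lifts \<phi> g" unfolding lifted_def by blast
      have "g = id" by (rule roots.filtration_trivial[OF _ g(2)]) (use assms(1) in fastforce)
      then show "\<phi> \<in> {\<one>\<^bsub>?U\<^esub>}" using lifts_id_unique g by (simp add: U_one)
    qed
  qed
  fix d assume "d < h"
  then obtain e where e: "e \<in> R" "ht e = d + 1" using roots.ht_attained[OF assms(2), of "d + 1"] assms(3) by auto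
  obtain \<phi> and \<zeta> :: "int ^ 'n \<Rightarrow> 'k" where "\<phi> \<in> lower_central ?U d" "lifts \<phi> (roots.shift \<zeta>)" "\<zeta> e \<noteq> 0"
    using lower_central_leading_term[OF e] by blast
  then show "lower_central ?U d \<noteq> {\<one>\<^bsub>?U\<^esub>}" using nontrivial_lift[OF e(1)]
    unfolding U_one by blast
qed

end

theorem corollary5p6:
  fixes \<Sigma> :: "(real ^ 'n) set set"
    and n m r :: nat
    and p q :: "nat \<Rightarrow> int ^ 'n"
    and a :: "nat \<Rightarrow> nat \<Rightarrow> nat"
    and c :: "nat \<Rightarrow> nat"
    and v :: "int ^ 'n"
  assumes "n = CARD('n)"
    and "complete_fan \<Sigma>"
    and "ray_generators \<Sigma> m p"
    and "bilateral_numbering n m p a"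
    and "dual_basis n p q"
    and "class_numbering n m a r c"
    and "\<forall>i\<in>{1..n}. \<forall>j\<in>{1..n}. i < j \<longrightarrow> pairing (q i) v < pairing (q j) v"
    and "\<forall>i\<in>{1..n}. pairing (q i) v < 0"
  shows "\<exists>l. longest_path_length (root_graph (positive_roots m p v)) l \<and>
    has_nilpotency_class
      (U_max \<Sigma> m p v ::
        (('n, 'k::{alg_closed_field, field_char_0}) toric_point \<Rightarrow> ('n, 'k) toric_point) monoid)
      (l + 1)"
proof -
  interpret radiant_fan \<Sigma> m n p q a r c v
    by unfold_locales (use assms in auto)
  let ?R = "positive_roots m p v"
  have "0 < n" using assms(1) by simp
  obtain ht l where l: "longest_path_length (root_graph ?R) l"
    and ht: "\<forall>e\<in>?R. 0 < ht e \<and> ht e \<le> l + 1" "\<exists>e\<in>?R. ht e = l + 1"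
      "\<forall>e\<in>?R. \<forall>f\<in>?R. e + f \<in> ?R \<longrightarrow> ht e < (ht (e + f) :: nat)"
      "\<forall>e\<in>?R. 1 < ht e \<longrightarrow> (\<exists>f\<in>?R. \<exists>g\<in>?R. e = f + g \<and> Suc (ht f) = ht e)"
  proof (rule root_graph_heights[of ?R lex_negative])
    show "finite ?R" by (rule finite_positive_roots)
    show "?R \<noteq> {}" by (rule positive_roots_nonempty[OF \<open>0 < n\<close>])
  qed (use lex_negative_root lex_negative_add lex_negative_irrefl that in blast)+
  interpret graded_radiant_fan \<Sigma> m n p q a r c v ht
    by unfold_locales (use ht in auto)
  obtain e0 where "e0 \<in> ?R" "ht e0 = l + 1" using ht(2) by blast
  then have "has_nilpotency_class
      (U_max \<Sigma> m p v :: (('n, 'k) toric_point \<Rightarrow> ('n, 'k) toric_point) monoid) (l + 1)"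
    using ht(1) by (intro nilpotency_class_eq_max_height) auto
  then show ?thesis using l by blast
qed

end
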